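(* Let $r>a\ge 1$ be coprime integers, $G=\frac1r(1,a)$, $\frac ra=[\alpha_1,\dots,\alpha_n]$, and let $T_{r,a}=\bigoplus_{p=1}^{n+1}S_{i_p}$. Then there is an isomorphism of rings $$A_{r,a}\cong \mathrm{End}_{\mathbb{C}[x,y]^G}(T_{r,a}),$$ where $A_{r,a}$ is the reconstruction algebra associated to $G$.
   Context: Ground field $\mathbb{C}$. Products are read left to right: for paths, $pq$ means $p$ followed by $q$; likewise in the endomorphism ring $fg$ means $f$ followed by $g$. Group. $G=\frac1r(1,a)=\langle\zeta\rangle\le GL(2,\mathbb{C})$, $\zeta=\mathrm{diag}(\varepsilon,\varepsilon^a)$, $\varepsilon$ a primitive $r$-th root of unity, acting on $\mathbb{C}[x,y]$ by $\zeta x=\varepsilon x$, $\zeta y=\varepsilon^a y$. Write $\frac ra=[\alpha_1,\dots,\alpha_n]:=\alpha_1-\frac{1}{\alpha_2-\frac{1}{\alpha_3-\cdots}}$ with all $\alpha_i\ge2$ (Jung–Hirzebruch continued fraction). Modules. For $t\in\mathbb{Z}$ (index mod $r$), $S_t=\{f\in\mathbb{C}[x,y]:\zeta f=\varepsilon^t f\}$, a module over $\mathbb{C}[x,y]^G=S_0$. The $i$-series is $i_0=r$, $i_1=a$, $i_t=\alpha_{t-1}i_{t-1}-i_{t-2}$ for $2\le t\le n+1$; thus $i_n=1$, $i_{n+1}=0$. Reconstruction algebra. $A_{r,a}$ is the path algebra over $\mathbb{C}$ of the following quiver $Q$ modulo the following relations. Put $\gamma=\sum_{i=1}^n(\alpha_i-2)$.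 If $n=1$: vertices $0,1$; arrows $a_1,a_2:0\to1$; $c_1,c_2:1\to0$; $k_1,\dots,k_{\alpha_1-2}:1\to0$. Relations: $c_2a_1=c_1a_2$, $a_1c_2=a_2c_1$; (if $\alpha_1>2$) $k_1a_1=c_2a_2$, $a_1k_1=a_2c_2$; $k_ta_1=k_{t-1}a_2$, $a_1k_t=a_2k_{t-1}$ for $2\le t\le\alpha_1-2$. If $n\ge2$: vertices $0,1,\dots,n$; clockwise arrows $c_{0n}:0\to n$ and $c_{t,t-1}:t\to t-1$ ($1\le t\le n$); anticlockwise arrows $a_{t,t+1}:t\to t+1$ ($0\le t\le n-1$) and $a_{n0}:n\to0$; and for each $1\le i\le n$, $\alpha_i-2$ extra arrows $i\to0$; the extra arrows are labelled $k_1,\dots,k_\gamma$ with weakly increasing tails. Put $k_0:=c_{10}$, $k_{\gamma+1}:=a_{n0}$. Let $l_s$ be the tail of $k_s$, $u_i=\max\{j:l_j=i\}$, $v_i=\min\{j:l_j=i\}$, $V_1=0$, $V_i=\max\{j:l_j<i\}$ for $2\le i\le n$. For $i\ne j$, $C_{ij}$ (resp. $A_{ij}$) is the shortest path from $i$ to $j$ consisting of clockwise (resp. anticlockwise) arrows. Relations: Step 1: if $\alpha_1=2$: $c_{10}a_{01}=a_{12}c_{21}$. If $\alpha_1>2$: $k_sa_{01}=k_{s+1}C_{01}$ and $a_{01}k_s=C_{01}k_{s+1}$ for $0\le s<u_1$; $k_{u_1}a_{01}=a_{12}c_{21}$. Step $t$ ($1<t<n$): if $\alpha_t=2$: $c_{t,t-1}a_{t-1,t}=a_{t,t+1}c_{t+1,t}$.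 If $\alpha_t>2$: $c_{t,t-1}a_{t-1,t}=k_{v_t}C_{0t}$; $C_{0t}k_{v_t}=A_{0l_{V_t}}k_{V_t}$; $k_sA_{0t}=k_{s+1}C_{0t}$ and $A_{0t}k_s=C_{0t}k_{s+1}$ for $v_t\le s<u_t$; $k_{u_t}A_{0t}=a_{t,t+1}c_{t+1,t}$. Step $n$: if $\alpha_n=2$: $c_{n,n-1}a_{n-1,n}=a_{n0}c_{0n}$; $c_{0n}a_{n0}=A_{0l_{V_n}}k_{V_n}$. If $\alpha_n>2$: $c_{n,n-1}a_{n-1,n}=k_{v_n}c_{0n}$; $c_{0n}k_{v_n}=A_{0l_{V_n}}k_{V_n}$; $k_sA_{0n}=k_{s+1}c_{0n}$ and $A_{0n}k_s=c_{0n}k_{s+1}$ for $v_n\le s<u_n$. *)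

theory Defs
  imports
    "HOL-Analysis.Analysis"
    "HOL-Algebra.QuotRing"
    "HOL-Algebra.Generated_Groups"
    "HOL-Algebra.Module"
    "HOL-Library.Poly_Mapping"
    "Graph_Theory.Arc_Walk"
begin

section \<open>The group \<open>1/r (1, a)\<close> acting on \<open>\<complex>[x, y]\<close>\<close>

definition primitive_root_of_unity :: "nat \<Rightarrow> complex \<Rightarrow> bool" where
  "primitive_root_of_unity r \<epsilon> \<longleftrightarrow> 0 < r \<and> \<epsilon> ^ r = 1 \<and> (\<forall>k. 0 < k \<and> k < r \<longrightarrow> \<epsilon> ^ k \<noteq> 1)"

definition GL2 :: "(complex ^ 2 ^ 2) monoid" where
  "GL2 = \<lparr>carrier = {g. invertible g}, mult = (\<lambda>g h. g ** h), one = mat 1\<rparr>"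

definition zeta :: "nat \<Rightarrow> complex \<Rightarrow> complex ^ 2 ^ 2" where
  "zeta a \<epsilon> = vector [vector [\<epsilon>, 0], vector [0, \<epsilon> ^ a]]"

definition cyclic_G :: "nat \<Rightarrow> complex \<Rightarrow> (complex ^ 2 ^ 2) set" where
  "cyclic_G a \<epsilon> = generate GL2 {zeta a \<epsilon>}"

text \<open>
  \<open>\<complex>[x, y]\<close> is the type \<open>complex poly poly\<close>: the inner variable is \<open>x\<close>, the outer one is \<open>y\<close>.
\<close>

definition const2 :: "complex \<Rightarrow> complex poly poly" where
  "const2 c = [:[:c:]:]"

definition var_x :: "complex poly poly" where
  "var_x = [:[:0, 1:]:]"

definition var_y :: "complex poly poly" where
  "var_y = [:0, 1:]"

definition subst2 :: "complex poly poly \<Rightarrow> complex poly poly \<Rightarrow> complex poly poly \<Rightarrow> complex poly poly" where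
  "subst2 u v f = poly (map_poly (\<lambda>p. poly (map_poly const2 p) u) f) v"

text \<open>
  A matrix acts on the span of \<open>x, y\<close> through its columns, and on \<open>\<complex>[x, y]\<close> by the algebra
  homomorphism extending this.
\<close>

definition gl2_act :: "complex ^ 2 ^ 2 \<Rightarrow> complex poly poly \<Rightarrow> complex poly poly" where
  "gl2_act g = subst2 (const2 (g $ 1 $ 1) * var_x + const2 (g $ 2 $ 1) * var_y)
                      (const2 (g $ 1 $ 2) * var_x + const2 (g $ 2 $ 2) * var_y)"

definition invariant_ring :: "(complex ^ 2 ^ 2) set \<Rightarrow> complex poly poly ring" where
  "invariant_ring G = \<lparr>carrier = {f. \<forall>g\<in>G. gl2_act g f = f},
     mult = (*), one = 1, zero = 0, add = (+)\<rparr>"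


section \<open>Modules and endomorphism rings\<close>

text \<open>The fields \<open>mult\<close> and \<open>one\<close> of a module record carry no information.\<close>

definition S_mod :: "nat \<Rightarrow> complex \<Rightarrow> int \<Rightarrow> (complex poly poly, complex poly poly) module" where
  "S_mod a \<epsilon> t = \<lparr>carrier = {f. gl2_act (zeta a \<epsilon>) f = const2 (\<epsilon> powi t) * f},
     mult = undefined, one = undefined, zero = 0, add = (+), smult = (*)\<rparr>"

text \<open>For a finite index set the direct sum is the product.\<close>

definition finite_direct_sum :: "'i set \<Rightarrow> ('i \<Rightarrow> ('r, 'm) module) \<Rightarrow> ('r, 'i \<Rightarrow> 'm) module" where
  "finite_direct_sum I M = \<lparr>carrier = (\<Pi>\<^sub>E i\<in>I. carrier (M i)),
     mult = undefined, one = undefined,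
     zero = (\<lambda>i\<in>I. \<zero>\<^bsub>M i\<^esub>), add = (\<lambda>f g. \<lambda>i\<in>I. f i \<oplus>\<^bsub>M i\<^esub> g i),
     smult = (\<lambda>r f. \<lambda>i\<in>I. r \<odot>\<^bsub>M i\<^esub> f i)\<rparr>"

definition module_endos :: "('r, 's) ring_scheme \<Rightarrow> ('r, 'm, 't) module_scheme \<Rightarrow> ('m \<Rightarrow> 'm) set" where
  "module_endos R M = {f \<in> carrier M \<rightarrow>\<^sub>E carrier M.
     (\<forall>x\<in>carrier M. \<forall>y\<in>carrier M. f (x \<oplus>\<^bsub>M\<^esub> y) = f x \<oplus>\<^bsub>M\<^esub> f y) \<and>
     (\<forall>r\<in>carrier R. \<forall>x\<in>carrier M. f (r \<odot>\<^bsub>M\<^esub> x) = r \<odot>\<^bsub>M\<^esub> f x)}"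

text \<open>The product \<open>f g\<close> is \<open>f\<close> followed by \<open>g\<close>.\<close>

definition End_ring :: "('r, 's) ring_scheme \<Rightarrow> ('r, 'm, 't) module_scheme \<Rightarrow> ('m \<Rightarrow> 'm) ring" where
  "End_ring R M = \<lparr>carrier = module_endos R M,
     mult = (\<lambda>f g. compose (carrier M) g f), one = (\<lambda>x\<in>carrier M. x),
     zero = (\<lambda>x\<in>carrier M. \<zero>\<^bsub>M\<^esub>), add = (\<lambda>f g. \<lambda>x\<in>carrier M. f x \<oplus>\<^bsub>M\<^esub> g x)\<rparr>"


section \<open>Continued fractions and the module \<open>T\<close>\<close>

fun cont_frac :: "nat list \<Rightarrow> rat" where
  "cont_frac [] = undefined"
| "cont_frac [x] = of_nat x"
| "cont_frac (x # y # ys) = of_nat x - 1 / cont_frac (y # ys)"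

definition jung_hirzebruch :: "nat \<Rightarrow> nat \<Rightarrow> nat list \<Rightarrow> bool" where
  "jung_hirzebruch r a \<alpha> \<longleftrightarrow>
     \<alpha> \<noteq> [] \<and> (\<forall>x\<in>set \<alpha>. 2 \<le> x) \<and> of_nat r / of_nat a = cont_frac \<alpha>"

text \<open>\<open>\<alpha>\<^sub>i\<close> is \<open>\<alpha> ! (i - 1)\<close>.\<close>

fun i_series :: "nat \<Rightarrow> nat \<Rightarrow> nat list \<Rightarrow> nat \<Rightarrow> int" where
  "i_series r a \<alpha> 0 = int r"
| "i_series r a \<alpha> (Suc 0) = int a"
| "i_series r a \<alpha> (Suc (Suc t)) = int (\<alpha> ! t) * i_series r a \<alpha> (Suc t) - i_series r a \<alpha> t"

definition T_mod ::
  "nat \<Rightarrow> nat \<Rightarrow> complex \<Rightarrow> nat list \<Rightarrow> (complex poly poly, nat \<Rightarrow> complex poly poly) module" where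
  "T_mod r a \<epsilon> \<alpha> =
     finite_direct_sum {1..length \<alpha> + 1} (\<lambda>p. S_mod a \<epsilon> (i_series r a \<alpha> p))"


section \<open>Path algebras\<close>

text \<open>
  A quiver is a \<open>pre_digraph\<close>; a path is a triple of its start vertex, its list of arrows and its
  end vertex.  The path \<open>p q\<close> is \<open>p\<close> followed by \<open>q\<close>.
\<close>

type_synonym ('v, 'e) path = "'v \<times> 'e list \<times> 'v"

definition paths :: "('v, 'e) pre_digraph \<Rightarrow> ('v, 'e) path set" where
  "paths Q = {(u, p, v). pre_digraph.awalk Q u p v}"

definition path_mult ::
  "(('v, 'e) path \<Rightarrow>\<^sub>0 complex) \<Rightarrow> (('v, 'e) path \<Rightarrow>\<^sub>0 complex) \<Rightarrow> (('v, 'e) path \<Rightarrow>\<^sub>0 complex)" where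
  "path_mult f g = (\<Sum>(u, p, v)\<in>Poly_Mapping.keys f. \<Sum>(u', q, w)\<in>Poly_Mapping.keys g.
     if v = u'
     then Poly_Mapping.single (u, p @ q, w) (Poly_Mapping.lookup f (u, p, v) * Poly_Mapping.lookup g (u', q, w))
     else 0)"

definition path_algebra :: "('v, 'e) pre_digraph \<Rightarrow> (('v, 'e) path \<Rightarrow>\<^sub>0 complex) ring" where
  "path_algebra Q = \<lparr>carrier = {f. Poly_Mapping.keys f \<subseteq> paths Q},
     mult = path_mult, one = (\<Sum>v\<in>verts Q. Poly_Mapping.single (v, [], v) 1),
     zero = 0, add = (+)\<rparr>"

text \<open>The element of the path algebra given by a nonempty path.\<close>

definition path_elem :: "('v, 'e) pre_digraph \<Rightarrow> 'e list \<Rightarrow> (('v, 'e) path \<Rightarrow>\<^sub>0 complex)" where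
  "path_elem Q p = Poly_Mapping.single (tail Q (hd p), p, head Q (last p)) 1"

text \<open>Relations \<open>p = q\<close> are given as pairs \<open>(p, q)\<close> of nonempty arrow lists.\<close>

definition path_algebra_mod_relations ::
  "('v, 'e) pre_digraph \<Rightarrow> ('e list \<times> 'e list) set \<Rightarrow> (('v, 'e) path \<Rightarrow>\<^sub>0 complex) set ring" where
  "path_algebra_mod_relations Q rels =
     path_algebra Q Quot
       genideal (path_algebra Q) ((\<lambda>(p, q). path_elem Q p - path_elem Q q) ` rels)"


section \<open>The reconstruction algebra\<close>

text \<open>
  For \<open>n \<ge> 2\<close> the arrows \<open>c\<^sub>i\<^sub>j\<close>, \<open>a\<^sub>i\<^sub>j\<close> are \<open>ar_c i j\<close>, \<open>ar_a i j\<close>; for \<open>n = 1\<close> the double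
  arrows \<open>c\<^sub>1, c\<^sub>2\<close> and \<open>a\<^sub>1, a\<^sub>2\<close> are \<open>dbl_c 1\<close>, \<open>dbl_c 2\<close>, \<open>dbl_a 1\<close>, \<open>dbl_a 2\<close>.
  In both cases the extra arrow \<open>k\<^sub>s\<close> is \<open>ar_k s\<close>.
\<close>

datatype arrow = ar_c nat nat | ar_a nat nat | ar_k nat | dbl_c nat | dbl_a nat

definition extra_tails :: "nat list \<Rightarrow> nat list" where
  "extra_tails \<alpha> = concat (map (\<lambda>i. replicate (\<alpha> ! (i - 1) - 2) i) [1..<length \<alpha> + 1])"

definition gam :: "nat list \<Rightarrow> nat" where
  "gam \<alpha> = (\<Sum>i = 1..length \<alpha>. \<alpha> ! (i - 1) - 2)"

text \<open>
  \<open>tail_k \<alpha> s\<close> is \<open>l\<^sub>s\<close>; the first and last clauses reflect \<open>k\<^sub>0 = c\<^sub>1\<^sub>0\<close> and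
  \<open>k\<^bsub>\<gamma>+1\<^esub> = a\<^bsub>n0\<^esub>\<close>.
\<close>

definition tail_k :: "nat list \<Rightarrow> nat \<Rightarrow> nat" where
  "tail_k \<alpha> s = (if s = 0 then 1 else if s \<le> gam \<alpha> then extra_tails \<alpha> ! (s - 1) else length \<alpha>)"

definition cw_arrows :: "nat list \<Rightarrow> arrow set" where
  "cw_arrows \<alpha> = insert (ar_c 0 (length \<alpha>)) ((\<lambda>t. ar_c t (t - 1)) ` {1..length \<alpha>})"

definition acw_arrows :: "nat list \<Rightarrow> arrow set" where
  "acw_arrows \<alpha> = insert (ar_a (length \<alpha>) 0) ((\<lambda>t. ar_a t (t + 1)) ` {0..<length \<alpha>})"

definition recon_arrows :: "nat list \<Rightarrow> arrow set" where
  "recon_arrows \<alpha> =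
     (if length \<alpha> = 1 then {dbl_a 1, dbl_a 2, dbl_c 1, dbl_c 2} else cw_arrows \<alpha> \<union> acw_arrows \<alpha>)
     \<union> ar_k ` {1..gam \<alpha>}"

fun arrow_tail :: "nat list \<Rightarrow> arrow \<Rightarrow> nat" where
  "arrow_tail \<alpha> (ar_c i j) = i"
| "arrow_tail \<alpha> (ar_a i j) = i"
| "arrow_tail \<alpha> (ar_k s) = tail_k \<alpha> s"
| "arrow_tail \<alpha> (dbl_c t) = 1"
| "arrow_tail \<alpha> (dbl_a t) = 0"

fun arrow_head :: "arrow \<Rightarrow> nat" where
  "arrow_head (ar_c i j) = j"
| "arrow_head (ar_a i j) = j"
| "arrow_head (ar_k s) = 0"
| "arrow_head (dbl_c t) = 0"
| "arrow_head (dbl_a t) = 1"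

definition recon_quiver :: "nat list \<Rightarrow> (nat, arrow) pre_digraph" where
  "recon_quiver \<alpha> = \<lparr>verts = {0..length \<alpha>}, arcs = recon_arrows \<alpha>,
     tail = arrow_tail \<alpha>, head = arrow_head\<rparr>"

text \<open>The arrow \<open>k\<^sub>s\<close> for \<open>0 \<le> s \<le> \<gamma> + 1\<close>, used for \<open>n \<ge> 2\<close> only.\<close>

definition kk :: "nat list \<Rightarrow> nat \<Rightarrow> arrow" where
  "kk \<alpha> s = (if s = 0 then ar_c 1 0 else if s \<le> gam \<alpha> then ar_k s else ar_a (length \<alpha>) 0)"

text \<open>
  In the following three definitions the index \<open>j\<close> of \<open>l\<^sub>j\<close> ranges over \<open>0, \<dots>, \<gamma> + 1\<close>, so that
  for example \<open>u\<^sub>n = \<gamma> + 1\<close>.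
\<close>

definition u_ind :: "nat list \<Rightarrow> nat \<Rightarrow> nat" where
  "u_ind \<alpha> i = Max {j. j \<le> gam \<alpha> + 1 \<and> tail_k \<alpha> j = i}"

definition v_ind :: "nat list \<Rightarrow> nat \<Rightarrow> nat" where
  "v_ind \<alpha> i = Min {j. j \<le> gam \<alpha> + 1 \<and> tail_k \<alpha> j = i}"

definition V_ind :: "nat list \<Rightarrow> nat \<Rightarrow> nat" where
  "V_ind \<alpha> i = (if i = 1 then 0 else Max {j. j \<le> gam \<alpha> + 1 \<and> tail_k \<alpha> j < i})"

text \<open>
  Shortest clockwise and anticlockwise paths from \<open>i\<close> to \<open>j\<close>, meaningful for \<open>n \<ge> 2\<close> and
  \<open>i \<noteq> j\<close>: then a path of minimal length is unique.
\<close>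

definition C_path :: "nat list \<Rightarrow> nat \<Rightarrow> nat \<Rightarrow> arrow list" where
  "C_path \<alpha> i j =
     (ARG_MIN length p. pre_digraph.awalk (recon_quiver \<alpha>) i p j \<and> set p \<subseteq> cw_arrows \<alpha>)"

definition A_path :: "nat list \<Rightarrow> nat \<Rightarrow> nat \<Rightarrow> arrow list" where
  "A_path \<alpha> i j =
     (ARG_MIN length p. pre_digraph.awalk (recon_quiver \<alpha>) i p j \<and> set p \<subseteq> acw_arrows \<alpha>)"

definition rels_n1 :: "nat list \<Rightarrow> (arrow list \<times> arrow list) set" where
  "rels_n1 \<alpha> =
     {([dbl_c 2, dbl_a 1], [dbl_c 1, dbl_a 2]),
      ([dbl_a 1, dbl_c 2], [dbl_a 2, dbl_c 1])}
     \<union> (if \<alpha> ! 0 > 2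
        then {([ar_k 1, dbl_a 1], [dbl_c 2, dbl_a 2]), ([dbl_a 1, ar_k 1], [dbl_a 2, dbl_c 2])}
        else {})
     \<union> {([ar_k t, dbl_a 1], [ar_k (t - 1), dbl_a 2]) | t. 2 \<le> t \<and> t \<le> \<alpha> ! 0 - 2}
     \<union> {([dbl_a 1, ar_k t], [dbl_a 2, ar_k (t - 1)]) | t. 2 \<le> t \<and> t \<le> \<alpha> ! 0 - 2}"

definition rels_first :: "nat list \<Rightarrow> (arrow list \<times> arrow list) set" where
  "rels_first \<alpha> =
     (if \<alpha> ! 0 = 2 then {([ar_c 1 0, ar_a 0 1], [ar_a 1 2, ar_c 2 1])}
      else {(kk \<alpha> s # [ar_a 0 1], kk \<alpha> (s + 1) # C_path \<alpha> 0 1) | s. s < u_ind \<alpha> 1}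
         \<union> {([ar_a 0 1, kk \<alpha> s], C_path \<alpha> 0 1 @ [kk \<alpha> (s + 1)]) | s. s < u_ind \<alpha> 1}
         \<union> {([kk \<alpha> (u_ind \<alpha> 1), ar_a 0 1], [ar_a 1 2, ar_c 2 1])})"

definition rels_middle :: "nat list \<Rightarrow> nat \<Rightarrow> (arrow list \<times> arrow list) set" where
  "rels_middle \<alpha> t =
     (if \<alpha> ! (t - 1) = 2
      then {([ar_c t (t - 1), ar_a (t - 1) t], [ar_a t (t + 1), ar_c (t + 1) t])}
      else {([ar_c t (t - 1), ar_a (t - 1) t], kk \<alpha> (v_ind \<alpha> t) # C_path \<alpha> 0 t),
            (C_path \<alpha> 0 t @ [kk \<alpha> (v_ind \<alpha> t)],
             A_path \<alpha> 0 (tail_k \<alpha> (V_ind \<alpha> t)) @ [kk \<alpha> (V_ind \<alpha> t)])}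
         \<union> {(kk \<alpha> s # A_path \<alpha> 0 t, kk \<alpha> (s + 1) # C_path \<alpha> 0 t)
              | s. v_ind \<alpha> t \<le> s \<and> s < u_ind \<alpha> t}
         \<union> {(A_path \<alpha> 0 t @ [kk \<alpha> s], C_path \<alpha> 0 t @ [kk \<alpha> (s + 1)])
              | s. v_ind \<alpha> t \<le> s \<and> s < u_ind \<alpha> t}
         \<union> {(kk \<alpha> (u_ind \<alpha> t) # A_path \<alpha> 0 t, [ar_a t (t + 1), ar_c (t + 1) t])})"

definition rels_last :: "nat list \<Rightarrow> (arrow list \<times> arrow list) set" where
  "rels_last \<alpha> = (let n = length \<alpha> in
     if \<alpha> ! (n - 1) = 2
     then {([ar_c n (n - 1), ar_a (n - 1) n], [ar_a n 0, ar_c 0 n]),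
           ([ar_c 0 n, ar_a n 0], A_path \<alpha> 0 (tail_k \<alpha> (V_ind \<alpha> n)) @ [kk \<alpha> (V_ind \<alpha> n)])}
     else {([ar_c n (n - 1), ar_a (n - 1) n], [kk \<alpha> (v_ind \<alpha> n), ar_c 0 n]),
           ([ar_c 0 n, kk \<alpha> (v_ind \<alpha> n)],
            A_path \<alpha> 0 (tail_k \<alpha> (V_ind \<alpha> n)) @ [kk \<alpha> (V_ind \<alpha> n)])}
         \<union> {(kk \<alpha> s # A_path \<alpha> 0 n, [kk \<alpha> (s + 1), ar_c 0 n])
              | s. v_ind \<alpha> n \<le> s \<and> s < u_ind \<alpha> n}
         \<union> {(A_path \<alpha> 0 n @ [kk \<alpha> s], [ar_c 0 n, kk \<alpha> (s + 1)])
              | s. v_ind \<alpha> n \<le> s \<and> s < u_ind \<alpha> n})"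

definition recon_relations :: "nat list \<Rightarrow> (arrow list \<times> arrow list) set" where
  "recon_relations \<alpha> =
     (if length \<alpha> = 1 then rels_n1 \<alpha>
      else rels_first \<alpha> \<union> (\<Union>t\<in>{1<..<length \<alpha>}. rels_middle \<alpha> t) \<union> rels_last \<alpha>)"

definition reconstruction_algebra :: "nat list \<Rightarrow> ((nat, arrow) path \<Rightarrow>\<^sub>0 complex) set ring" where
  "reconstruction_algebra \<alpha> = path_algebra_mod_relations (recon_quiver \<alpha>) (recon_relations \<alpha>)"

end

theory Submission
  imports Defs "HOL-Number_Theory.Cong"
begin

text \<open>
  A homomorphism \<open>S\<^sub>s \<rightarrow> S\<^sub>t\<close> is multiplication by an element of \<open>S\<^bsub>t-s\<^esub>\<close>, so \<open>End(T)\<close> is a ring of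
  matrices of polynomials with a basis of matrix units times monomials.  Send the vertex \<open>t\<close> to
  \<open>S\<^bsub>i\<^sub>t\<^esub>\<close> and every arrow to a monomial: \<open>c\<^bsub>t,t-1\<^esub>\<close> to a power of \<open>x\<close>, \<open>a\<^bsub>t,t+1\<^esub>\<close> to a power of \<open>y\<close>, the
  extra arrows to mixed monomials.  All relations equate paths with the same monomial, so it remains
  to see that between two vertices (i) every monomial of the right weight is the monomial of a path
  and (ii) two paths with the same monomial are equal modulo the relations.

  Put \<open>e\<^sub>t = (i\<^sub>t, -j\<^sub>t)\<close> with \<open>j\<^sub>0 = 0, j\<^sub>1 = 1\<close> and the recursion of the \<open>i\<close>-series.  Neighbouring
  \<open>e\<^sub>t\<close> form a basis of the lattice of invariant Laurent monomials, and so do neighbouring points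
  of the sequence \<open>e\<^bsub>t-1\<^esub> - m e\<^sub>t\<close>; hence certain boxes contain no nonzero invariant monomial.
  This gives (i): a nontrivial monomial leaving a vertex is divisible by an arrow leaving it.  For
  (ii), order the arrows at a vertex \<open>t \<noteq> 0\<close> by slope.  The relation between neighbouring arrows has
  as its monomial exactly their least common multiple, so by (i) and induction on the degree two
  paths can be compared by exchanging the first arrow for a neighbouring one.  At vertex \<open>0\<close>, whose
  arrows are \<open>x\<close> and \<open>y\<close>, the same works because every monomial divisible by \<open>xy\<close> that leaves it is
  divisible by an invariant which has a relation.
\<close>

section \<open>Continued fractions and the lattice of invariant monomials\<close>

text \<open>A monomial leaving vertex \<open>k + 1\<close> that no arrow divides lies below the
  staircase whose corners are the arrow weights, so its exponents are below \<open>fX k m\<close>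
  and \<open>fY k m\<close> for some \<open>m\<close>. It is not itself invariant but leads to the
  module with index \<open>i_q\<close>. Multiplying it by \<open>x^(i_{k+1} - i_q)\<close> or by
  \<open>y^(j_{k+1} - j_q)\<close>, whichever exponent is nonnegative, makes it invariant and keeps
  it inside a box cut out by two neighbouring points \<open>u\<close>, \<open>v\<close> of the
  sequence \<open>e_k - m e_{k+1}\<close>. Since \<open>u\<close>, \<open>v\<close> span the lattice
  and \<open>v\<close> lies to the upper left of \<open>u\<close>, a discussion of signs empties the
  box \<open>[0, u1) x [0, v2)\<close>.

  Vertex 0 is the obstacle: the least common multiple \<open>xy\<close> of its two arrows is in
  general not the monomial of a relation. Its relations have the minimal invariants other than
  \<open>x^r\<close> and \<open>y^r\<close> as monomials, and the same empty boxes show that these,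
  taken in order of slope, leave no gap.

  The cases \<open>n = 1\<close> and \<open>n \<ge> 2\<close> name their arrows differently. One
  numbering, arrow \<open>m\<close> at vertex \<open>k + 1\<close>, and relations indexed by
  \<open>(k, m)\<close> let a single argument serve both.\<close>

lemma cont_frac_gt_1:
  "xs \<noteq> [] \<Longrightarrow> \<forall>x\<in>set xs. 2 \<le> x \<Longrightarrow> 1 < cont_frac xs"
proof (induction xs rule: cont_frac.induct)
  case (3 x y ys)
  then have "1 < cont_frac (y # ys)" by simp
  then have "1 / cont_frac (y # ys) < 1" by simp
  moreover have "2 \<le> (of_nat x :: rat)"
    using 3 by (metis list.set_intros(1) of_nat_le_iff of_nat_numeral)
  ultimately show ?case by simp
qed (auto simp: of_nat_numeral)

text \<open>Chosen so that \<open>a * j_t\<close> is congruent to \<open>i_t\<close> modulo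
  \<open>r\<close>; thus \<open>x^(i_t)\<close> and \<open>y^(j_t)\<close> have the same
  character.\<close>

fun j_series :: "nat list \<Rightarrow> nat \<Rightarrow> int" where
  "j_series \<alpha> 0 = 0"
| "j_series \<alpha> (Suc 0) = 1"
| "j_series \<alpha> (Suc (Suc t)) = int (\<alpha> ! t) * j_series \<alpha> (Suc t) - j_series \<alpha> t"

locale hj_fraction =
  fixes r a :: nat and \<alpha> :: "nat list"
  assumes a_ge_1: "1 \<le> a" and a_less_r: "a < r" and coprime_r_a: "coprime r a"
    and jh: "jung_hirzebruch r a \<alpha>"
begin

abbreviation n where "n \<equiv> length \<alpha>"
abbreviation I where "I \<equiv> i_series r a \<alpha>"
abbreviation J where "J \<equiv> j_series \<alpha>"

lemma n_ge_1: "1 \<le> n"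
  using jh by (cases \<alpha>) (auto simp: jung_hirzebruch_def)

lemma alpha_ge_2: "k < n \<Longrightarrow> 2 \<le> \<alpha> ! k"
  using jh by (auto simp: jung_hirzebruch_def)

text \<open>The recursion is the Euclidean algorithm with quotients rounded up, so each consecutive
  quotient is a tail of the continued fraction. Positivity is carried along because the next
  quotient can be formed only once its denominator is known to be nonzero.\<close>

lemma I_quotient:
  "k < n \<Longrightarrow> 0 < I (Suc k) \<and> of_int (I k) / of_int (I (Suc k)) = cont_frac (drop k \<alpha>)"
proof (induction k)
  case 0
  then show ?case using jh a_ge_1 by (auto simp: jung_hirzebruch_def)
next
  case (Suc k)
  let ?i = "rat_of_int (I (Suc k))" and ?c = "cont_frac (drop (Suc k) \<alpha>)"
  have pos: "0 < ?i" and q: "of_int (I k) / ?i = cont_frac (drop k \<alpha>)"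
    using Suc by auto
  have c: "1 < ?c"
    using Suc.prems by (intro cont_frac_gt_1) (auto dest!: in_set_dropD simp: alpha_ge_2 in_set_conv_nth)
  have "drop k \<alpha> = \<alpha> ! k # drop (Suc k) \<alpha>" "drop (Suc k) \<alpha> = \<alpha> ! Suc k # drop (Suc (Suc k)) \<alpha>"
    using Suc.prems by (simp_all add: Cons_nth_drop_Suc)
  then have "cont_frac (drop k \<alpha>) = of_nat (\<alpha> ! k) - 1 / ?c"
    by simp
  then have "of_int (I k) = of_nat (\<alpha> ! k) * ?i - ?i / ?c"
    using q pos by (simp add: divide_eq_eq left_diff_distrib)
  then have e: "of_int (I (Suc (Suc k))) = ?i / ?c"
    by simp
  have "0 < ?i / ?c" using pos c by simp
  then have "0 < I (Suc (Suc k))" using e by (metis of_int_0_less_iff)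
  moreover have "of_int (I (Suc k)) / of_int (I (Suc (Suc k))) = ?c"
    unfolding e using pos c by simp
  ultimately show ?case by blast
qed

lemma I_pos: "k \<le> n \<Longrightarrow> 0 < I k"
  using I_quotient[of "k - 1"] a_ge_1 a_less_r by (cases k) auto

lemma I_Suc_n: "I (Suc n) = 0"
proof -
  obtain k where k: "n = Suc k" using n_ge_1 by (cases n) auto
  have "drop k \<alpha> = [\<alpha> ! k]" using k by (simp add: Cons_nth_drop_Suc[symmetric])
  then have "of_int (I k) / of_int (I (Suc k)) = (of_nat (\<alpha> ! k) :: rat)" "0 < I (Suc k)"
    using I_quotient[of k] k by auto
  then have "of_int (I k) = (of_int (int (\<alpha> ! k) * I (Suc k)) :: rat)"
    by (simp add: field_simps)
  then have "I k = int (\<alpha> ! k) * I (Suc k)"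
    by (simp only: of_int_eq_iff)
  then show ?thesis using k by simp
qed

lemma I_strict: "k \<le> n \<Longrightarrow> I (Suc k) < I k"
proof (cases "k = n")
  case True
  then show ?thesis using I_Suc_n I_pos by simp
next
  case False
  assume "k \<le> n"
  with False have k: "k < n" by simp
  have "1 < cont_frac (drop k \<alpha>)"
    using k by (intro cont_frac_gt_1) (auto dest!: in_set_dropD simp: alpha_ge_2 in_set_conv_nth)
  then have "1 < rat_of_int (I k) / of_int (I (Suc k))" "0 < rat_of_int (I (Suc k))"
    using I_quotient[OF k] by auto
  then show ?thesis by (simp add: field_simps)
qed

lemma I_less: "k < l \<Longrightarrow> l \<le> Suc n \<Longrightarrow> I l < I k"
proof (induction l)
  case (Suc l)
  then show ?case using I_strict[of l] by (cases "k = l") auto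
qed simp

lemma I_le: "k \<le> l \<Longrightarrow> l \<le> Suc n \<Longrightarrow> I l \<le> I k"
  using I_less[of k l] by (cases "k = l") auto

lemma I_nonneg: "k \<le> Suc n \<Longrightarrow> 0 \<le> I k"
  using I_le[of k "Suc n"] I_Suc_n by simp

lemma J_strict: "k \<le> n \<Longrightarrow> 0 \<le> J k \<and> J k < J (Suc k)"
proof (induction k)
  case (Suc k)
  then have "J k < J (Suc k)" "0 \<le> J k" by auto
  moreover have "2 * J (Suc k) \<le> int (\<alpha> ! k) * J (Suc k)"
    using alpha_ge_2[of k] Suc calculation by (intro mult_right_mono) auto
  ultimately show ?case unfolding j_series.simps by linarith
qed simp

lemma J_less: "k < l \<Longrightarrow> l \<le> Suc n \<Longrightarrow> J k < J l"
proof (induction l)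
  case (Suc l)
  then show ?case using J_strict[of l] by (cases "k = l") auto
qed simp

lemma J_le: "k \<le> l \<Longrightarrow> l \<le> Suc n \<Longrightarrow> J k \<le> J l"
  using J_less[of k l] by (cases "k = l") auto

lemma J_nonneg: "k \<le> Suc n \<Longrightarrow> 0 \<le> J k"
  using J_le[of 0 k] by simp

text \<open>The recursion preserves the gcd of neighbours, which starts as
  \<open>gcd r a = 1\<close> and ends as the gcd of \<open>I n\<close> and 0.\<close>

lemma I_n: "I n = 1"
proof -
  have g: "gcd (I k) (I (Suc k)) = 1" if "k \<le> n" for k
    using that
  proof (induction k)
    case 0
    then show ?case using coprime_r_a by (simp add: coprime_iff_gcd_eq_1)
  next
    case (Suc k)
    then have "gcd (I (Suc k)) (I k) = 1" by (simp add: gcd.commute)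
    moreover have "gcd (I (Suc k)) (int (\<alpha> ! k) * I (Suc k) - I k) = gcd (I (Suc k)) (I k)"
      by (metis gcd_add_mult gcd_neg2 minus_diff_eq uminus_add_conv_diff add.commute)
    ultimately show ?case by simp
  qed
  show "I n = 1" using g[of n] I_Suc_n I_pos[of n] by simp
qed

lemmas I_rec = i_series.simps(3)[of r a \<alpha>] and J_rec = j_series.simps(3)[of \<alpha>]
declare i_series.simps(3) [simp del] j_series.simps(3) [simp del]

text \<open>\<open>lat X Y\<close>: the Laurent monomial \<open>x\<^sup>X y\<^sup>Y\<close> is invariant.\<close>

definition lat :: "int \<Rightarrow> int \<Rightarrow> bool" where
  "lat X Y \<longleftrightarrow> int r dvd X + int a * Y"

lemma lat_add: "lat X Y \<Longrightarrow> lat X' Y' \<Longrightarrow> lat (X + X') (Y + Y')"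
  unfolding lat_def using dvd_add[of "int r" "X + int a * Y" "X' + int a * Y'"]
  by (simp add: algebra_simps)

lemma lat_diff: "lat X Y \<Longrightarrow> lat X' Y' \<Longrightarrow> lat (X - X') (Y - Y')"
  unfolding lat_def using dvd_diff[of "int r" "X + int a * Y" "X' + int a * Y'"]
  by (simp add: algebra_simps)

lemma lat_mult: "lat X Y \<Longrightarrow> lat (c * X) (c * Y)"
  unfolding lat_def using dvd_mult[of "int r" "X + int a * Y" c]
  by (simp add: algebra_simps)

lemma lat_I_J: "lat (I k) (- J k)"
proof (induction k rule: less_induct)
  case (less k)
  consider "k = 0" | "k = 1" | t where "k = Suc (Suc t)"
    by (metis One_nat_def not0_implies_Suc)
  then show ?case
  proof cases
    case (3 t)
    then show ?thesis
      using lat_diff[OF lat_mult[OF less[of "Suc t"], of "int (\<alpha> ! t)"] less[of t]]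
      by (simp add: I_rec J_rec)
  qed (auto simp: lat_def)
qed

text \<open>The vectors \<open>(r, 0)\<close> and \<open>(a, -1)\<close> span the lattice, and
  \<open>e_k = (\<alpha> ! k) e_{k+1} - e_{k+2}\<close> passes from one neighbouring pair to the
  next.\<close>

lemma lat_basis:
  "lat X Y \<Longrightarrow> \<exists>A B. X = A * I k + B * I (Suc k) \<and> Y = - A * J k - B * J (Suc k)"
proof (induction k)
  case 0
  then obtain q where "X + int a * Y = int r * q" by (auto simp: lat_def)
  then show ?case by (intro exI[of _ q] exI[of _ "- Y"]) (simp add: algebra_simps)
next
  case (Suc k)
  then obtain A B where "X = A * I k + B * I (Suc k)" "Y = - A * J k - B * J (Suc k)"
    by blast
  then show ?case
    by (intro exI[of _ "B + int (\<alpha> ! k) * A"] exI[of _ "- A"])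
      (simp add: I_rec J_rec algebra_simps)
qed

text \<open>Think of vectors \<open>u\<close>, \<open>v\<close> with \<open>v\<close> to the upper
  left of \<open>u\<close>. Coefficients of equal sign make a coordinate negative or too large; the
  disjunction among the hypotheses prevents \<open>u + v\<close> from falling into the box. With
  opposite signs, nonnegativity of one coordinate makes the positive coefficient the larger one in
  absolute value, and then the other coordinate is too large.\<close>

lemma box_lemma:
  fixes u1 u2 v1 v2 :: int
  assumes "0 < u1" "0 < v2" "v1 < u1" "u2 < v2" "0 \<le> v1 \<or> 0 \<le> u2"
    and "0 \<le> A * u1 + B * v1" "A * u1 + B * v1 < u1"
    and "0 \<le> A * u2 + B * v2" "A * u2 + B * v2 < v2"
  shows "A = 0 \<and> B = 0"
proof -
  consider "A = 0" | "0 < A" "0 \<le> B" | "0 < A" "B < 0" | "A < 0" "B \<le> 0" | "A < 0" "0 < B"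
    by linarith
  then show ?thesis
  proof cases
    case 1
    then have "B * v2 < 1 * v2" "0 * v2 \<le> B * v2" using assms by auto
    then have "B < 1" "0 \<le> B" using assms(2)
      by (auto simp: mult_less_cancel_right zero_le_mult_iff)
    then show ?thesis using 1 by simp
  next
    case 2
    have "1 * u1 \<le> A * u1" using assms(1) 2 by (intro mult_right_mono) auto
    moreover have "B = 0 \<or> 1 * v2 \<le> B * v2"
      using assms(2) 2 by (cases "B = 0") (auto intro!: mult_right_mono simp del: mult_1)
    moreover have "0 \<le> B * v1 \<or> 0 \<le> A * u2" using 2 assms(5) by auto
    ultimately have False
      using assms(7,9) by (cases "B = 0") (simp, linarith)
    then show ?thesis ..
  next
    case 3
    define D where "D = - B"
    then have B: "B = - D" "0 < D" using 3 by auto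
    have le: "D * v2 \<le> A * u2" using assms(8) B by simp
    have "0 < D * v2" using B assms(2) by simp
    then have "0 < u2" using le 3 by (metis less_le_trans zero_less_mult_pos)
    then have "D * u2 < D * v2" using B assms(4) by simp
    with le have "D * u2 < A * u2" by linarith
    then have DA: "D < A" using \<open>0 < u2\<close> by (auto simp: mult_less_cancel_right)
    have "D * v1 \<le> D * u1" using B assms(3) by simp
    moreover have "1 * u1 \<le> (A - D) * u1" using DA assms(1) by (intro mult_right_mono) auto
    moreover have "A * u1 - D * v1 < u1" using assms(7) B by simp
    ultimately have False unfolding left_diff_distrib by linarith
    then show ?thesis ..
  next
    case 4
    have A: "A * u1 < 0" using 4 assms(1) by (simp add: mult_neg_pos)
    show ?thesis
    proof (cases "B = 0 \<or> 0 \<le> v1")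
      case True
      then have "B * v1 \<le> 0" using 4 by (auto simp: mult_nonpos_nonneg)
      then show ?thesis using A assms(6) by linarith
    next
      case False
      then have "B * v2 < 0" "A * u2 \<le> 0"
        using 4 assms(2,5) by (auto simp: mult_neg_pos mult_nonpos_nonneg)
      then show ?thesis using assms(8) by linarith
    qed
  next
    case 5
    define C where "C = - A"
    have e: "A = - C" "0 < C" using C_def 5 by auto
    have le: "C * u1 \<le> B * v1" using assms(6) e by simp
    have "0 < C * u1" using e assms(1) by simp
    then have "0 < v1" using le 5 by (metis less_le_trans zero_less_mult_pos)
    then have "C * v1 < C * u1" using e assms(3) by simp
    with le have "C * v1 < B * v1" by linarith
    then have CB: "C < B" using \<open>0 < v1\<close> by (auto simp: mult_less_cancel_right)
    have "C * u2 \<le> C * v2" using e assms(4) by simp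
    moreover have "1 * v2 \<le> (B - C) * v2" using CB assms(2) by (intro mult_right_mono) auto
    moreover have "B * v2 - C * u2 < v2" using assms(9) e by simp
    ultimately have False unfolding left_diff_distrib by linarith
    then show ?thesis ..
  qed
qed

text \<open>
  The point \<open>(fX k m, fY k m)\<close> is \<open>e\<^sub>k - (m + 1) e\<^bsub>k+1\<^esub>\<close> with \<open>e\<^sub>k = (I k, - J k)\<close>; for
  \<open>0 \<le> m \<le> \<alpha>\<^bsub>k+1\<^esub> - 2\<close> these points are the minimal generators of the ring of invariants other
  than \<open>x\<^sup>r\<close> and \<open>y\<^sup>r\<close>.
\<close>

definition fX :: "nat \<Rightarrow> nat \<Rightarrow> int" where "fX k m = I k - (int m + 1) * I (Suc k)"
definition fY :: "nat \<Rightarrow> nat \<Rightarrow> int" where "fY k m = (int m + 1) * J (Suc k) - J k"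

lemma lat_f: "lat (fX k m) (fY k m)"
  using lat_diff[OF lat_I_J[of k] lat_mult[OF lat_I_J[of "Suc k"], of "int m + 1"]]
  by (simp add: fX_def fY_def algebra_simps)

text \<open>This is \<open>box_lemma\<close> for \<open>u = e_k - m e_{k+1}\<close> and
  \<open>v = e_k - (m + 1) e_{k+1}\<close>. The second coordinate of \<open>u\<close> can be
  negative only for \<open>m = 0\<close>, where the first coordinate of \<open>v\<close> is
  positive; this gives the disjunction required there.\<close>

lemma empty_box:
  assumes k: "k < n" and m: "m < \<alpha> ! k" and lat: "lat X Y"
    and X: "0 \<le> X" "X < fX k m + I (Suc k)" and Y: "0 \<le> Y" "Y < fY k m"
  shows "X = 0 \<and> Y = 0"
proof -
  have IJ: "0 < I (Suc k)" "0 \<le> I (Suc (Suc k))" "I (Suc k) < I k" "I (Suc (Suc k)) < I (Suc k)"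
    "0 \<le> J k" "J k < J (Suc k)"
    using k I_pos[of "Suc k"] I_nonneg[of "Suc (Suc k)"] I_strict[of k] I_strict[of "Suc k"] J_strict[of k]
    by auto
  let ?a = "int (\<alpha> ! k)"
  have i2: "I (Suc (Suc k)) = ?a * I (Suc k) - I k" by (simp add: I_rec)
  obtain A B where AB: "X = A * I k + B * I (Suc k)" "Y = - A * J k - B * J (Suc k)"
    using lat_basis[OF lat] by blast
  define u1 where "u1 = fX k m + I (Suc k)"
  define u2 where "u2 = fY k m - J (Suc k)"
  \<comment> \<open>In terms of \<open>u\<close> and \<open>v\<close> the point has coefficients
    \<open>A - D\<close> and \<open>D\<close>; comparing the multiples of \<open>e_{k+1}\<close>
    determines \<open>D\<close>.\<close>
  define D where "D = - (B + int m * A)"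
  have X': "X = (A - D) * u1 + D * fX k m"
    by (simp add: AB u1_def D_def fX_def algebra_simps)
  have Y': "Y = (A - D) * u2 + D * fY k m"
    by (simp add: AB u2_def D_def fY_def algebra_simps)
  have "int m * I (Suc k) \<le> (?a - 1) * I (Suc k)"
    using m IJ by (intro mult_right_mono) auto
  then have u1: "0 < u1"
    using i2 IJ by (simp add: u1_def fX_def algebra_simps)
  have "0 \<le> int m * J (Suc k)" using IJ by simp
  then have v2: "0 < fY k m"
    using IJ unfolding fY_def distrib_right by linarith
  have or: "0 \<le> fX k m \<or> 0 \<le> u2"
  proof (cases m)
    case 0
    then show ?thesis using IJ by (simp add: fX_def)
  next
    case (Suc m')
    have "0 \<le> int m' * J (Suc k)" using IJ by simp
    moreover have "u2 = J (Suc k) - J k + int m' * J (Suc k)"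
      by (simp add: Suc u2_def fY_def distrib_right)
    ultimately show ?thesis using IJ by linarith
  qed
  have "A - D = 0 \<and> D = 0"
    by (rule box_lemma[of u1 "fY k m" "fX k m" u2])
      (use u1 v2 or X Y X' Y' IJ in \<open>auto simp: u1_def u2_def\<close>)
  then show ?thesis using X' Y' by simp
qed

text \<open>Each \<open>S\<^bsub>i\<^sub>q\<^esub>\<close> is generated by \<open>x\<^bsup>i\<^sub>q\<^esup>\<close> and \<open>y\<^bsup>j\<^sub>q\<^esup>\<close>.\<close>

lemma special:
  assumes q: "k < n" and lat: "lat (X - I (Suc k)) Y"
    and X: "0 \<le> X" "X < I (Suc k)" and Y: "0 \<le> Y"
  shows "J (Suc k) \<le> Y"
proof (rule ccontr)
  assume "\<not> J (Suc k) \<le> Y"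
  then have YJ: "Y < J (Suc k)" by simp
  have IJ: "0 < I (Suc k)" "I (Suc k) < I k" "I (Suc (Suc k)) < I (Suc k)" "0 \<le> I (Suc (Suc k))"
    "0 \<le> J k" "J k < J (Suc k)" "J (Suc k) < J (Suc (Suc k))"
    using q I_pos[of "Suc k"] I_strict[of k] I_strict[of "Suc k"] J_strict[of k] J_strict[of "Suc k"]
      I_nonneg[of "Suc (Suc k)"] by auto
  obtain A B where AB: "X - I (Suc k) = A * I k + B * I (Suc k)" "Y = - A * J k - B * J (Suc k)"
    using lat_basis[OF lat] by blast
  consider "A = 0" | "0 < A" | "A < 0" by linarith
  then show False
  proof cases
    case 1
    define D where "D = - B"
    have "Y = D * J (Suc k)" "X - I (Suc k) = - D * I (Suc k)" using AB 1 D_def by auto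
    moreover from this have "D * J (Suc k) < 1 * J (Suc k)" using YJ by simp
    then have "D \<le> 0" using IJ by (auto simp: mult_less_cancel_right)
    then have "0 \<le> - D * I (Suc k)" using IJ by (intro mult_nonneg_nonneg) auto
    ultimately show False using X by linarith
  next
    case 2
    define D where "D = - B"
    have e: "X = A * I k - D * I (Suc k) + I (Suc k)" "Y = D * J (Suc k) - A * J k"
      using AB D_def by auto
    have "A * I (Suc k) < A * I k" using 2 IJ by simp
    then have "A * I (Suc k) < D * I (Suc k)" using e X by linarith
    then have "A < D" using IJ by (auto simp: mult_less_cancel_right)
    then have "(A + 1) * J (Suc k) \<le> D * J (Suc k)" using IJ by (intro mult_right_mono) auto
    moreover have "A * J k \<le> A * J (Suc k)" using 2 IJ by simp
    ultimately show False using YJ e by (simp add: algebra_simps)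
  next
    case 3
    \<comment> \<open>Now \<open>e_k\<close> is traded for \<open>e_{k+2}\<close>, with positive
      coefficient \<open>C\<close>. As in the previous case one coordinate forces
      \<open>C < D\<close>, which contradicts the bound on the other one.\<close>
    define C where "C = - A"
    define D where "D = - (B + int (\<alpha> ! k) * A)"
    have e: "X = C * I (Suc (Suc k)) - D * I (Suc k) + I (Suc k)"
      "Y = D * J (Suc k) - C * J (Suc (Suc k))"
      using AB by (simp_all add: D_def C_def I_rec J_rec algebra_simps)
    have C: "0 < C" using 3 C_def by simp
    have "C * J (Suc k) < C * J (Suc (Suc k))" using C IJ by simp
    then have "C * J (Suc k) < D * J (Suc k)" using e Y by linarith
    then have "C < D" using IJ by (auto simp: mult_less_cancel_right)
    then have "(C + 1) * I (Suc k) \<le> D * I (Suc k)" using IJ by (intro mult_right_mono) auto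
    moreover have "C * I (Suc (Suc k)) < C * I (Suc k)" using C IJ by simp
    ultimately show False using X e by (simp add: algebra_simps)
  qed
qed

text \<open>The arrows leaving vertex \<open>k + 1\<close> correspond to the monomials with exponents
  \<open>(arX k m, arY k m)\<close>, \<open>0 \<le> m < \<alpha>\<^bsub>k+1\<^esub>\<close>.\<close>

definition arX :: "nat \<Rightarrow> nat \<Rightarrow> int" where "arX k m = max 0 (fX k m)"
definition arY :: "nat \<Rightarrow> nat \<Rightarrow> int" where "arY k m = max 0 (fY k m - J (Suc k))"

section \<open>Arrow weights and monomials leaving a vertex other than 0\<close>

lemma fX_last: "k < n \<Longrightarrow> fX k (\<alpha> ! k - 2) = I (Suc k) - I (Suc (Suc k))"
  using alpha_ge_2[of k] by (simp add: I_rec fX_def of_nat_diff algebra_simps)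

lemma fY_last: "k < n \<Longrightarrow> fY k (\<alpha> ! k - 2) = J (Suc (Suc k)) - J (Suc k)"
  using alpha_ge_2[of k] by (simp add: J_rec fY_def of_nat_diff algebra_simps)

lemma fX_mono: "k < n \<Longrightarrow> m \<le> m' \<Longrightarrow> fX k m' \<le> fX k m"
  unfolding fX_def using I_pos[of "Suc k"] by (simp add: mult_right_mono)

lemma fY_mono: "k < n \<Longrightarrow> m \<le> m' \<Longrightarrow> fY k m \<le> fY k m'"
  unfolding fY_def using J_nonneg[of "Suc k"] by (simp add: mult_right_mono)

lemma fX_pos: "k < n \<Longrightarrow> Suc m < \<alpha> ! k \<Longrightarrow> 0 < fX k m"
  using fX_mono[of k m "\<alpha> ! k - 2"] fX_last[of k] I_strict[of "Suc k"] by force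

lemma fY_pos: "k < n \<Longrightarrow> 0 < fY k m"
  using J_strict[of k] J_nonneg[of "Suc k"] unfolding fY_def distrib_right
  by (smt (verit) less_imp_le_nat mult_nonneg_nonneg of_nat_0_le_iff)

text \<open>Truncation at 0 matters only at the two ends: \<open>fX\<close> is
  \<open>- I (k + 2)\<close> at the last index, and the expression inside \<open>arY\<close> is
  \<open>- J k\<close> at index 0. Elsewhere the weight is
  \<open>(fX k m, fY k (m - 1))\<close>.\<close>

lemma arX_eq: "k < n \<Longrightarrow> Suc m < \<alpha> ! k \<Longrightarrow> arX k m = fX k m"
  using fX_pos[of k m] by (simp add: arX_def)

lemma arY_Suc: "k < n \<Longrightarrow> arY k (Suc m) = fY k m"
  using fY_pos[of k m] by (simp add: arY_def fY_def algebra_simps)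

lemma arY_0: "k < n \<Longrightarrow> arY k 0 = 0"
  using J_nonneg[of k] by (simp add: arY_def fY_def)

lemma arX_last: "k < n \<Longrightarrow> arX k (\<alpha> ! k - 1) = 0"
  using alpha_ge_2[of k] I_nonneg[of "Suc (Suc k)"] by (simp add: I_rec arX_def fX_def of_nat_diff algebra_simps)

lemma arY_mono: "k < n \<Longrightarrow> m \<le> m' \<Longrightarrow> arY k m \<le> arY k m'"
  using fY_mono[of k m m'] by (simp add: arY_def)

lemma ar_nonneg: "0 \<le> arX k m" "0 \<le> arY k m"
  by (simp_all add: arX_def arY_def)

text \<open>The index \<open>q\<close> denotes the target module, with \<open>n + 1\<close> standing
  for vertex 0. The largest \<open>m\<close> whose y-exponent still fits determines the step of the
  staircase; if its x-exponent does not fit, a shifted monomial lies in an empty box.\<close>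

lemma ar_divides:
  assumes k: "k < n" and q: "1 \<le> q" "q \<le> Suc n" and X: "0 \<le> X" and Y: "0 \<le> Y"
    and lat: "lat (X + I (Suc k) - I q) Y" and nz: "X \<noteq> 0 \<or> Y \<noteq> 0 \<or> q \<noteq> Suc k"
  shows "\<exists>m < \<alpha> ! k. arX k m \<le> X \<and> arY k m \<le> Y"
proof (rule ccontr)
  assume neg: "\<not> ?thesis"
  have a2: "2 \<le> \<alpha> ! k" using alpha_ge_2 k by simp
  define M where "M = {m. m < \<alpha> ! k \<and> arY k m \<le> Y}"
  have M: "finite M" "0 \<in> M" using a2 Y arY_0[OF k] by (auto simp: M_def)
  define m where "m = Max M"
  have "m \<in> M" using M unfolding m_def by (intro Max_in) auto
  then have m: "m < \<alpha> ! k" "arY k m \<le> Y" by (auto simp: M_def)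
  have Xm: "X < arX k m" using neg m by (auto simp: not_le)
  then have "m \<noteq> \<alpha> ! k - 1" using X arX_last[OF k] by auto
  then have m1: "Suc m < \<alpha> ! k" using m by simp
  have "Suc m \<notin> M" using Max_ge[OF M(1), of "Suc m"] by (auto simp: m_def)
  then have Ym: "Y < fY k m" using m1 arY_Suc[OF k] by (auto simp: M_def)
  have Xm: "X < fX k m" using Xm arX_eq[OF k m1] by simp
  show False
  proof (cases "Suc k \<le> q")
    case True
    have "I q \<le> I (Suc k)" "0 \<le> I q" using I_le[OF True] I_nonneg[of q] q by auto
    then have "X + I (Suc k) - I q = 0 \<and> Y = 0"
      using empty_box[OF k _ lat, of m] m1 Xm Ym X Y by linarith
    moreover from this have "X = 0" "I q = I (Suc k)" using X \<open>I q \<le> I (Suc k)\<close> by auto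
    moreover from this have "q = Suc k" using I_less[of "Suc k" q] True q by (cases "q = Suc k") auto
    ultimately show False using nz by auto
  next
    case False
    then have qk: "q \<le> k" by simp
    have "J q < J (Suc k)" "0 \<le> J q" using J_less[of q "Suc k"] J_nonneg[of q] qk k by auto
    \<comment> \<open>For \<open>q \<le> k\<close> the shift goes in the direction of y, which calls
      for the next box: its x-bound \<open>fX k (m + 1) + I (k + 1)\<close> is
      \<open>fX k m\<close>, and its y-bound is larger by \<open>J (k + 1)\<close>.\<close>
    have "lat X (Y + J (Suc k) - J q)"
      using lat_add[OF lat lat_diff[OF lat_I_J[of q] lat_I_J[of "Suc k"]]] by (simp add: algebra_simps)
    then have "X = 0 \<and> Y + J (Suc k) - J q = 0"
      using m1 X Y Xm Ym \<open>J q < J (Suc k)\<close> \<open>0 \<le> J q\<close>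
      by (intro empty_box[OF k, of "Suc m"]) (auto simp: fX_def fY_def algebra_simps)
    then show False using \<open>J q < J (Suc k)\<close> Y by simp
  qed
qed

section \<open>Monomials divisible by xy and the minimal invariants dividing them\<close>

lemma fX_link: "k < n \<Longrightarrow> fX k (\<alpha> ! k - 2) = fX (Suc k) 0"
  using fX_last[of k] by (simp add: fX_def)

lemma fY_link: "k < n \<Longrightarrow> fY k (\<alpha> ! k - 2) = fY (Suc k) 0"
  using fY_last[of k] by (simp add: fY_def)

text \<open>Dividing by \<open>x^(I q)\<close>, or by \<open>y^(J q)\<close> when
  \<open>X < I q\<close>, which \<open>special\<close> permits, leaves an invariant monomial in an
  empty box, hence 1. The original monomial would be a pure power, against \<open>1 \<le> X\<close>
  and \<open>1 \<le> Y\<close>.\<close>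

lemma no_box:
  assumes q: "1 \<le> q" "q \<le> Suc n" and X: "1 \<le> X" and Y: "1 \<le> Y" and lat: "lat (X - I q) Y"
    and k: "k < n" "m < \<alpha> ! k" and box: "X < fX k m + I (Suc k)" "Y < fY k m"
  shows False
proof (cases "I q \<le> X")
  case True
  then show False
    using empty_box[OF k lat] X Y box I_nonneg[of q] q by auto
next
  case False
  then obtain q' where q': "q = Suc q'" "q' < n"
    using q X I_Suc_n by (cases q) (auto simp: le_less)
  then have "J q \<le> Y" using special[of q' X Y] lat False X Y by auto
  moreover have "lat X (Y - J q)"
    using lat_add[OF lat lat_I_J[of q]] by simp
  ultimately show False
    using empty_box[OF k, of X "Y - J q"] X Y box J_nonneg[of q] q by auto
qed

text \<open>Walk along the points \<open>f k m\<close>. As long as none divides,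
  \<open>fY k m \<le> Y\<close> forces \<open>X < fX k m = fX k (m + 1) + I (k + 1)\<close>, and the
  empty box then forces \<open>fY k (m + 1) \<le> Y\<close>. The walk can begin because the first
  y-exponent is 1, and it ends in a contradiction because the last x-exponent is
  \<open>I n = 1\<close>.\<close>

lemma f_divides:
  assumes q: "1 \<le> q" "q \<le> Suc n" and X: "1 \<le> X" and Y: "1 \<le> Y" and lat: "lat (X - I q) Y"
  shows "\<exists>k < n. \<exists>m. Suc m < \<alpha> ! k \<and> fX k m \<le> X \<and> fY k m \<le> Y"
proof (rule ccontr)
  assume neg: "\<not> ?thesis"
  have step: "fY k m \<le> Y" if "k < n" "Suc m < \<alpha> ! k" "fY k 0 \<le> Y" for k m
    using that
  proof (induction m)
    case (Suc m)
    then have "fY k m \<le> Y" by simp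
    then have "\<not> fX k m \<le> X" using neg Suc.prems(1,2) Suc_lessD by blast
    then have "fX k (Suc m) + I (Suc k) > X"
      by (simp add: fX_def algebra_simps)
    then show ?case
      using no_box[OF q X Y lat, of k "Suc m"] Suc.prems by force
  qed
  have zero: "fY k 0 \<le> Y" if "k < n" for k
    using that
  proof (induction k)
    case 0
    then show ?case using Y by (simp add: fY_def)
  next
    case (Suc k)
    then show ?case
      using step[of k "\<alpha> ! k - 2"] alpha_ge_2[of k] fY_link[of k] by simp
  qed
  obtain k where k: "n = Suc k" using n_ge_1 by (cases n) auto
  then have "fX k (\<alpha> ! k - 2) \<le> X" using fX_last[of k] I_n I_Suc_n X by simp
  moreover have "Suc (\<alpha> ! k - 2) < \<alpha> ! k" using alpha_ge_2[of k] k by simp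
  ultimately show False using neg step[of k "\<alpha> ! k - 2"] zero[of k] k by auto
qed

end

section \<open>Quivers with monomial relations\<close>

context hj_fraction
begin

text \<open>Vertex 0 belongs to the summand with index \<open>n + 1\<close>, whose i-value is 0;
  \<open>I 0 = r\<close> is merely congruent to it. With this normalisation vertex 0 is the only one
  whose value is divisible by \<open>r\<close>.\<close>

definition vI :: "nat \<Rightarrow> int" where "vI v = (if v = 0 then 0 else I v)"

lemma vI_vertex: "v \<le> n \<Longrightarrow> \<exists>q. 1 \<le> q \<and> q \<le> Suc n \<and> vI v = I q \<and> (\<forall>k. q = Suc k \<longrightarrow> k < n \<longrightarrow> v = Suc k)"
  by (rule exI[of _ "if v = 0 then Suc n else v"]) (auto simp: vI_def I_Suc_n)

lemma vI_bounds: "v \<le> n \<Longrightarrow> 0 \<le> vI v \<and> vI v < int r \<and> (vI v = 0 \<longrightarrow> v = 0)"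
  using I_pos[of v] I_less[of 0 v] a_less_r by (auto simp: vI_def)

text \<open>
  Among the invariants \<open>f k m\<close> each one that is not of the form \<open>f k (\<alpha>\<^bsub>k+1\<^esub> - 2)\<close> with
  \<open>k + 1 < n\<close> has a relation at vertex \<open>0\<close>; the others coincide with \<open>f (k + 1) 0\<close>.
\<close>

lemma f_relevant:
  assumes "k < n" "Suc m < \<alpha> ! k"
  shows "\<exists>k' m'. k' < n \<and> Suc m' < \<alpha> ! k' \<and> (Suc k' = n \<or> Suc (Suc m') < \<alpha> ! k') \<and>
    fX k' m' = fX k m \<and> fY k' m' = fY k m"
  using assms
proof (induction "n - k" arbitrary: k m)
  case (Suc d)
  show ?case
  proof (cases "Suc k = n \<or> Suc (Suc m) < \<alpha> ! k")
    case True
    then show ?thesis using Suc.prems by blast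
  next
    case False
    then have m: "m = \<alpha> ! k - 2" and k: "Suc k < n" using Suc.prems by auto
    have "Suc 0 < \<alpha> ! Suc k" using alpha_ge_2[OF k] by simp
    then show ?thesis
      using Suc.hyps(1)[of "Suc k" 0] Suc.hyps(2) k fX_link[of k] fY_link[of k] Suc.prems m by auto
  qed
qed simp

end

text \<open>The interface between the numerical part and the quiver. Arrows at vertex
  \<open>k + 1\<close> are numbered by slope, whatever their names. Relations are recorded only
  between neighbouring arrows, and between the two arrows at vertex 0, together with their
  monomials. The relation \<open>eqv\<close> stays abstract here; it will be equality modulo the
  ideal of relations.\<close>

locale toric_presentation = hj_fraction r a \<alpha> + wf_digraph Q
  for r a :: nat and \<alpha> :: "nat list" and Q :: "(nat, 'e) pre_digraph" +
  fixes ar :: "nat \<Rightarrow> nat \<Rightarrow> 'e" and xar yar :: 'e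
    and wx wy :: "'e \<Rightarrow> nat"
    and eqv :: "(nat, 'e) path \<Rightarrow> (nat, 'e) path \<Rightarrow> bool"
  assumes verts_Q: "verts Q = {0..n}"
    and out_0: "{e \<in> arcs Q. tail Q e = 0} = {xar, yar}"
    and out_Suc: "k < n \<Longrightarrow> {e \<in> arcs Q. tail Q e = Suc k} = ar k ` {..<\<alpha> ! k}"
    and weight_x: "wx xar = 1" "wy xar = 0"
    and weight_y: "wx yar = 0" "wy yar = 1"
    and weight_ar: "k < n \<Longrightarrow> m < \<alpha> ! k \<Longrightarrow> int (wx (ar k m)) = arX k m \<and> int (wy (ar k m)) = arY k m"
    and arc_lat: "e \<in> arcs Q \<Longrightarrow> lat (int (wx e) + vI (tail Q e) - vI (head Q e)) (int (wy e))"
    and eqv_refl: "awalk u p v \<Longrightarrow> eqv (u, p, v) (u, p, v)"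
    and eqv_sym: "eqv \<pi> \<pi>' \<Longrightarrow> eqv \<pi>' \<pi>"
    and eqv_trans: "eqv \<pi> \<pi>' \<Longrightarrow> eqv \<pi>' \<pi>'' \<Longrightarrow> eqv \<pi> \<pi>''"
    and eqv_append: "eqv (u, p, v) (u, p', v) \<Longrightarrow> awalk v q w \<Longrightarrow> eqv (u, p @ q, w) (u, p' @ q, w)"
    and eqv_Cons: "eqv (head Q e, p, w) (head Q e, p', w) \<Longrightarrow> e \<in> arcs Q \<Longrightarrow>
      eqv (tail Q e, e # p, w) (tail Q e, e # p', w)"
    and rel_Suc: "k < n \<Longrightarrow> Suc m < \<alpha> ! k \<Longrightarrow>
      \<exists>p q. awalk (Suc k) (ar k m # p) (Suc k) \<and> awalk (Suc k) (ar k (Suc m) # q) (Suc k) \<and>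
        eqv (Suc k, ar k m # p, Suc k) (Suc k, ar k (Suc m) # q, Suc k) \<and>
        int (\<Sum>e\<leftarrow>ar k m # p. wx e) = arX k m \<and> int (\<Sum>e\<leftarrow>ar k m # p. wy e) = arY k (Suc m) \<and>
        int (\<Sum>e\<leftarrow>ar k (Suc m) # q. wx e) = arX k m \<and> int (\<Sum>e\<leftarrow>ar k (Suc m) # q. wy e) = arY k (Suc m)"
    and rel_0: "k < n \<Longrightarrow> Suc m < \<alpha> ! k \<Longrightarrow> Suc k = n \<or> Suc (Suc m) < \<alpha> ! k \<Longrightarrow>
      \<exists>p q. awalk 0 (yar # p) 0 \<and> awalk 0 (xar # q) 0 \<and> eqv (0, yar # p, 0) (0, xar # q, 0) \<and>
        int (\<Sum>e\<leftarrow>yar # p. wx e) = fX k m \<and> int (\<Sum>e\<leftarrow>yar # p. wy e) = fY k m \<and>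
        int (\<Sum>e\<leftarrow>xar # q. wx e) = fX k m \<and> int (\<Sum>e\<leftarrow>xar # q. wy e) = fY k m"
begin

abbreviation wxs :: "'e list \<Rightarrow> nat" where "wxs p \<equiv> \<Sum>e\<leftarrow>p. wx e"
abbreviation wys :: "'e list \<Rightarrow> nat" where "wys p \<equiv> \<Sum>e\<leftarrow>p. wy e"

section \<open>Existence and uniqueness of paths with a given monomial\<close>

lemma walk_lat: "awalk u p v \<Longrightarrow> lat (int (wxs p) + vI u - vI v) (int (wys p))"
proof (induction p arbitrary: u)
  case Nil
  then show ?case by (simp add: awalk_Nil_iff lat_def)
next
  case (Cons e p)
  then have "lat (int (wx e) + vI u - vI (head Q e)) (int (wy e))"
    "lat (int (wxs p) + vI (head Q e) - vI v) (int (wys p))"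
    using arc_lat[of e] by (auto simp: awalk_Cons_iff)
  from lat_add[OF this] show ?case by (simp add: algebra_simps)
qed

lemma arc_cases:
  assumes "e \<in> arcs Q"
  obtains "tail Q e = 0" "e = xar \<or> e = yar"
  | k m where "k < n" "m < \<alpha> ! k" "tail Q e = Suc k" "e = ar k m"
proof (cases "tail Q e")
  case 0
  then show ?thesis using that(1) out_0 assms by blast
next
  case (Suc k)
  then have "k < n" using assms tail_in_verts[of e] verts_Q by auto
  then show ?thesis using that(2) out_Suc[of k] assms Suc by blast
qed

lemma ar_arc: "k < n \<Longrightarrow> m < \<alpha> ! k \<Longrightarrow> ar k m \<in> arcs Q \<and> tail Q (ar k m) = Suc k"
  using out_Suc[of k] by blast

lemma xy_arc: "xar \<in> arcs Q" "tail Q xar = 0" "yar \<in> arcs Q" "tail Q yar = 0"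
  using out_0 by blast+

lemma weight_pos: "e \<in> arcs Q \<Longrightarrow> 0 < wx e + wy e"
proof (elim arc_cases)
  fix k m assume k: "k < n" "m < \<alpha> ! k" "e = ar k m"
  have "0 < arX k m + arY k m"
  proof (cases "Suc m < \<alpha> ! k")
    case True
    then show ?thesis using arX_eq[of k m] fX_pos[of k m] ar_nonneg(2)[of k m] k by simp
  next
    case False
    then obtain m' where "m = Suc m'" using k alpha_ge_2[of k] by (cases m) auto
    then show ?thesis using arY_Suc[of k m'] fY_pos[of k m'] ar_nonneg(1)[of k m] k by simp
  qed
  moreover have "int (wx e) = arX k m" "int (wy e) = arY k m"
    using weight_ar[of k m] k by auto
  ultimately show ?thesis by linarith
qed (auto simp: weight_x weight_y)

lemma weight_zero: "awalk u p v \<Longrightarrow> wxs p = 0 \<Longrightarrow> wys p = 0 \<Longrightarrow> p = []"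
  by (cases p) (auto simp: awalk_Cons_iff dest!: weight_pos)

lemma dividing_arc:
  assumes u: "u \<le> n" and v: "v \<le> n" and lat: "lat (int X + vI u - vI v) (int Y)"
    and nz: "X \<noteq> 0 \<or> Y \<noteq> 0 \<or> u \<noteq> v"
  shows "\<exists>e \<in> arcs Q. tail Q e = u \<and> wx e \<le> X \<and> wy e \<le> Y"
proof (cases u)
  case 0
  have "X \<noteq> 0 \<or> Y \<noteq> 0"
  proof (rule ccontr)
    assume zero: "\<not> ?thesis"
    then have "int r dvd vI v" using lat 0 by (simp add: lat_def vI_def)
    then have "vI v = 0" using vI_bounds[OF v] by (metis zdvd_not_zless less_le)
    then show False using vI_bounds[OF v] nz 0 zero by auto
  qed
  then show ?thesis using xy_arc weight_x weight_y 0
    by (metis One_nat_def Suc_leI bot_nat_0.extremum neq0_conv)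
next
  case (Suc k)
  then have k: "k < n" using u by simp
  obtain q where q: "1 \<le> q" "q \<le> Suc n" "vI v = I q" "\<And>k. q = Suc k \<Longrightarrow> k < n \<Longrightarrow> v = Suc k"
    using vI_vertex[OF v] by blast
  have "int X \<noteq> 0 \<or> int Y \<noteq> 0 \<or> q \<noteq> Suc k" using nz q(4)[of k] k Suc by auto
  moreover have "lat (int X + I (Suc k) - I q) (int Y)" using lat Suc q(3) by (simp add: vI_def)
  ultimately obtain m where m: "m < \<alpha> ! k" "arX k m \<le> int X" "arY k m \<le> int Y"
    using ar_divides[OF k q(1,2), of "int X" "int Y"] by force
  then show ?thesis using ar_arc[OF k m(1)] weight_ar[OF k m(1)] Suc by auto
qed

lemma walk_exists:
  assumes "u \<le> n" "v \<le> n" "lat (int X + vI u - vI v) (int Y)"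
  shows "\<exists>p. awalk u p v \<and> wxs p = X \<and> wys p = Y"
  using assms
proof (induction "X + Y" arbitrary: X Y u rule: less_induct)
  case less
  show ?case
  proof (cases "X = 0 \<and> Y = 0 \<and> u = v")
    case True
    then show ?thesis using less.prems verts_Q by (intro exI[of _ "[]"]) (auto simp: awalk_Nil_iff)
  next
    case False
    then obtain e where e: "e \<in> arcs Q" "tail Q e = u" "wx e \<le> X" "wy e \<le> Y"
      using dividing_arc[OF less.prems] by blast
    have "lat (int X + vI u - vI v - (int (wx e) + vI u - vI (head Q e))) (int Y - int (wy e))"
      using lat_diff[OF less.prems(3) arc_lat[OF e(1)]] e(2) by simp
    then have "lat (int (X - wx e) + vI (head Q e) - vI v) (int (Y - wy e))"
      using e by (simp add: of_nat_diff algebra_simps)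
    moreover have "head Q e \<le> n" using head_in_verts[OF e(1)] verts_Q by simp
    moreover have "X - wx e + (Y - wy e) < X + Y" using weight_pos[OF e(1)] e(3,4) by linarith
    ultimately obtain p where "awalk (head Q e) p v" "wxs p = X - wx e" "wys p = Y - wy e"
      using less.hyps less.prems by blast
    then show ?thesis using e by (intro exI[of _ "e # p"]) (auto simp: awalk_Cons_iff)
  qed
qed

text \<open>If the monomial of \<open>q\<close> divides that of \<open>p\<close>, the quotient has
  the right weight for a path from \<open>w\<close> to \<open>v\<close>, so
  \<open>walk_exists\<close> applies. In this way one side of a relation is made the beginning of a
  path with a prescribed monomial.\<close>

lemma walk_completion:
  assumes "awalk u p v" and "awalk u q w" "wxs q \<le> wxs p" "wys q \<le> wys p"
  shows "\<exists>z. awalk w z v \<and> wxs (q @ z) = wxs p \<and> wys (q @ z) = wys p"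
proof -
  have "lat (int (wxs p - wxs q) + vI w - vI v) (int (wys p - wys q))"
    using lat_diff[OF walk_lat[OF assms(1)] walk_lat[OF assms(2)]] assms(3,4)
    by (simp add: of_nat_diff algebra_simps)
  moreover have "w \<le> n" "v \<le> n"
    using awalk_last_in_verts[OF assms(1)] awalk_last_in_verts[OF assms(2)] verts_Q by auto
  ultimately show ?thesis using walk_exists assms(3,4) by fastforce
qed

theorem walk_unique:
  assumes "awalk u p v" "awalk u p' v" "wxs p = wxs p'" "wys p = wys p'"
  shows "eqv (u, p, v) (u, p', v)"
  using assms
proof (induction "wxs p + wys p" arbitrary: u p p' rule: less_induct)
  case less
  have same_first: "eqv (u, e # s, v) (u, e # s', v)"
    if "awalk u (e # s) v" "awalk u (e # s') v" "wxs (e # s) = wxs p" "wxs (e # s') = wxs p"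
      "wys (e # s) = wys p" "wys (e # s') = wys p" for e s s'
  proof -
    have e: "e \<in> arcs Q" "u = tail Q e" "awalk (head Q e) s v" "awalk (head Q e) s' v"
      using that by (auto simp: awalk_Cons_iff)
    then have "eqv (head Q e, s, v) (head Q e, s', v)"
      using weight_pos[OF e(1)] that by (intro less.hyps) auto
    then show ?thesis using eqv_Cons e by blast
  qed
  \<comment> \<open>A relation between \<open>e # t\<close> and \<open>e' # t'\<close> whose
    monomial divides that of \<open>p\<close> exchanges the first arrow: \<open>e # s\<close> and
    \<open>e # t @ z\<close> agree by induction after \<open>e\<close>, and the relation replaces
    \<open>e # t\<close> by \<open>e' # t'\<close>.\<close>
  have via: "\<exists>z. awalk u (e' # z) v \<and> wxs (e' # z) = wxs p \<and> wys (e' # z) = wys p \<and>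
      eqv (u, e # s, v) (u, e' # z, v)"
    if w: "awalk u (e # s) v" "wxs (e # s) = wxs p" "wys (e # s) = wys p"
      and rel: "eqv (u, e # t, w) (u, e' # t', w)" "awalk u (e # t) w" "awalk u (e' # t') w"
        "wxs (e # t) \<le> wxs p" "wys (e # t) \<le> wys p" "wxs (e # t) = wxs (e' # t')"
        "wys (e # t) = wys (e' # t')"
    for e s e' t t' w
  proof -
    obtain z where z: "awalk w z v" "wxs ((e # t) @ z) = wxs p" "wys ((e # t) @ z) = wys p"
      using walk_completion[OF less.prems(1) rel(2,4,5)] by blast
    have "awalk u (e # t @ z) v" "awalk u (e' # t' @ z) v"
      using awalk_appendI[OF rel(2) z(1)] awalk_appendI[OF rel(3) z(1)] by auto
    moreover from this have "eqv (u, e # s, v) (u, e # t @ z, v)"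
      using w z by (intro same_first) auto
    moreover have "eqv (u, e # t @ z, v) (u, e' # t' @ z, v)"
      using eqv_append[OF rel(1) z(1)] by simp
    ultimately show ?thesis
      using z rel(6,7) by (intro exI[of _ "t' @ z"]) (auto intro: eqv_trans)
  qed
  \<comment> \<open>The relation between arrows \<open>i\<close> and \<open>i + 1\<close> fits: its
    x-exponent is that of arrow \<open>i\<close>, its y-exponent that of arrow \<open>i + 1\<close>,
    which is at most that of arrow \<open>i + d\<close>, and both outer arrows divide the
    monomial.\<close>
  have chain: "eqv (u, ar k i # s, v) (u, ar k (i + d) # s', v)"
    if "k < n" "u = Suc k" "i + d < \<alpha> ! k" "awalk u (ar k i # s) v" "awalk u (ar k (i + d) # s') v"
      "wxs (ar k i # s) = wxs p" "wys (ar k i # s) = wys p"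
      "wxs (ar k (i + d) # s') = wxs p" "wys (ar k (i + d) # s') = wys p" for k i d s s'
    using that
  proof (induction d arbitrary: i s)
    case 0
    then show ?case using same_first[of "ar k i" s s'] by simp
  next
    case (Suc d)
    have i: "Suc i < \<alpha> ! k" using Suc.prems by simp
    obtain t t' where t: "awalk u (ar k i # t) u" "awalk u (ar k (Suc i) # t') u"
      "eqv (u, ar k i # t, u) (u, ar k (Suc i) # t', u)"
      "int (wxs (ar k i # t)) = arX k i" "int (wys (ar k i # t)) = arY k (Suc i)"
      "int (wxs (ar k (Suc i) # t')) = arX k i" "int (wys (ar k (Suc i) # t')) = arY k (Suc i)"
      using rel_Suc[OF \<open>k < n\<close> i] \<open>u = Suc k\<close> by blast
    have "int (wx (ar k i)) \<le> int (wxs p)" "int (wy (ar k (i + Suc d))) \<le> int (wys p)"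
      unfolding of_nat_le_iff using Suc.prems(6)[symmetric] Suc.prems(9)[symmetric] by auto
    then have "arX k i \<le> int (wxs p)" "arY k (Suc i) \<le> int (wys p)"
      using weight_ar[of k i] weight_ar[of k "i + Suc d"] arY_mono[of k "Suc i" "i + Suc d"] Suc.prems
      by auto
    then have le: "wxs (ar k i # t) \<le> wxs p" "wys (ar k i # t) \<le> wys p"
      "wxs (ar k i # t) = wxs (ar k (Suc i) # t')" "wys (ar k i # t) = wys (ar k (Suc i) # t')"
      using t by linarith+
    obtain z where z: "awalk u (ar k (Suc i) # z) v" "wxs (ar k (Suc i) # z) = wxs p"
      "wys (ar k (Suc i) # z) = wys p" "eqv (u, ar k i # s, v) (u, ar k (Suc i) # z, v)"
      using via[OF Suc.prems(4,6,7) t(3,1,2) le] by blast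
    moreover have "eqv (u, ar k (Suc i) # z, v) (u, ar k (Suc i + d) # s', v)"
      by (rule Suc.IH) (use Suc.prems z in \<open>simp_all only: add_Suc add_Suc_right\<close>)
    ultimately show ?case using eqv_trans[OF z(4)] by simp
  qed
  \<comment> \<open>One path starts with x and the other with y, so both exponents are positive and
    some \<open>f k m\<close> divides the monomial; \<open>f_relevant\<close> changes the indices to
    those for which a relation is recorded.\<close>
  have corner: "eqv (u, yar # s, v) (u, xar # s', v)"
    if "u = 0" "awalk u (yar # s) v" "awalk u (xar # s') v"
      "wxs (yar # s) = wxs p" "wys (yar # s) = wys p"
      "wxs (xar # s') = wxs p" "wys (xar # s') = wys p" for s s'
  proof -
    note start = that(2,4,5)
    have pos: "1 \<le> int (wxs p)" "1 \<le> int (wys p)"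
      using that(5)[symmetric] that(6)[symmetric] weight_x weight_y by auto
    obtain q where q: "1 \<le> q" "q \<le> Suc n" "vI v = I q"
      using vI_vertex[of v] awalk_last_in_verts[OF less.prems(1)] verts_Q by auto
    have "lat (int (wxs p) - I q) (int (wys p))"
      using walk_lat[OF less.prems(1)] q(3) \<open>u = 0\<close> by (simp add: vI_def)
    then obtain k m where km: "k < n" "Suc m < \<alpha> ! k" "Suc k = n \<or> Suc (Suc m) < \<alpha> ! k"
      "fX k m \<le> int (wxs p)" "fY k m \<le> int (wys p)"
      using f_divides[OF q(1,2) pos] f_relevant by (smt (verit))
    obtain t t' where t: "awalk u (yar # t) 0" "awalk u (xar # t') 0"
      "eqv (u, yar # t, 0) (u, xar # t', 0)"
      "int (wxs (yar # t)) = fX k m" "int (wys (yar # t)) = fY k m"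
      "int (wxs (xar # t')) = fX k m" "int (wys (xar # t')) = fY k m"
      using rel_0[OF km(1-3)] \<open>u = 0\<close> by blast
    have le: "wxs (yar # t) \<le> wxs p" "wys (yar # t) \<le> wys p"
      "wxs (yar # t) = wxs (xar # t')" "wys (yar # t) = wys (xar # t')"
      using t km(4,5) by linarith+
    obtain z where z: "awalk u (xar # z) v" "wxs (xar # z) = wxs p" "wys (xar # z) = wys p"
      "eqv (u, yar # s, v) (u, xar # z, v)"
      using via[OF start t(3,1,2) le] by blast
    moreover have "eqv (u, xar # z, v) (u, xar # s', v)"
      by (rule same_first) (use that z in simp_all)
    ultimately show ?thesis using eqv_trans by blast
  qed
  show ?case
  proof (cases p)
    case Nil
    then have "p' = []" using weight_zero[OF less.prems(2)] less.prems by simp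
    then show ?thesis using Nil eqv_refl less.prems by simp
  next
    case p: (Cons e s)
    then have "p' \<noteq> []" using weight_zero[OF less.prems(1)] less.prems by auto
    then obtain e' s' where p': "p' = e' # s'" by (cases p') auto
    have e: "e \<in> arcs Q" "tail Q e = u" "e' \<in> arcs Q" "tail Q e' = u"
      using less.prems p p' by (auto simp: awalk_Cons_iff)
    note w = less.prems(1)[unfolded p] less.prems(2)[unfolded p']
      arg_cong[OF p, of wxs, symmetric] arg_cong[OF p, of wys, symmetric]
      less.prems(3)[symmetric, unfolded p'] less.prems(4)[symmetric, unfolded p']
    show ?thesis
    proof (cases rule: arc_cases[OF e(1)])
      case 1
      then have "u = 0" "e' = xar \<or> e' = yar" using e out_0 by auto
      then show ?thesis
        using 1 same_first[of e s s'] corner[of s s'] corner[of s' s, THEN eqv_sym] w p p' by auto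
    next
      case (2 k i)
      then obtain j where j: "j < \<alpha> ! k" "e' = ar k j" using e out_Suc[of k] by auto
      show ?thesis
      proof (cases "i \<le> j")
        case True
        then show ?thesis
          using chain[of k i "j - i" s s'] 2 j w p p' e by auto
      next
        case False
        then show ?thesis
          using chain[of k j "i - j" s' s, THEN eqv_sym] 2 j w p p' e by auto
      qed
    qed
  qed
qed

end

section \<open>Path algebras modulo relations\<close>

lemma poly_mapping_expansion:
  "f = (\<Sum>k\<in>Poly_Mapping.keys f. Poly_Mapping.single k (Poly_Mapping.lookup f k))"
proof (rule poly_mapping_eqI)
  fix k
  show "Poly_Mapping.lookup f k =
    Poly_Mapping.lookup (\<Sum>k\<in>Poly_Mapping.keys f. Poly_Mapping.single k (Poly_Mapping.lookup f k)) k"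
    by (simp add: lookup_sum lookup_single when_def sum.delta' in_keys_iff)
qed

lemma poly_mapping_span_induct [consumes 1, case_names zero single add]:
  fixes f :: "'k \<Rightarrow>\<^sub>0 'c::comm_monoid_add"
  assumes "Poly_Mapping.keys f \<subseteq> K" "P 0" "\<And>k c. k \<in> K \<Longrightarrow> P (Poly_Mapping.single k c)"
    and add: "\<And>f g. P f \<Longrightarrow> P g \<Longrightarrow> P (f + g)"
  shows "P f"
proof -
  have "P (\<Sum>k\<in>A. Poly_Mapping.single k (Poly_Mapping.lookup f k))"
    if "finite A" "A \<subseteq> K" for A
    using that by (induction A rule: finite_induct) (use assms in auto)
  from this[OF finite_keys assms(1)] show ?thesis
    using poly_mapping_expansion[of f] by simp
qed

lemmas poly_mapping_induct = poly_mapping_span_induct[OF subset_UNIV, case_names zero single add]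

section \<open>Bilinearity and associativity of the product of paths\<close>

definition path_term :: "('v, 'e) path \<Rightarrow> ('v, 'e) path \<Rightarrow> complex \<Rightarrow> (('v, 'e) path \<Rightarrow>\<^sub>0 complex)" where
  "path_term \<pi> \<sigma> c = (if snd (snd \<pi>) = fst \<sigma>
     then Poly_Mapping.single (fst \<pi>, fst (snd \<pi>) @ fst (snd \<sigma>), snd (snd \<sigma>)) c else 0)"

text \<open>Index sets \<open>keys\<close> do not behave additively, since coefficients can cancel
  in a sum. Over a common finite superset the missing terms are 0 and bilinearity becomes
  visible.\<close>

lemma path_mult_superset:
  assumes "finite A" "Poly_Mapping.keys f \<subseteq> A" "finite B" "Poly_Mapping.keys g \<subseteq> B"
  shows "path_mult f g =
    (\<Sum>\<pi>\<in>A. \<Sum>\<sigma>\<in>B. path_term \<pi> \<sigma> (Poly_Mapping.lookup f \<pi> * Poly_Mapping.lookup g \<sigma>))"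
proof -
  have "path_mult f g = (\<Sum>\<pi>\<in>Poly_Mapping.keys f. \<Sum>\<sigma>\<in>Poly_Mapping.keys g.
      path_term \<pi> \<sigma> (Poly_Mapping.lookup f \<pi> * Poly_Mapping.lookup g \<sigma>))"
    unfolding path_mult_def by (rule sum.cong[OF refl]) (auto simp: path_term_def intro!: sum.cong)
  also have "\<dots> = (\<Sum>\<pi>\<in>Poly_Mapping.keys f. \<Sum>\<sigma>\<in>B.
      path_term \<pi> \<sigma> (Poly_Mapping.lookup f \<pi> * Poly_Mapping.lookup g \<sigma>))"
    using assms by (intro sum.cong refl sum.mono_neutral_left) (auto simp: path_term_def in_keys_iff)
  also have "\<dots> = (\<Sum>\<pi>\<in>A. \<Sum>\<sigma>\<in>B.
      path_term \<pi> \<sigma> (Poly_Mapping.lookup f \<pi> * Poly_Mapping.lookup g \<sigma>))"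
    using assms by (intro sum.mono_neutral_left) (auto simp: path_term_def in_keys_iff intro!: sum.neutral)
  finally show ?thesis .
qed

lemma path_term_add: "path_term \<pi> \<sigma> (c + d) = path_term \<pi> \<sigma> c + path_term \<pi> \<sigma> d"
  by (simp add: path_term_def single_add)

lemma path_mult_add_left: "path_mult (f + g) h = path_mult f h + path_mult g h"
proof -
  let ?A = "Poly_Mapping.keys f \<union> Poly_Mapping.keys g"
  have "Poly_Mapping.keys (f + g) \<subseteq> ?A" by (rule keys_add)
  then show ?thesis
    by (simp add: path_mult_superset[of ?A _ "Poly_Mapping.keys h"] lookup_add distrib_right
        path_term_add sum.distrib)
qed

lemma path_mult_add_right: "path_mult h (f + g) = path_mult h f + path_mult h g"
proof -
  let ?A = "Poly_Mapping.keys f \<union> Poly_Mapping.keys g"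
  have "Poly_Mapping.keys (f + g) \<subseteq> ?A" by (rule keys_add)
  then show ?thesis
    by (simp add: path_mult_superset[of "Poly_Mapping.keys h" _ ?A] lookup_add distrib_left
        path_term_add sum.distrib)
qed

lemma path_mult_zero [simp]: "path_mult 0 f = 0" "path_mult f 0 = 0"
  by (simp_all add: path_mult_def)

lemma path_mult_single:
  "path_mult (Poly_Mapping.single \<pi> c) (Poly_Mapping.single \<sigma> d) = path_term \<pi> \<sigma> (c * d)"
  by (simp add: path_mult_superset[of "{\<pi>}" _ "{\<sigma>}"])

lemma path_mult_assoc: "path_mult (path_mult f g) h = path_mult f (path_mult g h)"
proof (induction f rule: poly_mapping_induct)
  case (single \<pi> c)
  show ?case
  proof (induction g rule: poly_mapping_induct)
    case (single \<sigma> d)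
    show ?case
    proof (induction h rule: poly_mapping_induct)
      case (single \<tau> e)
      show ?case by (simp add: path_mult_single path_term_def mult.assoc)
    qed (simp_all add: path_mult_add_left path_mult_add_right)
  qed (simp_all add: path_mult_add_left path_mult_add_right)
qed (simp_all add: path_mult_add_left path_mult_add_right)

lemma path_mult_sum_left: "path_mult (\<Sum>x\<in>A. f x) h = (\<Sum>x\<in>A. path_mult (f x) h)"
  by (induction A rule: infinite_finite_induct) (simp_all add: path_mult_add_left)

lemma path_mult_sum_right: "path_mult h (\<Sum>x\<in>A. f x) = (\<Sum>x\<in>A. path_mult h (f x))"
  by (induction A rule: infinite_finite_induct) (simp_all add: path_mult_add_right)

text \<open>A form of the first isomorphism theorem for an ideal given by generators. The target
  inherits the ring axioms as an image of \<open>R\<close>, which later spares a direct check for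
  the endomorphism ring.\<close>

lemma (in ring) genideal_quotient_iso:
  assumes gens: "gens \<subseteq> carrier R" and h: "h \<in> ring_hom R S" and surj: "h ` carrier R = carrier S"
    and zero: "h \<zero> = \<zero>\<^bsub>S\<^esub>" and gens_zero: "\<And>g. g \<in> gens \<Longrightarrow> h g = \<zero>\<^bsub>S\<^esub>"
    and kernel: "\<And>f. f \<in> carrier R \<Longrightarrow> h f = \<zero>\<^bsub>S\<^esub> \<Longrightarrow> f \<in> genideal R gens"
  shows "R Quot genideal R gens \<simeq> S"
proof -
  \<comment> \<open>The image ring is a record update of \<open>S\<close>; surjectivity and
    \<open>zero\<close> make the new values equal to the old ones.\<close>
  have "S \<lparr>carrier := carrier S, zero := \<zero>\<^bsub>S\<^esub>\<rparr> = S"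
    by (cases S) simp
  then have S: "ring S"
    using ring_hom_imp_img_ring[OF h] surj zero by metis
  interpret hom: ring_hom_ring R S h
    by (rule ring_hom_ringI2[OF ring_axioms S h])
  have ker: "a_kernel R S h = {f \<in> carrier R. h f = \<zero>\<^bsub>S\<^esub>}"
    by (rule a_kernel_def')
  have "gens \<subseteq> a_kernel R S h"
    unfolding ker using gens gens_zero by blast
  then have "genideal R gens \<subseteq> a_kernel R S h"
    by (rule genideal_minimal[OF hom.kernel_is_ideal])
  then have "genideal R gens = a_kernel R S h"
    unfolding ker using kernel by blast
  then show ?thesis
    using hom.FactRing_iso[OF surj] by metis
qed

locale finite_vertex_quiver = wf_digraph Q for Q :: "('v, 'e) pre_digraph" +
  assumes finite_verts: "finite (verts Q)"
begin

abbreviation PA where "PA \<equiv> path_algebra Q"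

lemma paths_iff: "(u, p, v) \<in> paths Q \<longleftrightarrow> awalk u p v"
  by (simp add: paths_def)

lemma path_algebra_simps [simp]:
  "carrier PA = {f. Poly_Mapping.keys f \<subseteq> paths Q}" "mult PA = path_mult" "zero PA = 0" "add PA = (+)"
  "one PA = (\<Sum>v\<in>verts Q. Poly_Mapping.single (v, [], v) 1)"
  by (simp_all add: path_algebra_def)

lemma path_term_closed: "\<pi> \<in> paths Q \<Longrightarrow> \<sigma> \<in> paths Q \<Longrightarrow> Poly_Mapping.keys (path_term \<pi> \<sigma> c) \<subseteq> paths Q"
  by (auto simp: path_term_def paths_def)

lemma path_mult_closed:
  assumes "Poly_Mapping.keys f \<subseteq> paths Q" "Poly_Mapping.keys g \<subseteq> paths Q"
  shows "Poly_Mapping.keys (path_mult f g) \<subseteq> paths Q"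
  using assms(1)
proof (induction f rule: poly_mapping_span_induct)
  case (single \<pi> c)
  show ?case using assms(2)
  proof (induction g rule: poly_mapping_span_induct)
    case (single \<sigma> d)
    then show ?case using path_term_closed \<open>\<pi> \<in> paths Q\<close> by (simp add: path_mult_single)
  next
    case (add f g)
    then show ?case using keys_add[of "path_mult (Poly_Mapping.single \<pi> c) f"]
      by (fastforce simp: path_mult_add_right)
  qed simp
next
  case (add f g')
  then show ?case using keys_add[of "path_mult f g"] by (fastforce simp: path_mult_add_left)
qed simp

lemma path_mult_one:
  assumes "Poly_Mapping.keys f \<subseteq> paths Q"
  shows "path_mult \<one>\<^bsub>PA\<^esub> f = f" "path_mult f \<one>\<^bsub>PA\<^esub> = f"
  using assms
proof (induction f rule: poly_mapping_span_induct)
  case (single \<pi> c)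
  obtain u p v where \<pi>: "\<pi> = (u, p, v)" by (cases \<pi>)
  have "u \<in> verts Q" "v \<in> verts Q"
    using single \<pi> awalk_hd_in_verts awalk_last_in_verts by (auto simp: paths_iff)
  then show "path_mult \<one>\<^bsub>PA\<^esub> (Poly_Mapping.single \<pi> c) = Poly_Mapping.single \<pi> c"
    "path_mult (Poly_Mapping.single \<pi> c) \<one>\<^bsub>PA\<^esub> = Poly_Mapping.single \<pi> c"
    by (simp_all add: \<pi> path_mult_sum_left path_mult_sum_right path_mult_single path_term_def
        finite_verts sum.delta sum.delta')
qed (simp_all add: path_mult_add_left path_mult_add_right)

sublocale PA: ring PA
proof (rule ringI)
  show "abelian_group PA"
  proof (rule abelian_groupI)
    fix f assume "f \<in> carrier PA"
    then show "\<exists>g\<in>carrier PA. g \<oplus>\<^bsub>PA\<^esub> f = \<zero>\<^bsub>PA\<^esub>"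
      by (intro bexI[of _ "- f"]) auto
  qed (auto simp: ac_simps dest!: subsetD[OF keys_add])
  show "Group.monoid PA"
  proof (rule monoidI)
    show "\<one>\<^bsub>PA\<^esub> \<in> carrier PA"
      by (auto simp: paths_iff awalk_Nil_iff dest!: subsetD[OF keys_sum])
  qed (simp_all add: path_mult_closed path_mult_assoc path_mult_one[simplified])
qed (simp_all add: path_mult_add_left path_mult_add_right)

lemma a_minus_path_algebra [simp]: "f \<in> carrier PA \<Longrightarrow> \<ominus>\<^bsub>PA\<^esub> f = - f"
  by (rule PA.minus_equality) auto

end

section \<open>The ideal generated by the relations\<close>

locale quiver_relations = finite_vertex_quiver Q for Q :: "('v, 'e) pre_digraph" +
  fixes rels :: "('e list \<times> 'e list) set"
  assumes rels_walks: "(p, q) \<in> rels \<Longrightarrow>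
    p \<noteq> [] \<and> q \<noteq> [] \<and> (\<exists>u v. awalk u p v \<and> awalk u q v)"
begin

definition relators where
  "relators = (\<lambda>(p, q). path_elem Q p - path_elem Q q) ` rels"

definition relation_ideal where "relation_ideal = genideal PA relators"

lemma path_elem_walk: "awalk u p v \<Longrightarrow> p \<noteq> [] \<Longrightarrow> path_elem Q p = Poly_Mapping.single (u, p, v) 1"
proof -
  assume p: "awalk u p v" "p \<noteq> []"
  have "tail Q (hd p) = u" using p by (cases p) (auto simp: awalk_Cons_iff)
  moreover have "head Q (last p) = v"
    using p
  proof (induction p arbitrary: u)
    case (Cons e p)
    then show ?case by (cases p) (auto simp: awalk_simps)
  qed simp
  ultimately show ?thesis by (simp add: path_elem_def)
qed

lemma relators_closed: "relators \<subseteq> carrier PA"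
proof
  fix g assume "g \<in> relators"
  then obtain p q where "(p, q) \<in> rels" "g = path_elem Q p - path_elem Q q"
    by (auto simp: relators_def)
  moreover from this obtain u v where w: "awalk u p v" "awalk u q v" "p \<noteq> []" "q \<noteq> []"
    using rels_walks by blast
  have "Poly_Mapping.keys (path_elem Q p - path_elem Q q) \<subseteq> {(u, p, v), (u, q, v)}"
    using keys_diff[of "path_elem Q p" "path_elem Q q"] w by (simp add: path_elem_walk insert_commute)
  ultimately show "g \<in> carrier PA"
    using w by (auto simp only: path_algebra_simps paths_iff)
qed

sublocale relation_ideal: ideal relation_ideal PA
  unfolding relation_ideal_def by (rule PA.genideal_ideal[OF relators_closed])

lemma relation_ideal_minus: "f \<in> relation_ideal \<Longrightarrow> - f \<in> relation_ideal"
  using relation_ideal.a_inv_closed[of f] a_minus_path_algebra[of f] relation_ideal.a_Hcarr[of f]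
  by metis

lemma relation_ideal_closed:
  "0 \<in> relation_ideal"
  "f \<in> relation_ideal \<Longrightarrow> g \<in> relation_ideal \<Longrightarrow> f + g \<in> relation_ideal"
  "f \<in> relation_ideal \<Longrightarrow> g \<in> carrier PA \<Longrightarrow> path_mult g f \<in> relation_ideal"
  "f \<in> relation_ideal \<Longrightarrow> g \<in> carrier PA \<Longrightarrow> path_mult f g \<in> relation_ideal"
  using relation_ideal.zero_closed relation_ideal.a_inv_closed[of f] relation_ideal.a_closed[of f g]
    relation_ideal.I_l_closed[of f g] relation_ideal.I_r_closed[of f g]
  by auto

definition path_eqv :: "('v, 'e) path \<Rightarrow> ('v, 'e) path \<Rightarrow> bool" where
  "path_eqv \<pi> \<pi>' \<longleftrightarrow> \<pi> \<in> paths Q \<and> \<pi>' \<in> paths Q \<and>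
    Poly_Mapping.single \<pi> 1 - Poly_Mapping.single \<pi>' 1 \<in> relation_ideal"

lemma path_eqv_refl: "awalk u p v \<Longrightarrow> path_eqv (u, p, v) (u, p, v)"
  by (simp add: path_eqv_def paths_iff relation_ideal_closed)

lemma path_eqv_sym: "path_eqv \<pi> \<pi>' \<Longrightarrow> path_eqv \<pi>' \<pi>"
  using relation_ideal_minus[of "Poly_Mapping.single \<pi> 1 - Poly_Mapping.single \<pi>' 1"]
  by (simp add: path_eqv_def)

lemma path_eqv_trans: "path_eqv \<pi> \<pi>' \<Longrightarrow> path_eqv \<pi>' \<pi>'' \<Longrightarrow> path_eqv \<pi> \<pi>''"
  using relation_ideal_closed(2)[of "Poly_Mapping.single \<pi> 1 - Poly_Mapping.single \<pi>' 1"
      "Poly_Mapping.single \<pi>' 1 - Poly_Mapping.single \<pi>'' 1"]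
  by (simp add: path_eqv_def)

lemma path_mult_diff: "path_mult f (g - h) = path_mult f g - path_mult f h"
  "path_mult (g - h) f = path_mult g f - path_mult h f"
  using path_mult_add_right[of f "g - h" h] path_mult_add_left[of "g - h" h f] by simp_all

lemma path_eqv_append:
  assumes "path_eqv (u, p, v) (u, p', v)" "awalk v q w"
  shows "path_eqv (u, p @ q, w) (u, p' @ q, w)"
proof -
  have "path_mult (Poly_Mapping.single (u, p, v) 1 - Poly_Mapping.single (u, p', v) 1)
    (Poly_Mapping.single (v, q, w) 1) \<in> relation_ideal"
    using assms by (intro relation_ideal_closed(4)) (simp_all add: path_eqv_def paths_iff)
  then show ?thesis
    using assms awalk_appendI[of u _ v q w]
    by (simp add: path_eqv_def paths_iff path_mult_diff path_mult_single path_term_def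
        del: awalk_append_iff)
qed

lemma path_eqv_Cons:
  assumes "path_eqv (head Q e, p, w) (head Q e, p', w)" "e \<in> arcs Q"
  shows "path_eqv (tail Q e, e # p, w) (tail Q e, e # p', w)"
proof -
  have "path_mult (Poly_Mapping.single (tail Q e, [e], head Q e) 1)
     (Poly_Mapping.single (head Q e, p, w) 1 - Poly_Mapping.single (head Q e, p', w) 1) \<in> relation_ideal"
    using assms arc_implies_awalk[of e]
    by (intro relation_ideal_closed(3)) (simp_all add: path_eqv_def paths_iff)
  then show ?thesis
    using assms
    by (simp add: path_eqv_def paths_iff path_mult_diff path_mult_single path_term_def awalk_Cons_iff)
qed

lemma path_eqv_rel:
  assumes "(p, q) \<in> rels" "awalk u p v"
  shows "awalk u q v" "path_eqv (u, p, v) (u, q, v)"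
proof -
  obtain u' v' where w: "awalk u' p v'" "awalk u' q v'" "p \<noteq> []" "q \<noteq> []"
    using rels_walks[OF assms(1)] by blast
  then have "u' = u \<and> v' = v" using awalk_ends[OF assms(2) w(1)] by blast
  then show q: "awalk u q v" using w by simp
  have "path_elem Q p - path_elem Q q \<in> relation_ideal"
    unfolding relation_ideal_def using PA.genideal_self[OF relators_closed] assms(1)
    by (auto simp: relators_def)
  then show "path_eqv (u, p, v) (u, q, v)"
    using q assms(2) w(3,4) by (simp add: path_eqv_def paths_iff path_elem_walk)
qed

text \<open>Subtracting the vanishing sum writes \<open>f\<close> as a linear combination of
  differences of \<pi> and \<open>\<rho> \<pi>\<close>, each of which lies in the ideal.\<close>

lemma in_relation_ideal:
  assumes f: "f \<in> carrier PA" and rep: "\<And>\<pi>. \<pi> \<in> Poly_Mapping.keys f \<Longrightarrow> path_eqv \<pi> (\<rho> \<pi>)"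
    and zero: "(\<Sum>\<pi>\<in>Poly_Mapping.keys f. Poly_Mapping.single (\<rho> \<pi>) (Poly_Mapping.lookup f \<pi>)) = 0"
  shows "f \<in> relation_ideal"
proof -
  have sum_closed: "(\<Sum>x\<in>A. g x) \<in> relation_ideal"
    if "finite A" "\<And>x. x \<in> A \<Longrightarrow> g x \<in> relation_ideal" for A :: "('v, 'e) path set" and g
    using that by (induction A rule: finite_induct) (auto intro: relation_ideal_closed)
  have "f = (\<Sum>\<pi>\<in>Poly_Mapping.keys f. Poly_Mapping.single \<pi> (Poly_Mapping.lookup f \<pi>)) -
      (\<Sum>\<pi>\<in>Poly_Mapping.keys f. Poly_Mapping.single (\<rho> \<pi>) (Poly_Mapping.lookup f \<pi>))"
    using zero poly_mapping_expansion[of f] by simp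
  also have "\<dots> = (\<Sum>\<pi>\<in>Poly_Mapping.keys f. Poly_Mapping.single \<pi> (Poly_Mapping.lookup f \<pi>) -
      Poly_Mapping.single (\<rho> \<pi>) (Poly_Mapping.lookup f \<pi>))"
    by (simp add: sum_subtractf)
  also have "\<dots> \<in> relation_ideal"
  proof (rule sum_closed)
    fix \<pi> assume "\<pi> \<in> Poly_Mapping.keys f"
    then have e: "path_eqv \<pi> (\<rho> \<pi>)" by (rule rep)
    define c where "c = Poly_Mapping.lookup f \<pi>"
    \<comment> \<open>An ideal absorbs ring elements, so the scalar \<open>c\<close> has to be
      realised as one: this is \<open>c\<close> times the unit.\<close>
    let ?s = "\<Sum>v\<in>verts Q. Poly_Mapping.single (v, [], v) c :: ('v, 'e) path \<Rightarrow>\<^sub>0 complex"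
    have "?s \<in> carrier PA"
      by (auto simp: paths_iff awalk_Nil_iff split: if_splits dest!: subsetD[OF keys_sum])
    then have "path_mult ?s (Poly_Mapping.single \<pi> 1 - Poly_Mapping.single (\<rho> \<pi>) 1) \<in> relation_ideal"
      using e by (intro relation_ideal_closed(3)) (auto simp: path_eqv_def)
    moreover have "path_mult ?s (Poly_Mapping.single \<sigma> 1) = Poly_Mapping.single \<sigma> c"
      if "\<sigma> \<in> paths Q" for \<sigma>
    proof -
      obtain u p v where \<sigma>: "\<sigma> = (u, p, v)" by (cases \<sigma>)
      then have "u \<in> verts Q" using that awalk_hd_in_verts by (auto simp: paths_iff)
      then show ?thesis
        by (simp add: \<sigma> path_mult_sum_left path_mult_single path_term_def finite_verts sum.delta)
    qed
    ultimately show "Poly_Mapping.single \<pi> (Poly_Mapping.lookup f \<pi>) -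
      Poly_Mapping.single (\<rho> \<pi>) (Poly_Mapping.lookup f \<pi>) \<in> relation_ideal"
      using e by (simp add: path_mult_diff path_eqv_def c_def)
  qed simp
  finally show ?thesis .
qed

end

section \<open>Arrows of the reconstruction algebra\<close>

context hj_fraction
begin

abbreviation RQ :: "(nat, arrow) pre_digraph" where "RQ \<equiv> recon_quiver \<alpha>"

text \<open>The number of extra arrows with tail at most \<open>k\<close>. Since tails increase
  weakly, those leaving vertex \<open>k + 1\<close> have the indices \<open>K k + m\<close> with
  \<open>1 \<le> m \<le> \<alpha> ! k - 2\<close>.\<close>

definition K :: "nat \<Rightarrow> nat" where "K k = (\<Sum>i<k. \<alpha> ! i - 2)"

lemma K_0: "K 0 = 0" and K_Suc: "K (Suc k) = K k + (\<alpha> ! k - 2)"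
  by (simp_all add: K_def)

lemma K_mono: "k \<le> l \<Longrightarrow> K k \<le> K l"
  unfolding K_def by (intro sum_mono2) auto

lemma gam_eq: "gam \<alpha> = K n"
  by (simp add: gam_def K_def sum.atLeast1_atMost_eq)

lemma length_tails_prefix:
  "k \<le> n \<Longrightarrow> length (concat (map (\<lambda>i. replicate (\<alpha> ! (i - 1) - 2) i) [1..<Suc k])) = K k"
  by (induction k) (simp_all add: K_0 K_Suc)

lemma tail_k_mid:
  assumes k: "k < n" and m: "1 \<le> m" "m \<le> \<alpha> ! k - 2"
  shows "tail_k \<alpha> (K k + m) = Suc k" "K k + m \<le> gam \<alpha>"
proof -
  have "K k + m \<le> K (Suc k)" using m by (simp add: K_Suc)
  also have "\<dots> \<le> gam \<alpha>" using k by (simp add: gam_eq K_mono)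
  finally show le: "K k + m \<le> gam \<alpha>" .
  have m': "m - 1 < \<alpha> ! k - 2" "\<not> K k + m - 1 < K k" using m by linarith+
  let ?f = "\<lambda>i. replicate (\<alpha> ! (i - 1) - 2) i"
  have "[1..<n + 1] = [1..<Suc k] @ [Suc k..<n + 1]"
    using k upt_add_eq_append[of 1 "Suc k" "n - k"] by simp
  also have "[Suc k..<n + 1] = Suc k # [Suc (Suc k)..<n + 1]"
    using k by (simp add: upt_conv_Cons)
  finally have "extra_tails \<alpha> = concat (map ?f [1..<Suc k]) @ ?f (Suc k) @ concat (map ?f [Suc (Suc k)..<n + 1])"
    by (simp add: extra_tails_def)
  then have "extra_tails \<alpha> ! (K k + (m - 1)) = Suc k"
    using length_tails_prefix[of k] k m m'
    by (simp add: nth_append del: upt_Suc)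
  then show "tail_k \<alpha> (K k + m) = Suc k"
    using le m by (simp add: tail_k_def)
qed

lemma tail_k_0: "tail_k \<alpha> 0 = 1" and tail_k_last: "tail_k \<alpha> (Suc (gam \<alpha>)) = n"
  by (simp_all add: tail_k_def)

lemma K_cases:
  assumes "1 \<le> s" "s \<le> K l"
  shows "\<exists>k<l. \<exists>m. 1 \<le> m \<and> m \<le> \<alpha> ! k - 2 \<and> s = K k + m"
  using assms
proof (induction l)
  case (Suc l)
  show ?case
  proof (cases "s \<le> K l")
    case True
    then show ?thesis using Suc less_SucI by blast
  next
    case False
    then show ?thesis using Suc.prems by (intro exI[of _ l] conjI exI[of _ "s - K l"]) (auto simp: K_Suc)
  qed
qed (simp add: K_0)

lemma s_cases:
  assumes "s \<le> gam \<alpha> + 1"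
  obtains "s = 0" | k m where "k < n" "1 \<le> m" "m \<le> \<alpha> ! k - 2" "s = K k + m" "tail_k \<alpha> s = Suc k"
  | "s = gam \<alpha> + 1"
proof (cases "s = 0 \<or> s = gam \<alpha> + 1")
  case False
  then obtain k m where "k < n" "1 \<le> m" "m \<le> \<alpha> ! k - 2" "s = K k + m"
    using K_cases[of s n] assms gam_eq by auto
  then show ?thesis using that(2) tail_k_mid(1) by blast
qed (use that in auto)

text \<open>The last vertex is excluded because the additional arrow with index
  \<open>gam \<alpha> + 1\<close> has tail \<open>n\<close>; dually \<open>v_ind_Suc\<close>
  excludes vertex 1, the tail of the additional arrow with index 0.\<close>

lemma u_ind_Suc:
  assumes k: "Suc k < n" and a: "2 < \<alpha> ! k"
  shows "u_ind \<alpha> (Suc k) = K k + (\<alpha> ! k - 2)"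
  unfolding u_ind_def
proof (rule Max_eqI)
  have "1 \<le> \<alpha> ! k - 2" using a by simp
  then have "K k + (\<alpha> ! k - 2) \<le> gam \<alpha>" "tail_k \<alpha> (K k + (\<alpha> ! k - 2)) = Suc k"
    using tail_k_mid[of k "\<alpha> ! k - 2"] k by simp_all
  then show "K k + (\<alpha> ! k - 2) \<in> {j. j \<le> gam \<alpha> + 1 \<and> tail_k \<alpha> j = Suc k}"
    by simp
next
  fix j assume j: "j \<in> {j. j \<le> gam \<alpha> + 1 \<and> tail_k \<alpha> j = Suc k}"
  then have "j \<le> gam \<alpha> + 1" by simp
  then show "j \<le> K k + (\<alpha> ! k - 2)"
    by (cases rule: s_cases) (use j k tail_k_last in auto)
qed simp

lemma u_ind_n: "u_ind \<alpha> n = Suc (gam \<alpha>)"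
  unfolding u_ind_def by (rule Max_eqI) (use tail_k_last in auto)

lemma v_ind_Suc:
  assumes k: "0 < k" "k < n" and a: "2 < \<alpha> ! k"
  shows "v_ind \<alpha> (Suc k) = Suc (K k)"
  unfolding v_ind_def
proof (rule Min_eqI)
  have "1 \<le> \<alpha> ! k - 2" using a by simp
  then have "Suc (K k) \<le> gam \<alpha>" "tail_k \<alpha> (Suc (K k)) = Suc k"
    using tail_k_mid[of k 1] k by simp_all
  then show "Suc (K k) \<in> {j. j \<le> gam \<alpha> + 1 \<and> tail_k \<alpha> j = Suc k}"
    by simp
next
  fix j assume j: "j \<in> {j. j \<le> gam \<alpha> + 1 \<and> tail_k \<alpha> j = Suc k}"
  then have "j \<le> gam \<alpha> + 1" by simp
  then show "Suc (K k) \<le> j"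
  proof (cases rule: s_cases)
    case 3
    have "1 \<le> \<alpha> ! k - 2" using a by simp
    then show ?thesis using tail_k_mid(2)[of k 1] k 3 by simp
  qed (use j k tail_k_0 in auto)
qed simp

text \<open>The arrows at vertex \<open>k + 1\<close> in order of slope. For
  \<open>n \<ge> 2\<close> the clockwise arrow comes first and the anticlockwise one last. For
  \<open>n = 1\<close> two clockwise arrows open the list, so the extra arrow with index
  \<open>s\<close> is at position \<open>s + 1\<close> instead of \<open>s\<close>.\<close>

definition rar :: "nat \<Rightarrow> nat \<Rightarrow> arrow" where
  "rar k m = (if n = 1 then (if m = 0 then dbl_c 1 else if m = 1 then dbl_c 2 else ar_k (m - 1))
     else if m = 0 then ar_c (Suc k) k
     else if m = \<alpha> ! k - 1 then (if Suc k = n then ar_a n 0 else ar_a (Suc k) (Suc (Suc k)))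
     else ar_k (K k + m))"

lemma kk_mid:
  "n \<noteq> 1 \<Longrightarrow> k < n \<Longrightarrow> 1 \<le> m \<Longrightarrow> m \<le> \<alpha> ! k - 2 \<Longrightarrow> kk \<alpha> (K k + m) = rar k m"
  using tail_k_mid(2)[of k m] by (auto simp: kk_def rar_def)

lemma kk_0: "n \<noteq> 1 \<Longrightarrow> kk \<alpha> 0 = rar 0 0"
  by (simp add: kk_def rar_def)

lemma kk_last: "n \<noteq> 1 \<Longrightarrow> Suc k = n \<Longrightarrow> kk \<alpha> (Suc (gam \<alpha>)) = rar k (\<alpha> ! k - 1)"
  using alpha_ge_2[of k] by (auto simp: kk_def rar_def)

text \<open>Identifies the arrow that the relation at vertex 0 for \<open>f k 0\<close> uses on its
  y-side. Going down from \<open>k\<close>, vertices with \<alpha>-value 2 have no extra arrow, and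
  there \<open>fX_link\<close> and \<open>fY_link\<close> leave the invariant unchanged. If no extra
  arrow is met, the search ends at the arrow with index 0, which is the case
  \<open>m = 0\<close>.\<close>

lemma previous_extra_arrow:
  assumes "n \<noteq> 1" "0 < k" "k < n"
  shows "\<exists>l m. l < k \<and> Suc m < \<alpha> ! l \<and> tail_k \<alpha> (K k) = Suc l \<and> kk \<alpha> (K k) = rar l m \<and>
    (m = 0 \<longrightarrow> l = 0) \<and> fX l m = fX k 0 \<and> fY l m = fY k 0"
  using assms
proof (induction k)
  case (Suc k)
  show ?case
  proof (cases "2 < \<alpha> ! k")
    case True
    then show ?thesis
      using Suc.prems tail_k_mid(1)[of k "\<alpha> ! k - 2"] kk_mid[of k "\<alpha> ! k - 2"] fX_link[of k] fY_link[of k]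
      by (intro exI[of _ k] exI[of _ "\<alpha> ! k - 2"]) (auto simp: K_Suc)
  next
    case False
    then have a: "\<alpha> ! k = 2" using alpha_ge_2[of k] Suc.prems by simp
    have f: "fX k 0 = fX (Suc k) 0" "fY k 0 = fY (Suc k) 0"
      using fX_link[of k] fY_link[of k] a Suc.prems by simp_all
    show ?thesis
    proof (cases "k = 0")
      case True
      then show ?thesis
        using a f Suc.prems kk_0 tail_k_0
        by (intro exI[of _ 0] exI[of _ "0::nat"]) (auto simp: K_Suc K_0)
    next
      case False
      then show ?thesis using Suc.IH Suc.prems a f by (auto simp: K_Suc less_Suc_eq)
    qed
  qed
qed simp

lemma V_ind_Suc:
  assumes k: "n \<noteq> 1" "0 < k" "k < n"
  shows "V_ind \<alpha> (Suc k) = K k"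
proof -
  have "Max {j. j \<le> gam \<alpha> + 1 \<and> tail_k \<alpha> j < Suc k} = K k"
  proof (rule Max_eqI)
    fix j assume j: "j \<in> {j. j \<le> gam \<alpha> + 1 \<and> tail_k \<alpha> j < Suc k}"
    then have "j \<le> gam \<alpha> + 1" by simp
    then show "j \<le> K k"
    proof (cases rule: s_cases)
      case (2 l m)
      then have "j \<le> K (Suc l)" "Suc l \<le> k" using j by (auto simp: K_Suc)
      then show ?thesis using K_mono order_trans by blast
    qed (use j k tail_k_last in auto)
  next
    show "K k \<in> {j. j \<le> gam \<alpha> + 1 \<and> tail_k \<alpha> j < Suc k}"
      using previous_extra_arrow[OF k] K_mono[of k n] k gam_eq by fastforce
  qed simp
  then show ?thesis using k by (simp add: V_ind_def)
qed

text \<open>Clockwise arrows carry \<open>x^(i_{t-1} - i_t)\<close>, and the one leaving vertex 0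
  carries x because \<open>I n = 1\<close>. For an extra arrow, subtracting \<open>K\<close>
  recovers its position among the arrows at its tail; the summand 1 is the shift of
  \<open>rar\<close> for \<open>n = 1\<close>.\<close>

fun rwx :: "arrow \<Rightarrow> nat" where
  "rwx (ar_c i j) = (if i = 0 then 1 else nat (I j - I i))"
| "rwx (ar_a i j) = 0"
| "rwx (ar_k s) = nat (arX (tail_k \<alpha> s - 1) (s - K (tail_k \<alpha> s - 1) + (if n = 1 then 1 else 0)))"
| "rwx (dbl_c t) = nat (arX 0 (t - 1))"
| "rwx (dbl_a t) = (if t = 1 then 1 else 0)"

text \<open>For an anticlockwise arrow the exponent uses \<open>Suc i\<close> rather than the head,
  because the arrow from \<open>n\<close> to 0 has to count as going to index
  \<open>n + 1\<close>.\<close>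

fun rwy :: "arrow \<Rightarrow> nat" where
  "rwy (ar_c i j) = 0"
| "rwy (ar_a i j) = nat (J (Suc i) - J i)"
| "rwy (ar_k s) = nat (arY (tail_k \<alpha> s - 1) (s - K (tail_k \<alpha> s - 1) + (if n = 1 then 1 else 0)))"
| "rwy (dbl_c t) = nat (arY 0 (t - 1))"
| "rwy (dbl_a t) = (if t = 1 then 0 else 1)"

definition rX where "rX = (if n = 1 then dbl_a 1 else ar_c 0 n)"
definition rY where "rY = (if n = 1 then dbl_a 2 else ar_a 0 1)"

lemma weight_rXY: "rwx rX = 1" "rwy rX = 0" "rwx rY = 0" "rwy rY = 1"
  by (simp_all add: rX_def rY_def)

lemma weight_rar:
  assumes k: "k < n" and m: "m < \<alpha> ! k"
  shows "int (rwx (rar k m)) = arX k m \<and> int (rwy (rar k m)) = arY k m"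
proof -
  have a: "2 \<le> \<alpha> ! k" using alpha_ge_2 k .
  show ?thesis
  proof (cases "n = 1")
    case True
    then have "k = 0" using k by simp
    moreover have "tail_k \<alpha> (m - 1) = Suc 0" if "2 \<le> m"
      using tail_k_mid(1)[of 0 "m - 1"] that k m \<open>k = 0\<close> by (simp add: K_0)
    ultimately show ?thesis
      using True m ar_nonneg by (cases m; cases "m - 1") (auto simp: rar_def K_0)
  next
    case n: False
    consider "m = 0" | "m = \<alpha> ! k - 1" "m \<noteq> 0" | "1 \<le> m" "m \<le> \<alpha> ! k - 2" "m \<noteq> \<alpha> ! k - 1"
      using m by linarith
    then show ?thesis
    proof cases
      case 1
      then show ?thesis
        using n arX_eq[of k 0] arY_0[of k] a k I_strict[of k] by (simp add: rar_def fX_def)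
    next
      case 2
      then have "m = Suc (\<alpha> ! k - 2)" using a by simp
      then have "arY k m = fY k (\<alpha> ! k - 2)"
        using arY_Suc[OF k, of "\<alpha> ! k - 2"] by simp
      then show ?thesis
        using 2 n arX_last[of k] fY_last[of k] k J_strict[of "Suc k"] by (auto simp: rar_def)
    next
      case 3
      then show ?thesis
        using n tail_k_mid(1)[of k m] k ar_nonneg by (simp add: rar_def)
    qed
  qed
qed

end

lemma recon_quiver_simps [simp]:
  "verts (recon_quiver \<alpha>) = {0..length \<alpha>}" "arcs (recon_quiver \<alpha>) = recon_arrows \<alpha>"
  "tail (recon_quiver \<alpha>) = arrow_tail \<alpha>" "head (recon_quiver \<alpha>) = arrow_head"
  by (simp_all add: recon_quiver_def)

context hj_fraction
begin

lemma index_cases: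
  assumes "m < \<alpha> ! k"
  obtains "n = 1" "m < 2" | m' where "n = 1" "m = Suc m'" "1 \<le> m'"
    | "n \<noteq> 1" "m = 0 \<or> m = \<alpha> ! k - 1"
    | "n \<noteq> 1" "1 \<le> m" "m \<le> \<alpha> ! k - 2" "m \<noteq> \<alpha> ! k - 1"
proof (cases "n = 1")
  case True
  then show ?thesis using that(1,2) by (cases m) force+
next
  case False
  then show ?thesis using that(3,4) assms by (cases "m = 0 \<or> m = \<alpha> ! k - 1") force+
qed

lemma rar_tail: "k < n \<Longrightarrow> m < \<alpha> ! k \<Longrightarrow> arrow_tail \<alpha> (rar k m) = Suc k"
proof -
  assume k: "k < n" and m: "m < \<alpha> ! k"
  show ?thesis using m
  proof (cases rule: index_cases)
    case (2 m')
    then have "m' \<le> \<alpha> ! k - 2" using m by linarith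
    then show ?thesis using 2 k tail_k_mid(1)[of k m'] by (simp add: rar_def K_0)
  next
    case 4
    then show ?thesis using k tail_k_mid(1)[of k m] by (simp add: rar_def)
  qed (use k in \<open>auto simp: rar_def\<close>)
qed

lemma rar_arc: "k < n \<Longrightarrow> m < \<alpha> ! k \<Longrightarrow> rar k m \<in> recon_arrows \<alpha>"
proof -
  assume k: "k < n" and m: "m < \<alpha> ! k"
  show ?thesis using m
  proof (cases rule: index_cases)
    case (2 m')
    then have "m' \<le> \<alpha> ! k - 2" using m by linarith
    then show ?thesis using 2 k tail_k_mid(2)[of k m'] by (simp add: rar_def recon_arrows_def K_0)
  next
    case 3
    have "ar_c (Suc k) k \<in> (\<lambda>t. ar_c t (t - 1)) ` {1..n}"
      using k by (intro image_eqI[of _ _ "Suc k"]) auto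
    moreover have "ar_a (Suc k) (Suc (Suc k)) \<in> (\<lambda>t. ar_a t (t + 1)) ` {0..<n}" if "Suc k \<noteq> n"
      using k that by (intro image_eqI[of _ _ "Suc k"]) auto
    ultimately show ?thesis
      using 3 by (auto simp: rar_def recon_arrows_def cw_arrows_def acw_arrows_def)
  next
    case 4
    then show ?thesis using k tail_k_mid(2)[of k m] by (simp add: rar_def recon_arrows_def)
  qed (use k in \<open>auto simp: rar_def recon_arrows_def\<close>)
qed

lemma rar_head:
  "n = 1 \<Longrightarrow> arrow_head (rar k m) = 0"
  "n \<noteq> 1 \<Longrightarrow> arrow_head (rar k 0) = k"
  "n \<noteq> 1 \<Longrightarrow> 1 \<le> m \<Longrightarrow> m \<noteq> \<alpha> ! k - 1 \<Longrightarrow> arrow_head (rar k m) = 0"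
  "n \<noteq> 1 \<Longrightarrow> k < n \<Longrightarrow> arrow_head (rar k (\<alpha> ! k - 1)) = (if Suc k = n then 0 else Suc (Suc k))"
  using alpha_ge_2[of k] by (auto simp: rar_def)

lemma rXY: "rX \<in> recon_arrows \<alpha>" "arrow_tail \<alpha> rX = 0" "arrow_head rX = n"
  "rY \<in> recon_arrows \<alpha>" "arrow_tail \<alpha> rY = 0" "arrow_head rY = 1"
  using n_ge_1 by (auto simp: rX_def rY_def recon_arrows_def cw_arrows_def acw_arrows_def image_iff)

lemma arrow_cases:
  assumes "e \<in> recon_arrows \<alpha>"
  shows "e = rX \<or> e = rY \<or> (\<exists>k<n. \<exists>m<\<alpha> ! k. e = rar k m)"
proof (cases "\<exists>s. e = ar_k s")
  case True
  then obtain s where s: "e = ar_k s" "1 \<le> s" "s \<le> gam \<alpha>"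
    using assms by (auto simp: recon_arrows_def cw_arrows_def acw_arrows_def split: if_splits)
  then obtain k m where k: "k < n" "1 \<le> m" "m \<le> \<alpha> ! k - 2" "s = K k + m"
    using K_cases[of s n] gam_eq by auto
  show ?thesis
  proof (cases "n = 1")
    case True
    then have "k = 0" using k by simp
    then have "e = rar 0 (Suc s)" "Suc s < \<alpha> ! 0" "0 < n"
      using True s k by (simp_all add: rar_def K_0)
    then show ?thesis by blast
  next
    case False
    moreover have "m < \<alpha> ! k" "m \<noteq> \<alpha> ! k - 1" "m \<noteq> 0" using k by linarith+
    ultimately have "e = rar k m" using s k by (simp add: rar_def)
    then show ?thesis using k \<open>m < \<alpha> ! k\<close> by blast
  qed
next
  case no_k: False
  show ?thesis
  proof (cases "n = 1")
    case True
    have a: "2 \<le> \<alpha> ! 0" using alpha_ge_2[of 0] True by simp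
    have "e = rX \<or> e = rY \<or> e = rar 0 0 \<or> e = rar 0 1"
      using assms no_k True by (auto simp: recon_arrows_def rX_def rY_def rar_def)
    moreover have "0 < n" "0 < \<alpha> ! 0" "1 < \<alpha> ! 0" using a True by simp_all
    ultimately show ?thesis by blast
  next
    case n: False
    then consider "e = rX" | t where "e = ar_c t (t - 1)" "1 \<le> t" "t \<le> n" | "e = ar_a n 0"
      | t where "e = ar_a t (t + 1)" "t < n"
      using assms no_k by (auto simp: recon_arrows_def cw_arrows_def acw_arrows_def rX_def)
    then show ?thesis
    proof cases
      case (2 t)
      then obtain k where t: "t = Suc k" "k < n" by (cases t) auto
      then have "e = rar k 0" "0 < \<alpha> ! k" using 2 n alpha_ge_2[of k] by (simp_all add: rar_def)
      then show ?thesis using t by blast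
    next
      case 3
      obtain k where k: "n = Suc k" using n_ge_1 by (cases n) auto
      then have "e = rar k (\<alpha> ! k - 1)" "\<alpha> ! k - 1 < \<alpha> ! k" "k < n"
        using 3 n alpha_ge_2[of k] by (simp_all add: rar_def)
      then show ?thesis by blast
    next
      case (4 t)
      show ?thesis
      proof (cases t)
        case 0
        then show ?thesis using 4 n by (simp add: rY_def)
      next
        case (Suc k)
        then have "e = rar k (\<alpha> ! k - 1)" "\<alpha> ! k - 1 < \<alpha> ! k" "k < n"
          using 4 n alpha_ge_2[of k] by (simp_all add: rar_def)
        then show ?thesis by blast
      qed
    qed simp
  qed
qed

lemma fX_step: "fX k m = fX k (Suc m) + I (Suc k)"
  by (simp add: fX_def algebra_simps)

lemma lat_rar:
  assumes k: "k < n" and m: "m < \<alpha> ! k"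
  shows "lat (arX k m + I (Suc k) - vI (arrow_head (rar k m))) (arY k m)"
proof -
  have a: "2 \<le> \<alpha> ! k" using alpha_ge_2 k .
  have k0: "lat (arX k 0 + I (Suc k) - I k) (arY k 0)"
    using arX_eq[OF k, of 0] arY_0[OF k] a by (simp add: fX_def lat_def)
  have last: "lat (arX k (\<alpha> ! k - 1) + I (Suc k) - I (Suc (Suc k))) (arY k (\<alpha> ! k - 1))"
  proof -
    have e: "\<alpha> ! k - 1 = Suc (\<alpha> ! k - 2)" using a by simp
    show ?thesis
      using lat_f[of k "\<alpha> ! k - 2"] arX_last[OF k] arY_Suc[OF k, of "\<alpha> ! k - 2"] fX_last[OF k]
      unfolding e by simp
  qed
  \<comment> \<open>An extra arrow ends at vertex 0, and its monomial times
    \<open>x^(i_{k+1})\<close> is the invariant \<open>f k (m - 1)\<close>.\<close>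
  have mid: "lat (arX k m + I (Suc k)) (arY k m)" if "1 \<le> m" "m \<noteq> \<alpha> ! k - 1"
  proof -
    obtain m' where m': "m = Suc m'" using \<open>1 \<le> m\<close> by (cases m) auto
    then show ?thesis
      using lat_f[of k m'] arX_eq[OF k, of m] arY_Suc[OF k, of m'] fX_step[of k m'] that m by simp
  qed
  show ?thesis
  proof (cases "n = 1")
    case True
    then have "k = 0" using k by simp
    moreover have "lat (int r) 0" by (simp add: lat_def)
    ultimately show ?thesis
      using True last mid lat_add[OF k0, of "int r" 0] rar_head(1)[OF True] I_Suc_n
      by (cases "m = 0"; cases "m = \<alpha> ! k - 1") (simp_all add: vI_def)
  next
    case n: False
    consider "m = 0" | "m = \<alpha> ! k - 1" "m \<noteq> 0" | "1 \<le> m" "m \<noteq> \<alpha> ! k - 1"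
      using m by linarith
    then show ?thesis
    proof cases
      case 1
      \<comment> \<open>For \<open>k = 0\<close> the head is vertex 0, whose value is 0 and not
        \<open>I 0 = r\<close>; the two differ by a lattice point.\<close>
      have "lat (int r) 0" by (simp add: lat_def)
      then show ?thesis
        using 1 k0 lat_add[OF k0, of "int r" 0] rar_head(2)[OF n] by (cases "k = 0") (simp_all add: vI_def)
    next
      case 2
      then show ?thesis using last rar_head(4)[OF n k] I_Suc_n by (auto simp: vI_def)
    next
      case 3
      then show ?thesis using mid rar_head(3)[OF n] by (simp add: vI_def)
    qed
  qed
qed

lemma recon_arc_lat:
  assumes "e \<in> recon_arrows \<alpha>"
  shows "lat (int (rwx e) + vI (arrow_tail \<alpha> e) - vI (arrow_head e)) (int (rwy e))"
proof -
  consider "e = rX" | "e = rY" | k m where "k < n" "m < \<alpha> ! k" "e = rar k m"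
    using arrow_cases[OF assms] by blast
  then show ?thesis
  proof cases
    case 1
    then show ?thesis using rXY weight_rXY I_n n_ge_1 by (auto simp: vI_def lat_def)
  next
    case 2
    then show ?thesis using rXY weight_rXY by (simp add: vI_def lat_def)
  next
    case (3 k m)
    then show ?thesis using lat_rar[of k m] weight_rar[of k m] rar_tail[of k m] by (simp add: vI_def)
  qed
qed

lemma rar_head_le: "k < n \<Longrightarrow> m < \<alpha> ! k \<Longrightarrow> arrow_head (rar k m) \<le> n"
  by (auto simp: rar_def)

sublocale RQ: finite_vertex_quiver RQ
proof
  fix e assume "e \<in> arcs RQ"
  then have "e = rX \<or> e = rY \<or> (\<exists>k<n. \<exists>m<\<alpha> ! k. e = rar k m)"
    using arrow_cases by simp
  then show "tail RQ e \<in> verts RQ" "head RQ e \<in> verts RQ"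
    using rXY rar_tail rar_head_le n_ge_1 by auto
qed simp

abbreviation "rwxs p \<equiv> \<Sum>e\<leftarrow>p. rwx e"
abbreviation "rwys p \<equiv> \<Sum>e\<leftarrow>p. rwy e"

section \<open>Shortest clockwise and anticlockwise paths\<close>

definition cw_to :: "nat \<Rightarrow> nat \<Rightarrow> arrow list" where
  "cw_to t i = map (\<lambda>i. ar_c i (i - 1)) (rev [Suc t..<Suc i])"
definition rcp :: "nat \<Rightarrow> arrow list" where "rcp t = ar_c 0 n # cw_to t n"
definition rap :: "nat \<Rightarrow> arrow list" where "rap t = map (\<lambda>i. ar_a i (Suc i)) [0..<t]"

lemma cw_to_Suc: "t \<le> i \<Longrightarrow> cw_to t (Suc i) = ar_c (Suc i) i # cw_to t i"
  by (simp add: cw_to_def)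

lemma cw_to_self: "cw_to t t = []"
  by (simp add: cw_to_def)

lemma cw_to_walk:
  assumes "n \<noteq> 1" "t \<le> i" "i \<le> n"
  shows "RQ.awalk i (cw_to t i) t \<and> int (rwxs (cw_to t i)) = I t - I i \<and> rwys (cw_to t i) = 0"
  using assms(2,3)
proof (induction i rule: dec_induct)
  case base
  then show ?case by (simp add: cw_to_self RQ.awalk_Nil_iff)
next
  case (step i)
  have "ar_c (Suc i) i = rar i 0" using assms(1) by (simp add: rar_def)
  then have "ar_c (Suc i) i \<in> recon_arrows \<alpha>" using rar_arc[of i 0] alpha_ge_2[of i] step by simp
  then show ?case
    using step I_strict[of i] by (simp add: cw_to_Suc RQ.awalk_Cons_iff)
qed

lemma rcp_walk:
  assumes "n \<noteq> 1" "1 \<le> t" "t \<le> n"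
  shows "RQ.awalk 0 (rcp t) t" "int (rwxs (rcp t)) = I t" "rwys (rcp t) = 0"
  using cw_to_walk[of t n] assms I_n rXY by (simp_all add: rcp_def RQ.awalk_Cons_iff rX_def)

lemma ar_a_arc: "n \<noteq> 1 \<Longrightarrow> t < n \<Longrightarrow> ar_a t (Suc t) \<in> recon_arrows \<alpha>"
  by (auto simp: recon_arrows_def acw_arrows_def)

lemma rap_walk:
  assumes "n \<noteq> 1" "t \<le> n"
  shows "RQ.awalk 0 (rap t) t \<and> rwxs (rap t) = 0 \<and> int (rwys (rap t)) = J t"
  using assms(2)
proof (induction t)
  case 0
  then show ?case by (simp add: rap_def RQ.awalk_Nil_iff)
next
  case (Suc t)
  have "RQ.awalk 0 (rap t @ [ar_a t (Suc t)]) (Suc t)"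
    using Suc ar_a_arc[OF assms(1), of t] by (intro RQ.awalk_appendI[of _ _ t]) (auto simp: RQ.awalk_simps)
  then show ?case using Suc J_strict[of t] by (simp add: rap_def)
qed

text \<open>Each vertex has exactly one outgoing clockwise arrow, so the walk is forced until it
  first meets \<open>t\<close>. After that it may go round the cycle again, which accounts for
  \<open>z\<close>.\<close>

lemma cw_prefix:
  assumes "n \<noteq> 1" "t \<le> i" "i \<le> n" "RQ.awalk i p t" "set p \<subseteq> cw_arrows \<alpha>"
  shows "\<exists>z. p = cw_to t i @ z"
  using assms(2-)
proof (induction i arbitrary: p rule: dec_induct)
  case base
  then show ?case by (simp add: cw_to_self)
next
  case (step i)
  then obtain e q where p: "p = e # q" by (cases p) (auto simp: RQ.awalk_simps)
  then have "e \<in> cw_arrows \<alpha>" "arrow_tail \<alpha> e = Suc i" "RQ.awalk (arrow_head e) q t"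
    using step by (auto simp: RQ.awalk_Cons_iff)
  moreover from this have "e = ar_c (Suc i) i" by (auto simp: cw_arrows_def)
  ultimately show ?case using step p by (auto simp: cw_to_Suc)
qed

text \<open>\<open>C_path\<close> is some walk of minimal length. Every competitor extends
  \<open>rcp t\<close>, so minimality leaves only \<open>rcp t\<close> itself.\<close>

lemma C_path_eq:
  assumes n: "n \<noteq> 1" and t: "1 \<le> t" "t \<le> n"
  shows "C_path \<alpha> 0 t = rcp t"
proof -
  let ?P = "\<lambda>p. RQ.awalk 0 p t \<and> set p \<subseteq> cw_arrows \<alpha>"
  have P: "?P (rcp t)"
    using rcp_walk[OF n t] t by (auto simp: rcp_def cw_to_def cw_arrows_def)
  have prefix: "\<exists>z. p = rcp t @ z" if p: "?P p" for p
  proof -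
    obtain e q where e: "p = e # q" using p t by (cases p) (auto simp: RQ.awalk_simps)
    then have "e \<in> cw_arrows \<alpha>" "arrow_tail \<alpha> e = 0" "RQ.awalk (arrow_head e) q t" "set q \<subseteq> cw_arrows \<alpha>"
      using p by (auto simp: RQ.awalk_Cons_iff)
    moreover from this have "e = ar_c 0 n" by (auto simp: cw_arrows_def)
    ultimately show ?thesis using cw_prefix[OF n, of t n q] t e by (auto simp: rcp_def)
  qed
  have "?P (arg_min length ?P)" using P by (rule arg_min_natI)
  moreover have "length (arg_min length ?P) \<le> length (rcp t)" using P by (rule arg_min_nat_le)
  ultimately show ?thesis unfolding C_path_def using prefix by fastforce
qed

lemma acw_prefix:
  assumes "n \<noteq> 1" "i \<le> t" "t \<le> n" "RQ.awalk i p t" "set p \<subseteq> acw_arrows \<alpha>"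
  shows "\<exists>z. p = map (\<lambda>i. ar_a i (Suc i)) [i..<t] @ z"
  using assms(2-)
proof (induction "t - i" arbitrary: i p)
  case (Suc d)
  then obtain e q where p: "p = e # q" by (cases p) (auto simp: RQ.awalk_simps)
  then have "e \<in> acw_arrows \<alpha>" "arrow_tail \<alpha> e = i" "RQ.awalk (arrow_head e) q t"
    using Suc.prems by (auto simp: RQ.awalk_Cons_iff)
  moreover from this have "e = ar_a i (Suc i)" using Suc by (auto simp: acw_arrows_def)
  ultimately have "\<exists>z. q = map (\<lambda>i. ar_a i (Suc i)) [Suc i..<t] @ z"
    using Suc p by (intro Suc.hyps(1)) auto
  then show ?case using p \<open>e = ar_a i (Suc i)\<close> Suc by (auto simp: upt_conv_Cons)
qed simp

lemma A_path_eq: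
  assumes n: "n \<noteq> 1" and t: "1 \<le> t" "t \<le> n"
  shows "A_path \<alpha> 0 t = rap t"
proof -
  let ?P = "\<lambda>p. RQ.awalk 0 p t \<and> set p \<subseteq> acw_arrows \<alpha>"
  have P: "?P (rap t)"
    using rap_walk[OF n t(2)] t by (auto simp: rap_def acw_arrows_def)
  have prefix: "\<exists>z. p = rap t @ z" if p: "?P p" for p
    using acw_prefix[OF n, of 0 t p] p t by (auto simp: rap_def)
  have "?P (arg_min length ?P)" using P by (rule arg_min_natI)
  moreover have "length (arg_min length ?P) \<le> length (rap t)" using P by (rule arg_min_nat_le)
  ultimately show ?thesis unfolding A_path_def using prefix by fastforce
qed

end

section \<open>Relations of the reconstruction algebra\<close>

context hj_fraction
begin

text \<open>
  The two sides of the relation at vertex \<open>k + 1\<close> between its arrows number \<open>m\<close> and \<open>m + 1\<close>, and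
  of the relation at vertex \<open>0\<close> for the invariant \<open>f k m\<close>.
\<close>

definition cyc_l :: "nat \<Rightarrow> nat \<Rightarrow> arrow list" where
  "cyc_l k m = rar k m #
    (if n = 1 then [rY] else if m = 0 then [ar_a k (Suc k)] else rap (Suc k))"

definition cyc_r :: "nat \<Rightarrow> nat \<Rightarrow> arrow list" where
  "cyc_r k m = rar k (Suc m) #
    (if n = 1 then [rX] else if Suc m = \<alpha> ! k - 1 \<and> Suc k \<noteq> n then [ar_c (Suc (Suc k)) (Suc k)]
     else rcp (Suc k))"

text \<open>For \<open>m = 0 < k\<close> and \<open>n \<ge> 2\<close> the arrow
  \<open>rar k 0\<close> leads to \<open>k\<close> and not to vertex 0. The invariant
  \<open>f k 0\<close> is then realised through the last extra arrow with smaller tail, as found in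
  \<open>previous_extra_arrow\<close>.\<close>

definition zer_l :: "nat \<Rightarrow> nat \<Rightarrow> arrow list" where
  "zer_l k m = (if n = 1 then [rY, rar 0 m]
    else if m = 0 \<and> 0 < k then A_path \<alpha> 0 (tail_k \<alpha> (K k)) @ [kk \<alpha> (K k)]
    else rap (Suc k) @ [rar k m])"

definition zer_r :: "nat \<Rightarrow> nat \<Rightarrow> arrow list" where
  "zer_r k m = (if n = 1 then [rX, rar 0 (Suc m)] else rcp (Suc k) @ [rar k (Suc m)])"

section \<open>The monomials of the two sides of each relation\<close>

lemma arY_add_J:
  assumes k: "k < n" and m: "0 < m"
  shows "arY k m + J (Suc k) = arY k (Suc m)"
proof -
  obtain m' where "m = Suc m'" using m by (cases m) auto
  then show ?thesis
    using arY_Suc[OF k, of m'] arY_Suc[OF k, of "Suc m'"] by (simp add: fY_def algebra_simps)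
qed

text \<open>Combining arrow \<open>m + 1\<close> with the clockwise path of monomial
  \<open>x^(i_{k+1})\<close> gives the x-exponent of arrow \<open>m\<close>. For the last arrow this
  rests on \<open>I (n + 1) = 0\<close>, hence on \<open>Suc k = n\<close>; at other vertices
  \<open>cyc_r\<close> returns by a single clockwise arrow there.\<close>

lemma arX_add_I:
  assumes k: "k < n" and m: "Suc m < \<alpha> ! k" "Suc k = n \<or> Suc (Suc m) < \<alpha> ! k"
  shows "arX k (Suc m) + I (Suc k) = arX k m"
proof (cases "Suc (Suc m) < \<alpha> ! k")
  case True
  then show ?thesis using arX_eq[OF k] fX_step[of k m] by simp
next
  case False
  then have "m = \<alpha> ! k - 2" "Suc k = n" using m by auto
  then have "arX k m = I (Suc k)" using arX_eq[OF k m(1)] fX_last[OF k] I_Suc_n by simp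
  moreover have "Suc m = \<alpha> ! k - 1" using False m by simp
  then have "arX k (Suc m) = 0" using arX_last[OF k] by (simp only:)
  ultimately show ?thesis by simp
qed

lemma cyc_l_walk:
  assumes k: "k < n" and m: "Suc m < \<alpha> ! k"
  shows "RQ.awalk (Suc k) (cyc_l k m) (Suc k) \<and>
    int (rwxs (cyc_l k m)) = arX k m \<and> int (rwys (cyc_l k m)) = arY k (Suc m)"
proof -
  have ar: "rar k m \<in> recon_arrows \<alpha>" "arrow_tail \<alpha> (rar k m) = Suc k"
    "int (rwx (rar k m)) = arX k m" "int (rwy (rar k m)) = arY k m"
    using rar_arc[OF k, of m] rar_tail[OF k, of m] weight_rar[OF k, of m] m by simp_all
  have y0: "arY k (Suc 0) = J (Suc k) - J k" "arY k 0 = 0"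
    using arY_Suc[OF k, of 0] arY_0[OF k] by (simp_all add: fY_def)
  consider "n = 1" | "n \<noteq> 1" "m = 0" | "n \<noteq> 1" "m \<noteq> 0" by blast
  then show ?thesis
  proof cases
    case 1
    then have "k = 0" using k by simp
    then have "arY k m + 1 = arY k (Suc m)"
      using y0 arY_add_J[OF k, of m] by (cases "m = 0") auto
    then show ?thesis
      using 1 \<open>k = 0\<close> ar rXY weight_rXY rar_head(1)[OF 1] by (simp add: cyc_l_def RQ.awalk_simps)
  next
    case 2
    then show ?thesis
      using ar y0 ar_a_arc[OF 2(1) k] rar_head(2)[OF 2(1)] J_strict[of k] k
      by (simp add: cyc_l_def RQ.awalk_simps)
  next
    case 3
    then have "arrow_head (rar k m) = 0" using rar_head(3)[of m k] m by simp
    then show ?thesis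
      using 3 ar rap_walk[of "Suc k"] arY_add_J[OF k, of m] k by (simp add: cyc_l_def RQ.awalk_Cons_iff)
  qed
qed

lemma cyc_r_walk:
  assumes k: "k < n" and m: "Suc m < \<alpha> ! k"
  shows "RQ.awalk (Suc k) (cyc_r k m) (Suc k) \<and>
    int (rwxs (cyc_r k m)) = arX k m \<and> int (rwys (cyc_r k m)) = arY k (Suc m)"
proof -
  have ar: "rar k (Suc m) \<in> recon_arrows \<alpha>" "arrow_tail \<alpha> (rar k (Suc m)) = Suc k"
    "int (rwx (rar k (Suc m))) = arX k (Suc m)" "int (rwy (rar k (Suc m))) = arY k (Suc m)"
    using rar_arc[OF k, of "Suc m"] rar_tail[OF k, of "Suc m"] weight_rar[OF k, of "Suc m"] m
    by simp_all
  consider "n = 1" | "n \<noteq> 1" "Suc m = \<alpha> ! k - 1" "Suc k \<noteq> n"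
    | "n \<noteq> 1" "Suc m \<noteq> \<alpha> ! k - 1 \<or> Suc k = n" by blast
  then show ?thesis
  proof cases
    case 1
    then have "k = 0" "I (Suc k) = 1" using k I_n by auto
    then have "arX k (Suc m) + 1 = arX k m"
      using arX_add_I[OF k m] 1 by simp
    then show ?thesis
      using 1 \<open>k = 0\<close> ar rXY weight_rXY rar_head(1)[OF 1] by (simp add: cyc_r_def RQ.awalk_simps)
  next
    case 2
    have "ar_c (Suc (Suc k)) (Suc k) = rar (Suc k) 0" using 2 by (simp add: rar_def)
    then have c: "ar_c (Suc (Suc k)) (Suc k) \<in> recon_arrows \<alpha>"
      using rar_arc[of "Suc k" 0] alpha_ge_2[of "Suc k"] k 2 by simp
    have "m = \<alpha> ! k - 2" using 2 by simp
    then have "arX k m = I (Suc k) - I (Suc (Suc k))" using arX_eq[OF k m] fX_last[OF k] by simp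
    moreover have "arX k (Suc m) = 0" unfolding 2(2) using arX_last[OF k] .
    moreover have "arrow_head (rar k (Suc m)) = Suc (Suc k)"
      unfolding 2(2) using rar_head(4)[OF 2(1) k] 2(3) by simp
    ultimately show ?thesis
      using 2 ar c I_strict[of "Suc k"] k by (simp add: cyc_r_def RQ.awalk_simps)
  next
    case 3
    have "arrow_head (rar k (Suc m)) = 0"
      using 3 rar_head(3)[OF 3(1), of "Suc m" k] rar_head(4)[OF 3(1) k]
      by (cases "Suc m = \<alpha> ! k - 1") simp_all
    moreover have "arX k (Suc m) + I (Suc k) = arX k m"
      using 3 m by (intro arX_add_I[OF k m]) linarith
    moreover have "cyc_r k m = rar k (Suc m) # rcp (Suc k)" using 3 by (auto simp: cyc_r_def)
    ultimately show ?thesis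
      using 3 ar rcp_walk[OF 3(1), of "Suc k"] k by (simp add: RQ.awalk_Cons_iff)
  qed
qed

lemma rap_rar_walk:
  assumes n: "n \<noteq> 1" and k: "k < n" and m: "Suc m < \<alpha> ! k" and km: "m = 0 \<longrightarrow> k = 0"
  shows "RQ.awalk 0 (rap (Suc k) @ [rar k m]) 0 \<and>
    int (rwxs (rap (Suc k) @ [rar k m])) = fX k m \<and> int (rwys (rap (Suc k) @ [rar k m])) = fY k m"
proof -
  have ar: "rar k m \<in> recon_arrows \<alpha>" "arrow_tail \<alpha> (rar k m) = Suc k"
    "int (rwx (rar k m)) = arX k m" "int (rwy (rar k m)) = arY k m"
    using rar_arc[OF k, of m] rar_tail[OF k, of m] weight_rar[OF k, of m] m by simp_all
  have "arrow_head (rar k m) = 0"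
    using rar_head(2,3)[OF n] m km by (cases "m = 0") auto
  moreover have "arY k m + J (Suc k) = fY k m"
    using km arY_add_J[OF k, of m] arY_Suc[OF k, of m] arY_0[OF k] by (cases "m = 0") (auto simp: fY_def)
  moreover have "arX k m = fX k m" using arX_eq[OF k m] .
  moreover have "RQ.awalk 0 (rap (Suc k)) (Suc k)" "rwxs (rap (Suc k)) = 0" "int (rwys (rap (Suc k))) = J (Suc k)"
    using rap_walk[OF n, of "Suc k"] k by simp_all
  moreover have "RQ.awalk (Suc k) [rar k m] 0"
    using ar calculation by (simp add: RQ.awalk_simps)
  ultimately show ?thesis
    using ar RQ.awalk_appendI[of 0 "rap (Suc k)" "Suc k" "[rar k m]" 0]
    by (simp del: RQ.awalk_append_iff)
qed

definition relevant :: "nat \<Rightarrow> nat \<Rightarrow> bool" where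
  "relevant k m \<longleftrightarrow> k < n \<and> Suc m < \<alpha> ! k \<and> (Suc k = n \<or> Suc (Suc m) < \<alpha> ! k)"

lemma zer_l_walk:
  assumes "relevant k m"
  shows "RQ.awalk 0 (zer_l k m) 0 \<and> int (rwxs (zer_l k m)) = fX k m \<and> int (rwys (zer_l k m)) = fY k m"
proof -
  have k: "k < n" and m: "Suc m < \<alpha> ! k" using assms by (auto simp: relevant_def)
  consider "n = 1" | "n \<noteq> 1" "m = 0" "0 < k" | "n \<noteq> 1" "m = 0 \<longrightarrow> k = 0" by blast
  then show ?thesis
  proof cases
    case 1
    then have "k = 0" using k by simp
    then have "arY k m + 1 = fY k m"
      using arY_add_J[OF k, of m] arY_Suc[OF k, of m] arY_0[OF k] by (cases "m = 0") (auto simp: fY_def)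
    then show ?thesis
      using 1 \<open>k = 0\<close> m rXY weight_rXY rar_head(1)[OF 1] weight_rar[OF k, of m] rar_arc[OF k, of m]
        rar_tail[OF k, of m] arX_eq[OF k m]
      by (simp add: zer_l_def RQ.awalk_simps)
  next
    case 2
    then obtain l m' where l: "l < k" "Suc m' < \<alpha> ! l" "tail_k \<alpha> (K k) = Suc l" "kk \<alpha> (K k) = rar l m'"
      "fX l m' = fX k 0" "fY l m' = fY k 0" "m' = 0 \<longrightarrow> l = 0"
      using previous_extra_arrow[OF 2(1,3) k] by blast
    then have "zer_l k m = rap (Suc l) @ [rar l m']"
      using 2 k A_path_eq[OF 2(1), of "Suc l"] by (simp add: zer_l_def)
    then show ?thesis using rap_rar_walk[OF 2(1), of l m'] l k 2(2) by simp
  next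
    case 3
    then have "zer_l k m = rap (Suc k) @ [rar k m]" by (auto simp: zer_l_def)
    then show ?thesis using rap_rar_walk[OF 3(1) k m 3(2)] by simp
  qed
qed

lemma zer_r_walk:
  assumes "relevant k m"
  shows "RQ.awalk 0 (zer_r k m) 0 \<and> int (rwxs (zer_r k m)) = fX k m \<and> int (rwys (zer_r k m)) = fY k m"
proof -
  have k: "k < n" and m: "Suc m < \<alpha> ! k" and km: "Suc k = n \<or> Suc (Suc m) < \<alpha> ! k"
    using assms by (auto simp: relevant_def)
  have ar: "rar k (Suc m) \<in> recon_arrows \<alpha>" "arrow_tail \<alpha> (rar k (Suc m)) = Suc k"
    "int (rwx (rar k (Suc m))) = arX k (Suc m)" "int (rwy (rar k (Suc m))) = arY k (Suc m)"
    using rar_arc[OF k, of "Suc m"] rar_tail[OF k, of "Suc m"] weight_rar[OF k, of "Suc m"] m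
    by simp_all
  have x: "arX k (Suc m) + I (Suc k) = fX k m"
    using arX_add_I[OF k m km] arX_eq[OF k m] by simp
  have y: "arY k (Suc m) = fY k m" using arY_Suc[OF k] .
  show ?thesis
  proof (cases "n = 1")
    case True
    then have "k = 0" "I (Suc k) = 1" using k I_n by auto
    then show ?thesis
      using True ar x y rXY weight_rXY rar_head(1)[OF True] by (simp add: zer_r_def RQ.awalk_simps)
  next
    case n: False
    have "arrow_head (rar k (Suc m)) = 0"
      using km rar_head(3)[OF n, of "Suc m" k] rar_head(4)[OF n k]
      by (cases "Suc m = \<alpha> ! k - 1") auto
    then have "RQ.awalk (Suc k) [rar k (Suc m)] 0" using ar by (simp add: RQ.awalk_simps)
    then show ?thesis
      using n ar x y rcp_walk[OF n, of "Suc k"] k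
        RQ.awalk_appendI[of 0 "rcp (Suc k)" "Suc k" "[rar k (Suc m)]" 0]
      by (simp add: zer_r_def del: RQ.awalk_append_iff)
  qed
qed

section \<open>The relation sets in the uniform numbering\<close>

lemma rels_n1_eq:
  assumes n: "n = 1"
  shows "rels_n1 \<alpha> = (\<Union>m\<in>{m. Suc m < \<alpha> ! 0}. {(cyc_r 0 m, cyc_l 0 m), (zer_r 0 m, zer_l 0 m)})"
    (is "_ = ?R")
proof -
  have a: "2 \<le> \<alpha> ! 0" using alpha_ge_2[of 0] n by simp
  define P where "P m = {(cyc_r 0 m, cyc_l 0 m), (zer_r 0 m, zer_l 0 m)}" for m
  have P: "P 0 = {([dbl_c 2, dbl_a 1], [dbl_c 1, dbl_a 2]), ([dbl_a 1, dbl_c 2], [dbl_a 2, dbl_c 1])}"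
    "P 1 = {([ar_k 1, dbl_a 1], [dbl_c 2, dbl_a 2]), ([dbl_a 1, ar_k 1], [dbl_a 2, dbl_c 2])}"
    "\<And>t. 2 \<le> t \<Longrightarrow> P t = {([ar_k t, dbl_a 1], [ar_k (t - 1), dbl_a 2]), ([dbl_a 1, ar_k t], [dbl_a 2, ar_k (t - 1)])}"
    using n by (simp_all add: P_def cyc_r_def cyc_l_def zer_r_def zer_l_def rar_def rX_def rY_def)
  have "{m. Suc m < \<alpha> ! 0} = {0} \<union> (if \<alpha> ! 0 > 2 then {1} else {}) \<union> {t. 2 \<le> t \<and> t \<le> \<alpha> ! 0 - 2}"
    using a by auto
  then have "?R = P 0 \<union> (if \<alpha> ! 0 > 2 then P 1 else {}) \<union> (\<Union>t\<in>{t. 2 \<le> t \<and> t \<le> \<alpha> ! 0 - 2}. P t)"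
    unfolding P_def[symmetric] by (simp only: UN_Un) simp
  also have "(\<Union>t\<in>{t. 2 \<le> t \<and> t \<le> \<alpha> ! 0 - 2}. P t) =
      {([ar_k t, dbl_a 1], [ar_k (t - 1), dbl_a 2]) | t. 2 \<le> t \<and> t \<le> \<alpha> ! 0 - 2}
      \<union> {([dbl_a 1, ar_k t], [dbl_a 2, ar_k (t - 1)]) | t. 2 \<le> t \<and> t \<le> \<alpha> ! 0 - 2}"
    using P(3) by auto
  finally show ?thesis unfolding rels_n1_def P by auto
qed

end

lemma Collect_shift:
  fixes c b :: nat
  shows "{f s | s. Suc c \<le> s \<and> s < c + b} = {f (c + m) | m. 1 \<le> m \<and> m < b}"
proof -
  have "\<exists>m. s = c + m \<and> 1 \<le> m \<and> m < b" if "Suc c \<le> s" "s < c + b" for s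
    using that by (intro exI[of _ "s - c"]) auto
  then show ?thesis by fastforce
qed

context hj_fraction
begin

lemma rels_first_eq:
  assumes n: "n \<noteq> 1"
  shows "rels_first \<alpha> = {(cyc_l 0 m, cyc_r 0 m) | m. Suc m < \<alpha> ! 0}
    \<union> {(zer_l 0 m, zer_r 0 m) | m. relevant 0 m}"
proof -
  have n2: "Suc 0 < n" using n n_ge_1 by simp
  have rap1: "rap (Suc 0) = [ar_a 0 (Suc 0)]" by (simp add: rap_def)
  have rel: "relevant 0 m \<longleftrightarrow> m < \<alpha> ! 0 - 2" for m using n2 by (auto simp: relevant_def)
  have a0: "2 \<le> \<alpha> ! 0" using alpha_ge_2[of 0] n2 by linarith
  have last: "rar 0 (\<alpha> ! 0 - 1) = ar_a 1 2"
    using n n2 a0 by (auto simp: rar_def numeral_2_eq_2)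
  show ?thesis
  proof (cases "\<alpha> ! 0 = 2")
    case True
    have "cyc_l 0 0 = [ar_c 1 0, ar_a 0 1]" "cyc_r 0 0 = [ar_a 1 2, ar_c 2 1]"
      using n n2 last True by (auto simp: cyc_l_def cyc_r_def rar_def)
    then show ?thesis using True rel by (auto simp: rels_first_def)
  next
    case False
    then have a: "2 < \<alpha> ! 0" using a0 by simp
    have u: "u_ind \<alpha> 1 = \<alpha> ! 0 - 2"
      using u_ind_Suc[of 0] n2 a by (simp add: K_0)
    have "\<alpha> \<noteq> []" using n2 by auto
    then have kk: "kk \<alpha> m = rar 0 m" if "m \<le> \<alpha> ! 0 - 2" for m
      using kk_0[OF n] kk_mid[OF n, of 0 m] that n2 \<open>\<alpha> \<noteq> []\<close> by (cases "m = 0") (simp_all add: K_0)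
    have C: "C_path \<alpha> 0 1 = rcp 1" using C_path_eq[OF n, of 1] n2 by simp
    have l: "cyc_l 0 m = [rar 0 m, ar_a 0 1]" "zer_l 0 m = [ar_a 0 1, rar 0 m]" for m
      using n rap1 by (simp_all add: cyc_l_def zer_l_def)
    have r: "zer_r 0 m = rcp 1 @ [rar 0 (Suc m)]" for m
      using n by (simp add: zer_r_def)
    have r1: "cyc_r 0 m = rar 0 (Suc m) # rcp 1" if "m < \<alpha> ! 0 - 2" for m
      using that n by (auto simp: cyc_r_def)
    have r2: "cyc_r 0 (\<alpha> ! 0 - 2) = [ar_a 1 2, ar_c 2 1]"
    proof -
      have e: "Suc (\<alpha> ! 0 - 2) = \<alpha> ! 0 - 1" using a by simp
      show ?thesis unfolding cyc_r_def e last using n n2 by simp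
    qed
    have "{(cyc_l 0 m, cyc_r 0 m) | m. Suc m < \<alpha> ! 0} =
      {(cyc_l 0 m, cyc_r 0 m) | m. m < \<alpha> ! 0 - 2} \<union> {(cyc_l 0 (\<alpha> ! 0 - 2), cyc_r 0 (\<alpha> ! 0 - 2))}"
    proof -
      have "Suc m < \<alpha> ! 0 \<longleftrightarrow> m < \<alpha> ! 0 - 2 \<or> m = \<alpha> ! 0 - 2" for m using a by auto
      then show ?thesis by auto
    qed
    also have "{(cyc_l 0 m, cyc_r 0 m) | m. m < \<alpha> ! 0 - 2} =
      {(kk \<alpha> s # [ar_a 0 1], kk \<alpha> (s + 1) # C_path \<alpha> 0 1) | s. s < u_ind \<alpha> 1}"
      unfolding u C using kk l(1) r1 by (intro Collect_cong ex_cong1) auto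
    also have "{(cyc_l 0 (\<alpha> ! 0 - 2), cyc_r 0 (\<alpha> ! 0 - 2))} =
      {([kk \<alpha> (u_ind \<alpha> 1), ar_a 0 1], [ar_a 1 2, ar_c 2 1])}"
      unfolding u l r2 using kk by simp
    finally have 1: "{(cyc_l 0 m, cyc_r 0 m) | m. Suc m < \<alpha> ! 0} =
      {(kk \<alpha> s # [ar_a 0 1], kk \<alpha> (s + 1) # C_path \<alpha> 0 1) | s. s < u_ind \<alpha> 1} \<union>
      {([kk \<alpha> (u_ind \<alpha> 1), ar_a 0 1], [ar_a 1 2, ar_c 2 1])}" .
    have 2: "{(zer_l 0 m, zer_r 0 m) | m. relevant 0 m} =
      {([ar_a 0 1, kk \<alpha> s], C_path \<alpha> 0 1 @ [kk \<alpha> (s + 1)]) | s. s < u_ind \<alpha> 1}"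
      unfolding u C rel l(2) r using kk by (intro Collect_cong ex_cong1) auto
    show ?thesis unfolding 1 2 rels_first_def using False by auto
  qed
qed

text \<open>The relations at vertex \<open>k + 1\<close> for \<open>k > 0\<close> and \<open>\<alpha>\<^bsub>k+1\<^esub> > 2\<close> that have the same shape in Step
  \<open>t\<close> and in Step \<open>n\<close>.\<close>

lemma rels_common:
  assumes n: "n \<noteq> 1" and k: "0 < k" "k < n" and a: "2 < \<alpha> ! k"
  shows "ar_c (Suc k) k # [ar_a k (Suc k)] = cyc_l k 0"
    "kk \<alpha> (v_ind \<alpha> (Suc k)) # C_path \<alpha> 0 (Suc k) = cyc_r k 0"
    "C_path \<alpha> 0 (Suc k) @ [kk \<alpha> (v_ind \<alpha> (Suc k))] = zer_r k 0"
    "A_path \<alpha> 0 (tail_k \<alpha> (V_ind \<alpha> (Suc k))) @ [kk \<alpha> (V_ind \<alpha> (Suc k))] = zer_l k 0"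
    "b \<le> \<alpha> ! k - 2 \<Longrightarrow>
      {(kk \<alpha> s # A_path \<alpha> 0 (Suc k), kk \<alpha> (s + 1) # C_path \<alpha> 0 (Suc k))
        | s. v_ind \<alpha> (Suc k) \<le> s \<and> s < K k + b} = {(cyc_l k m, cyc_r k m) | m. 1 \<le> m \<and> m < b}"
    "b \<le> \<alpha> ! k - 2 \<Longrightarrow>
      {(A_path \<alpha> 0 (Suc k) @ [kk \<alpha> s], C_path \<alpha> 0 (Suc k) @ [kk \<alpha> (s + 1)])
        | s. v_ind \<alpha> (Suc k) \<le> s \<and> s < K k + b} = {(zer_l k m, zer_r k m) | m. 1 \<le> m \<and> m < b}"
proof -
  have A: "A_path \<alpha> 0 (Suc k) = rap (Suc k)" and C: "C_path \<alpha> 0 (Suc k) = rcp (Suc k)"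
    using A_path_eq[OF n, of "Suc k"] C_path_eq[OF n, of "Suc k"] k by simp_all
  have v: "v_ind \<alpha> (Suc k) = Suc (K k)" and V: "V_ind \<alpha> (Suc k) = K k"
    using v_ind_Suc[OF k a] V_ind_Suc[OF n k] by simp_all
  have kk: "kk \<alpha> (K k + m) = rar k m" if "1 \<le> m" "m \<le> \<alpha> ! k - 2" for m
    using kk_mid[OF n k(2) that] .
  have kv: "kk \<alpha> (Suc (K k)) = rar k (Suc 0)" using kk[of 1] a by simp
  show "ar_c (Suc k) k # [ar_a k (Suc k)] = cyc_l k 0" using n by (simp add: cyc_l_def rar_def)
  show "kk \<alpha> (v_ind \<alpha> (Suc k)) # C_path \<alpha> 0 (Suc k) = cyc_r k 0"
    using n a C v kv by (auto simp: cyc_r_def)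
  show "C_path \<alpha> 0 (Suc k) @ [kk \<alpha> (v_ind \<alpha> (Suc k))] = zer_r k 0"
    using n C v kv by (simp add: zer_r_def)
  show "A_path \<alpha> 0 (tail_k \<alpha> (V_ind \<alpha> (Suc k))) @ [kk \<alpha> (V_ind \<alpha> (Suc k))] = zer_l k 0"
    using n k V by (simp add: zer_l_def)
  assume b: "b \<le> \<alpha> ! k - 2"
  have l: "cyc_l k m = kk \<alpha> (K k + m) # rap (Suc k)" "zer_l k m = rap (Suc k) @ [kk \<alpha> (K k + m)]"
    "cyc_r k m = kk \<alpha> (K k + m + 1) # rcp (Suc k)" "zer_r k m = rcp (Suc k) @ [kk \<alpha> (K k + m + 1)]"
    if "1 \<le> m \<and> m < b" for m
    using that b n kk[of m] kk[of "Suc m"] by (auto simp: cyc_l_def zer_l_def cyc_r_def zer_r_def)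
  show "{(kk \<alpha> s # A_path \<alpha> 0 (Suc k), kk \<alpha> (s + 1) # C_path \<alpha> 0 (Suc k))
        | s. v_ind \<alpha> (Suc k) \<le> s \<and> s < K k + b} = {(cyc_l k m, cyc_r k m) | m. 1 \<le> m \<and> m < b}"
    unfolding v A C Collect_shift using l(1,3) by (intro Collect_cong ex_cong1) auto
  show "{(A_path \<alpha> 0 (Suc k) @ [kk \<alpha> s], C_path \<alpha> 0 (Suc k) @ [kk \<alpha> (s + 1)])
        | s. v_ind \<alpha> (Suc k) \<le> s \<and> s < K k + b} = {(zer_l k m, zer_r k m) | m. 1 \<le> m \<and> m < b}"
    unfolding v A C Collect_shift using l(2,4) by (intro Collect_cong ex_cong1) auto
qed

text \<open>For index 0 the relation at vertex 0 is listed with its sides exchanged. The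
  comprehension with the dummy \<open>m\<close> is a singleton or empty. It is empty for
  \<open>\<alpha> ! k = 2\<close>, where \<open>f k 0\<close> coincides with
  \<open>f (k + 1) 0\<close> and is left to a later step.\<close>

lemma rels_middle_eq:
  assumes k: "0 < k" "Suc k < n"
  shows "rels_middle \<alpha> (Suc k) = {(cyc_l k m, cyc_r k m) | m. Suc m < \<alpha> ! k}
    \<union> {(zer_r k 0, zer_l k 0) | m :: nat. relevant k 0} \<union> {(zer_l k m, zer_r k m) | m. 1 \<le> m \<and> relevant k m}"
proof -
  have n: "n \<noteq> 1" and kn: "k < n" using k by auto
  have rel: "relevant k m \<longleftrightarrow> m < \<alpha> ! k - 2" for m using k by (auto simp: relevant_def)
  have last: "rar k (\<alpha> ! k - 1) = ar_a (Suc k) (Suc (Suc k))"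
    using n k alpha_ge_2[of k] by (simp add: rar_def)
  have r: "cyc_r k (\<alpha> ! k - 2) = [ar_a (Suc k) (Suc (Suc k)), ar_c (Suc (Suc k)) (Suc k)]"
  proof -
    have e: "Suc (\<alpha> ! k - 2) = \<alpha> ! k - 1" using alpha_ge_2[OF kn] by simp
    show ?thesis unfolding cyc_r_def e last using n k by simp
  qed
  show ?thesis
  proof (cases "\<alpha> ! k = 2")
    case True
    have "cyc_l k 0 = [ar_c (Suc k) k, ar_a k (Suc k)]"
      using n by (simp add: cyc_l_def rar_def)
    then show ?thesis using True rel r by (auto simp: rels_middle_def)
  next
    case False
    then have a: "2 < \<alpha> ! k" using alpha_ge_2[OF kn] by simp
    note common = rels_common[OF n k(1) kn a]
    have u: "u_ind \<alpha> (Suc k) = K k + (\<alpha> ! k - 2)" using u_ind_Suc[OF k(2) a] .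
    have cl: "kk \<alpha> (K k + (\<alpha> ! k - 2)) # A_path \<alpha> 0 (Suc k) = cyc_l k (\<alpha> ! k - 2)"
      using kk_mid[OF n kn, of "\<alpha> ! k - 2"] a n A_path_eq[OF n, of "Suc k"] kn by (simp add: cyc_l_def)
    have "Suc m < \<alpha> ! k \<longleftrightarrow> m = 0 \<or> (1 \<le> m \<and> m < \<alpha> ! k - 2) \<or> m = \<alpha> ! k - 2" for m
      using a by auto
    then show ?thesis
      unfolding rels_middle_def u cl rel common(3,4) common(5,6)[OF order.refl]
      using common(1,2) a r by auto
  qed
qed

lemma rels_last_eq:
  assumes n: "n \<noteq> 1" and k: "Suc k = n"
  shows "rels_last \<alpha> = {(cyc_l k m, cyc_r k m) | m. Suc m < \<alpha> ! k}
    \<union> {(zer_r k 0, zer_l k 0)} \<union> {(zer_l k m, zer_r k m) | m. 1 \<le> m \<and> relevant k m}"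
proof -
  have k0: "0 < k" and kn: "k < n" using n k by auto
  have rel: "relevant k m \<longleftrightarrow> Suc m < \<alpha> ! k" for m using k by (auto simp: relevant_def)
  have last: "rar k (\<alpha> ! k - 1) = ar_a (Suc k) 0"
    using n k alpha_ge_2[OF kn] by (simp add: rar_def)
  have rcp: "rcp (Suc k) = [ar_c 0 (Suc k)]" unfolding k by (simp add: rcp_def cw_to_self)
  have V: "A_path \<alpha> 0 (tail_k \<alpha> (V_ind \<alpha> (Suc k))) @ [kk \<alpha> (V_ind \<alpha> (Suc k))] = zer_l k 0"
    using n k0 V_ind_Suc[OF n k0 kn] by (simp add: zer_l_def)
  note rels_last = rels_last_def[of \<alpha>, unfolded Let_def k[symmetric] diff_Suc_1]
  show ?thesis
  proof (cases "\<alpha> ! k = 2")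
    case True
    then have "rar k (Suc 0) = ar_a (Suc k) 0" using last by simp
    then have "cyc_l k 0 = [ar_c (Suc k) k, ar_a k (Suc k)]" "cyc_r k 0 = [ar_a (Suc k) 0, ar_c 0 (Suc k)]"
      "zer_r k 0 = [ar_c 0 (Suc k), ar_a (Suc k) 0]"
      using n rcp k by (auto simp: cyc_l_def cyc_r_def zer_r_def rar_def)
    moreover have "Suc m < \<alpha> ! k \<longleftrightarrow> m = 0" "\<not> (1 \<le> m \<and> relevant k m)" for m
      using True rel by auto
    ultimately show ?thesis unfolding rels_last V using True by auto
  next
    case False
    then have a: "2 < \<alpha> ! k" using alpha_ge_2[OF kn] by simp
    have C: "C_path \<alpha> 0 (Suc k) = [ar_c 0 (Suc k)]"
      using C_path_eq[OF n, of "Suc k"] rcp kn by simp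
    have A: "A_path \<alpha> 0 (Suc k) = rap (Suc k)"
      using A_path_eq[OF n, of "Suc k"] kn by simp
    note common = rels_common[OF n k0 kn a]
    have u: "u_ind \<alpha> (Suc k) = Suc (K k + (\<alpha> ! k - 2))"
      using u_ind_n gam_eq K_Suc[of k] unfolding k[symmetric] by simp
    define b where "b = K k + (\<alpha> ! k - 2)"
    have kkb: "kk \<alpha> b = rar k (\<alpha> ! k - 2)" "kk \<alpha> (Suc b) = rar k (\<alpha> ! k - 1)"
      using kk_mid[OF n kn, of "\<alpha> ! k - 2"] a kk_last[OF n k] gam_eq K_Suc[of k] k by (simp_all add: b_def)
    have e: "Suc (\<alpha> ! k - 2) = \<alpha> ! k - 1" using a by simp
    have cr: "cyc_r k (\<alpha> ! k - 2) = rar k (Suc (\<alpha> ! k - 2)) # rcp (Suc k)"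
      using n k by (auto simp: cyc_r_def)
    have top: "cyc_l k (\<alpha> ! k - 2) = kk \<alpha> b # A_path \<alpha> 0 (Suc k)"
      "cyc_r k (\<alpha> ! k - 2) = kk \<alpha> (b + 1) # C_path \<alpha> 0 (Suc k)"
      "zer_l k (\<alpha> ! k - 2) = A_path \<alpha> 0 (Suc k) @ [kk \<alpha> b]"
      "zer_r k (\<alpha> ! k - 2) = C_path \<alpha> 0 (Suc k) @ [kk \<alpha> (b + 1)]"
      using n a rcp cr by (simp_all add: kkb A C cyc_l_def zer_l_def zer_r_def e)
    \<comment> \<open>As \<open>u_n\<close> is \<open>gam \<alpha> + 1\<close>, the range of
      \<open>s\<close> is longer by one than in a middle step. The additional index
      \<open>b = gam \<alpha>\<close> brings in the anticlockwise arrow from \<open>n\<close> to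
      0.\<close>
    have s: "v_ind \<alpha> (Suc k) \<le> s \<and> s < Suc b \<longleftrightarrow> (v_ind \<alpha> (Suc k) \<le> s \<and> s < K k + (\<alpha> ! k - 2)) \<or> s = b" for s
      using v_ind_Suc[OF k0 kn a] a by (auto simp: b_def)
    have split: "{f s | s. v_ind \<alpha> (Suc k) \<le> s \<and> s < Suc b} =
      {f s | s. v_ind \<alpha> (Suc k) \<le> s \<and> s < K k + (\<alpha> ! k - 2)} \<union> {f b}"
      for f :: "nat \<Rightarrow> arrow list \<times> arrow list"
      unfolding s by blast
    have m: "Suc m < \<alpha> ! k \<longleftrightarrow> m = 0 \<or> (1 \<le> m \<and> m < \<alpha> ! k - 2) \<or> m = \<alpha> ! k - 2"
      "1 \<le> m \<and> Suc m < \<alpha> ! k \<longleftrightarrow> (1 \<le> m \<and> m < \<alpha> ! k - 2) \<or> m = \<alpha> ! k - 2" for m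
      using a by auto
    have a1: "1 \<le> \<alpha> ! k - 2" using a by simp
    have "rels_last \<alpha> = {(cyc_l k 0, cyc_r k 0), (zer_r k 0, zer_l k 0)}
         \<union> {(kk \<alpha> s # A_path \<alpha> 0 (Suc k), kk \<alpha> (s + 1) # C_path \<alpha> 0 (Suc k))
              | s. v_ind \<alpha> (Suc k) \<le> s \<and> s < Suc b}
         \<union> {(A_path \<alpha> 0 (Suc k) @ [kk \<alpha> s], C_path \<alpha> 0 (Suc k) @ [kk \<alpha> (s + 1)])
              | s. v_ind \<alpha> (Suc k) \<le> s \<and> s < Suc b}"
      unfolding rels_last V u b_def[symmetric] using common(1-3) a C by auto
    also have "\<dots> = {(cyc_l k 0, cyc_r k 0), (zer_r k 0, zer_l k 0)}
        \<union> ({(cyc_l k m, cyc_r k m) | m. 1 \<le> m \<and> m < \<alpha> ! k - 2} \<union> {(cyc_l k (\<alpha> ! k - 2), cyc_r k (\<alpha> ! k - 2))})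
        \<union> ({(zer_l k m, zer_r k m) | m. 1 \<le> m \<and> m < \<alpha> ! k - 2} \<union> {(zer_l k (\<alpha> ! k - 2), zer_r k (\<alpha> ! k - 2))})"
      unfolding split common(5,6)[OF order.refl] top ..
    also have "\<dots> = {(cyc_l k m, cyc_r k m) | m. Suc m < \<alpha> ! k}
      \<union> {(zer_r k 0, zer_l k 0)} \<union> {(zer_l k m, zer_r k m) | m. 1 \<le> m \<and> relevant k m}"
      using a1 unfolding rel m by auto
    finally show ?thesis .
  qed
qed

text \<open>The orientation of the pairs varies from step to step, hence the unordered
  pairs.\<close>

lemma recon_relations_cases:
  assumes "(p, q) \<in> recon_relations \<alpha>"
  shows "(\<exists>k m. k < n \<and> Suc m < \<alpha> ! k \<and> {p, q} = {cyc_l k m, cyc_r k m}) \<or>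
    (\<exists>k m. relevant k m \<and> {p, q} = {zer_l k m, zer_r k m})"
proof (cases "n = 1")
  case True
  then have "(p, q) \<in> rels_n1 \<alpha>" using assms by (simp add: recon_relations_def)
  then obtain m where "Suc m < \<alpha> ! 0" "(p, q) = (cyc_r 0 m, cyc_l 0 m) \<or> (p, q) = (zer_r 0 m, zer_l 0 m)"
    using rels_n1_eq[OF True] by blast
  moreover from this have "relevant 0 m" using True by (simp add: relevant_def)
  ultimately show ?thesis using True by fastforce
next
  case n: False
  then obtain k where k: "Suc k = n" using n_ge_1 by (cases n) auto
  have "(p, q) \<in> rels_first \<alpha> \<or> (\<exists>t. 1 < t \<and> t < n \<and> (p, q) \<in> rels_middle \<alpha> t) \<or> (p, q) \<in> rels_last \<alpha>"
    using assms n by (auto simp: recon_relations_def)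
  then consider "(p, q) \<in> rels_first \<alpha>" | k' where "0 < k'" "Suc k' < n" "(p, q) \<in> rels_middle \<alpha> (Suc k')"
    | "(p, q) \<in> rels_last \<alpha>"
    by (metis Suc_lessE Suc_less_eq One_nat_def)
  then show ?thesis
  proof cases
    case 1
    then show ?thesis using rels_first_eq[OF n] n_ge_1 by (auto simp: Suc_le_eq)
  next
    case (2 k')
    then have "k' < n" by simp
    from 2(3) consider m where "Suc m < \<alpha> ! k'" "p = cyc_l k' m" "q = cyc_r k' m"
      | "relevant k' 0" "p = zer_r k' 0" "q = zer_l k' 0"
      | m where "relevant k' m" "p = zer_l k' m" "q = zer_r k' m"
      unfolding rels_middle_eq[OF 2(1,2)] by blast
    then show ?thesis using \<open>k' < n\<close> by cases (blast, metis insert_commute, blast)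
  next
    case 3
    have "k < n" "relevant k 0" using k alpha_ge_2[of k] by (auto simp: relevant_def)
    from 3 consider m where "Suc m < \<alpha> ! k" "p = cyc_l k m" "q = cyc_r k m"
      | "p = zer_r k 0" "q = zer_l k 0"
      | m where "relevant k m" "p = zer_l k m" "q = zer_r k m"
      unfolding rels_last_eq[OF n k] by blast
    then show ?thesis
      using \<open>k < n\<close> \<open>relevant k 0\<close> by cases (blast, metis insert_commute, blast)
  qed
qed

lemma cyc_relation:
  assumes k: "k < n" and m: "Suc m < \<alpha> ! k"
  shows "(cyc_l k m, cyc_r k m) \<in> recon_relations \<alpha> \<or> (cyc_r k m, cyc_l k m) \<in> recon_relations \<alpha>"
proof (cases "n = 1")
  case True
  then show ?thesis using rels_n1_eq[OF True] assms by (auto simp: recon_relations_def)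
next
  case n: False
  consider "k = 0" | "0 < k" "Suc k < n" | "Suc k = n" using k by linarith
  then show ?thesis
  proof cases
    case 1
    then show ?thesis using rels_first_eq[OF n] n m by (auto simp: recon_relations_def)
  next
    case 2
    then have "(cyc_l k m, cyc_r k m) \<in> rels_middle \<alpha> (Suc k)" using rels_middle_eq[OF 2] m by blast
    moreover have "Suc k \<in> {1<..<n}" using 2 by simp
    ultimately show ?thesis using n unfolding recon_relations_def by auto
  next
    case 3
    then show ?thesis using rels_last_eq[OF n 3] n m by (auto simp: recon_relations_def)
  qed
qed

lemma zer_relation:
  assumes rel: "relevant k m"
  shows "(zer_l k m, zer_r k m) \<in> recon_relations \<alpha> \<or> (zer_r k m, zer_l k m) \<in> recon_relations \<alpha>"
proof (cases "n = 1")
  case True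
  then show ?thesis using rels_n1_eq[OF True] assms by (auto simp: recon_relations_def relevant_def)
next
  case n: False
  have "k < n" using rel by (simp add: relevant_def)
  then consider "k = 0" | "0 < k" "Suc k < n" | "Suc k = n" by linarith
  then show ?thesis
  proof cases
    case 1
    then show ?thesis using rels_first_eq[OF n] n rel by (auto simp: recon_relations_def)
  next
    case 2
    then have "(zer_l k m, zer_r k m) \<in> rels_middle \<alpha> (Suc k) \<or> (zer_r k m, zer_l k m) \<in> rels_middle \<alpha> (Suc k)"
      using rels_middle_eq[OF 2] rel by (cases "m = 0") auto
    moreover have "Suc k \<in> {1<..<n}" using 2 by simp
    ultimately show ?thesis using n unfolding recon_relations_def by auto
  next
    case 3
    then show ?thesis using rels_last_eq[OF n 3] n rel
      by (cases "m = 0") (auto simp: recon_relations_def)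
  qed
qed

end

sublocale hj_fraction \<subseteq> RR: quiver_relations "recon_quiver \<alpha>" "recon_relations \<alpha>"
proof
  fix p q assume "(p, q) \<in> recon_relations \<alpha>"
  then consider k m where "k < length \<alpha>" "Suc m < \<alpha> ! k" "{p, q} = {cyc_l k m, cyc_r k m}"
    | k m where "relevant k m" "{p, q} = {zer_l k m, zer_r k m}"
    using recon_relations_cases by blast
  then show "p \<noteq> [] \<and> q \<noteq> [] \<and> (\<exists>u v. RQ.awalk u p v \<and> RQ.awalk u q v)"
  proof cases
    case (1 k m)
    have "cyc_l k m \<noteq> []" "cyc_r k m \<noteq> []" by (simp_all add: cyc_l_def cyc_r_def)
    then show ?thesis using 1(3) cyc_l_walk[OF 1(1,2)] cyc_r_walk[OF 1(1,2)]
      by (metis doubleton_eq_iff)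
  next
    case (2 k m)
    have "zer_l k m \<noteq> []" "zer_r k m \<noteq> []" by (simp_all add: zer_l_def zer_r_def)
    then show ?thesis using 2(2) zer_l_walk[OF 2(1)] zer_r_walk[OF 2(1)]
      by (metis doubleton_eq_iff)
  qed
qed

context hj_fraction
begin

section \<open>The reconstruction algebra as an instance of the abstract presentation\<close>

lemma relation_weights:
  assumes "(p, q) \<in> recon_relations \<alpha>"
  shows "rwxs p = rwxs q \<and> rwys p = rwys q"
  using recon_relations_cases[OF assms]
proof (elim disjE exE conjE)
  fix k m assume 1: "k < n" "Suc m < \<alpha> ! k" "{p, q} = {cyc_l k m, cyc_r k m}"
  then have "rwxs (cyc_l k m) = rwxs (cyc_r k m)" "rwys (cyc_l k m) = rwys (cyc_r k m)"
    using cyc_l_walk[OF 1(1,2)] cyc_r_walk[OF 1(1,2)] by (simp_all flip: of_nat_eq_iff)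
  then show ?thesis using 1(3) by (auto simp: doubleton_eq_iff)
next
  fix k m assume 1: "relevant k m" "{p, q} = {zer_l k m, zer_r k m}"
  then have "rwxs (zer_l k m) = rwxs (zer_r k m)" "rwys (zer_l k m) = rwys (zer_r k m)"
    using zer_l_walk[OF 1(1)] zer_r_walk[OF 1(1)] by (simp_all flip: of_nat_eq_iff)
  then show ?thesis using 1(2) by (auto simp: doubleton_eq_iff)
qed

text \<open>The exchange of x and y at vertex 0 needs relations whose two sides begin with the two
  different arrows.\<close>

lemma zer_first_arrow:
  assumes "relevant k m"
  shows "\<exists>p. zer_l k m = rY # p" "\<exists>q. zer_r k m = rX # q"
proof -
  have k: "k < n" using assms by (simp add: relevant_def)
  have rap: "\<exists>p. rap (Suc l) = rY # p" if "n \<noteq> 1" for l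
    using that by (simp add: rap_def rY_def upt_conv_Cons del: upt_Suc)
  show "\<exists>q. zer_r k m = rX # q" by (auto simp: zer_r_def rcp_def rX_def)
  show "\<exists>p. zer_l k m = rY # p"
  proof (cases "n \<noteq> 1 \<and> m = 0 \<and> 0 < k")
    case True
    then obtain l m' where "l < k" "tail_k \<alpha> (K k) = Suc l"
      using previous_extra_arrow[of k] k by blast
    then have "A_path \<alpha> 0 (tail_k \<alpha> (K k)) = rap (Suc l)"
      using A_path_eq[of "Suc l"] k True by simp
    then show ?thesis using True rap[of l] by (auto simp: zer_l_def)
  next
    case False
    then show ?thesis using rap[of k] by (auto simp: zer_l_def)
  qed
qed

lemma path_eqv_symmetric_rel:
  assumes "(p, q) \<in> recon_relations \<alpha> \<or> (q, p) \<in> recon_relations \<alpha>" "RQ.awalk u p v" "RQ.awalk u q v"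
  shows "RR.path_eqv (u, p, v) (u, q, v)"
  using assms RR.path_eqv_rel(2) RR.path_eqv_sym by blast

sublocale TP: toric_presentation r a \<alpha> RQ rar rX rY rwx rwy RR.path_eqv
proof unfold_locales
  show "verts RQ = {0..n}" by simp
  show "{e \<in> arcs RQ. tail RQ e = 0} = {rX, rY}"
  proof (intro equalityI subsetI)
    fix e assume "e \<in> {e \<in> arcs RQ. tail RQ e = 0}"
    then show "e \<in> {rX, rY}" using arrow_cases[of e] rar_tail by fastforce
  qed (use rXY in auto)
  show "{e \<in> arcs RQ. tail RQ e = Suc k} = rar k ` {..<\<alpha> ! k}" if "k < n" for k
  proof (intro equalityI subsetI)
    fix e assume e: "e \<in> {e \<in> arcs RQ. tail RQ e = Suc k}"
    then obtain l m where "l < n" "m < \<alpha> ! l" "e = rar l m"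
      using arrow_cases[of e] rXY(2,5) by auto
    then show "e \<in> rar k ` {..<\<alpha> ! k}" using e rar_tail[of l m] by auto
  qed (use that rar_arc rar_tail in auto)
  show "lat (int (rwx e) + vI (tail RQ e) - vI (head RQ e)) (int (rwy e))" if "e \<in> arcs RQ" for e
    using recon_arc_lat that by simp
  show "\<exists>p q. RQ.awalk (Suc k) (rar k m # p) (Suc k) \<and> RQ.awalk (Suc k) (rar k (Suc m) # q) (Suc k) \<and>
        RR.path_eqv (Suc k, rar k m # p, Suc k) (Suc k, rar k (Suc m) # q, Suc k) \<and>
        int (\<Sum>e\<leftarrow>rar k m # p. rwx e) = arX k m \<and> int (\<Sum>e\<leftarrow>rar k m # p. rwy e) = arY k (Suc m) \<and>
        int (\<Sum>e\<leftarrow>rar k (Suc m) # q. rwx e) = arX k m \<and> int (\<Sum>e\<leftarrow>rar k (Suc m) # q. rwy e) = arY k (Suc m)"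
    if k: "k < n" and m: "Suc m < \<alpha> ! k" for k m
  proof -
    have "\<exists>p. cyc_l k m = rar k m # p" "\<exists>q. cyc_r k m = rar k (Suc m) # q"
      by (simp_all add: cyc_l_def cyc_r_def)
    then obtain p q where pq: "cyc_l k m = rar k m # p" "cyc_r k m = rar k (Suc m) # q" by blast
    then show ?thesis
      using cyc_l_walk[OF k m] cyc_r_walk[OF k m]
        path_eqv_symmetric_rel[OF cyc_relation[OF k m], of "Suc k" "Suc k"] unfolding pq by blast
  qed
  show "\<exists>p q. RQ.awalk 0 (rY # p) 0 \<and> RQ.awalk 0 (rX # q) 0 \<and> RR.path_eqv (0, rY # p, 0) (0, rX # q, 0) \<and>
        int (\<Sum>e\<leftarrow>rY # p. rwx e) = fX k m \<and> int (\<Sum>e\<leftarrow>rY # p. rwy e) = fY k m \<and>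
        int (\<Sum>e\<leftarrow>rX # q. rwx e) = fX k m \<and> int (\<Sum>e\<leftarrow>rX # q. rwy e) = fY k m"
    if "k < n" "Suc m < \<alpha> ! k" "Suc k = n \<or> Suc (Suc m) < \<alpha> ! k" for k m
  proof -
    have rel: "relevant k m" using that by (simp add: relevant_def)
    obtain p q where pq: "zer_l k m = rY # p" "zer_r k m = rX # q"
      using zer_first_arrow[OF rel] by blast
    then show ?thesis
      using zer_l_walk[OF rel] zer_r_walk[OF rel]
        path_eqv_symmetric_rel[OF zer_relation[OF rel], of 0 0] unfolding pq by blast
  qed
  show "rwx rX = 1" "rwy rX = 0" "rwx rY = 0" "rwy rY = 1"
    by (fact weight_rXY)+
  show "int (rwx (rar k m)) = arX k m \<and> int (rwy (rar k m)) = arY k m" if "k < n" "m < \<alpha> ! k" for k m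
    using that by (rule weight_rar)
  show "RR.path_eqv (u, p, v) (u, p, v)" if "RQ.awalk u p v" for u p v
    using that by (rule RR.path_eqv_refl)
  show "RR.path_eqv \<pi>' \<pi>" if "RR.path_eqv \<pi> \<pi>'" for \<pi> \<pi>'
    using that by (rule RR.path_eqv_sym)
  show "RR.path_eqv \<pi> \<pi>''" if "RR.path_eqv \<pi> \<pi>'" "RR.path_eqv \<pi>' \<pi>''" for \<pi> \<pi>' \<pi>''
    using that by (rule RR.path_eqv_trans)
  show "RR.path_eqv (u, p @ q, w) (u, p' @ q, w)"
    if "RR.path_eqv (u, p, v) (u, p', v)" "RQ.awalk v q w" for u p v p' q w
    using that by (rule RR.path_eqv_append)
  show "RR.path_eqv (tail RQ e, e # p, w) (tail RQ e, e # p', w)"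
    if "RR.path_eqv (head RQ e, p, w) (head RQ e, p', w)" "e \<in> arcs RQ" for e p w p'
    using that by (rule RR.path_eqv_Cons)
qed

end

section \<open>Modules of semi-invariants\<close>

definition mono2 :: "complex \<Rightarrow> nat \<Rightarrow> nat \<Rightarrow> complex poly poly" where
  "mono2 c i j = monom (monom c i) j"

abbreviation coeff2 :: "complex poly poly \<Rightarrow> nat \<Rightarrow> nat \<Rightarrow> complex" where
  "coeff2 f i j \<equiv> poly.coeff (poly.coeff f j) i"

lemma coeff2_mono2: "coeff2 (mono2 c i j) i' j' = (if i = i' \<and> j = j' then c else 0)"
  by (simp add: mono2_def)

lemma poly2_eqI: "(\<And>i j. coeff2 f i j = coeff2 g i j) \<Longrightarrow> f = g"
  by (intro poly_eqI) simp

lemma mono2_mult: "mono2 c i j * mono2 d i' j' = mono2 (c * d) (i + i') (j + j')"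
  by (simp add: mono2_def mult_monom)

lemma mono2_add: "mono2 (c + d) i j = mono2 c i j + mono2 d i j"
  by (simp add: mono2_def add_monom)

lemma mono2_0 [simp]: "mono2 0 i j = 0"
  by (simp add: mono2_def)

lemma mono2_1: "mono2 1 0 0 = 1"
  by (simp add: mono2_def monom_0 flip: one_pCons)

lemma mono2_expansion: "f = (\<Sum>j\<le>degree f. \<Sum>i\<le>degree (poly.coeff f j). mono2 (coeff2 f i j) i j)"
proof -
  have "(\<Sum>i\<le>degree (poly.coeff f j). mono2 (coeff2 f i j) i j) = monom (poly.coeff f j) j" for j
    using poly_as_sum_of_monoms[of "poly.coeff f j"]
    by (simp add: mono2_def flip: monom_sum)
  then show ?thesis by (simp add: poly_as_sum_of_monoms)
qed

lemma coeff2_mono2_mult: "coeff2 (mono2 1 i j * f) i' j' = (if i \<le> i' \<and> j \<le> j' then coeff2 f (i' - i) (j' - j) else 0)"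
  by (simp add: mono2_def coeff_monom_mult)

section \<open>The action of the cyclic group on coefficients\<close>

definition diag2 :: "complex \<Rightarrow> complex \<Rightarrow> complex ^ 2 ^ 2" where
  "diag2 c d = vector [vector [c, 0], vector [0, d]]"

lemma diag2_entries: "diag2 c d $ 1 $ 1 = c" "diag2 c d $ 1 $ 2 = 0" "diag2 c d $ 2 $ 1 = 0" "diag2 c d $ 2 $ 2 = d"
  by (simp_all add: diag2_def)

lemma diag2_mult: "diag2 c d ** diag2 c' d' = diag2 (c * c') (d * d')"
  by (simp add: vec_eq_iff forall_2 matrix_matrix_mult_def sum_2 diag2_entries)

lemma diag2_one: "diag2 1 1 = mat 1"
  by (simp add: vec_eq_iff forall_2 diag2_entries mat_def)

lemma coeff2_diag2_act: "coeff2 (gl2_act (diag2 c d) f) i j = c ^ i * d ^ j * coeff2 f i j"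
proof -
  have inner: "poly (map_poly const2 p) [:[:0, c:]:] = [:pcompose p [:0, c:]:]" for p
    by (induction p) (simp_all add: map_poly_pCons const2_def pcompose_pCons)
  have u: "const2 c * var_x + const2 0 * var_y = [:[:0, c:]:]"
    and v: "const2 0 * var_x + const2 d * var_y = [:0, [:d:]:]"
    by (simp_all add: const2_def var_x_def var_y_def)
  have "coeff2 (poly (map_poly (\<lambda>p. [:pcompose p [:0, c:]:]) f) [:0, [:d:]:]) i j = c ^ i * d ^ j * coeff2 f i j"
  proof (induction f arbitrary: j)
    case 0
    then show ?case by simp
  next
    case (pCons p f)
    then show ?case
      by (cases j) (simp_all add: map_poly_pCons coeff_pcompose_linear)
  qed
  then show ?thesis
    by (simp add: gl2_act_def subst2_def diag2_entries u v inner)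
qed

lemma const2_mult_coeff2: "coeff2 (const2 c * f) i j = c * coeff2 f i j"
  by (simp add: const2_def)

lemma primitive_root_powi:
  assumes "primitive_root_of_unity r \<epsilon>"
  shows "\<epsilon> powi m = 1 \<longleftrightarrow> int r dvd m"
proof -
  have r: "0 < r" "\<epsilon> ^ r = 1" and prim: "\<And>k. 0 < k \<Longrightarrow> k < r \<Longrightarrow> \<epsilon> ^ k \<noteq> 1"
    using assms by (auto simp: primitive_root_of_unity_def)
  have nz: "\<epsilon> \<noteq> 0" using r by (auto simp: power_0_left)
  define k where "k = nat (m mod int r)"
  have k: "m mod int r = int k" "k < r" using r by (simp_all add: k_def nat_less_iff)
  have "\<epsilon> powi m = \<epsilon> powi (int r * (m div int r) + m mod int r)" by simp
  also have "\<dots> = \<epsilon> powi (int r * (m div int r)) * \<epsilon> powi (m mod int r)"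
    using nz by (intro power_int_add) simp
  also have "\<epsilon> powi (int r * (m div int r)) = (\<epsilon> powi int r) powi (m div int r)"
    by (rule power_int_mult)
  also have "(\<epsilon> powi int r) powi (m div int r) * \<epsilon> powi (m mod int r) = \<epsilon> ^ k" using r k by simp
  finally have "\<epsilon> powi m = \<epsilon> ^ k" .
  moreover have "int r dvd m \<longleftrightarrow> k = 0" using k by (simp add: dvd_eq_mod_eq_0)
  ultimately show ?thesis using prim[of k] k by (cases "k = 0") auto
qed

locale cyclic_quotient =
  fixes r a :: nat and \<epsilon> :: complex
  assumes coprime_ra: "coprime r a" and r_pos: "0 < r" and primitive: "primitive_root_of_unity r \<epsilon>"
begin

text \<open>The group acts diagonally on monomials, so semi-invariance is a condition on the support
  alone.\<close>

definition S :: "int \<Rightarrow> complex poly poly set" where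
  "S t = {f. \<forall>i j. coeff2 f i j \<noteq> 0 \<longrightarrow> int r dvd int i + int a * int j - t}"

lemma zeta_eq: "zeta a \<epsilon> = diag2 \<epsilon> (\<epsilon> ^ a)"
  by (simp add: zeta_def diag2_def)

lemma eps_nz: "\<epsilon> \<noteq> 0"
  using primitive r_pos by (auto simp: primitive_root_of_unity_def power_0_left)

lemma eps_power_eq: "\<epsilon> ^ i * (\<epsilon> ^ a) ^ j = \<epsilon> powi t \<longleftrightarrow> int r dvd int i + int a * int j - t"
proof -
  have "\<epsilon> ^ i * (\<epsilon> ^ a) ^ j = \<epsilon> powi (int i + int a * int j)"
    using eps_nz by (simp add: power_int_add power_int_of_nat power_mult flip: of_nat_mult)
  then have "\<epsilon> ^ i * (\<epsilon> ^ a) ^ j = \<epsilon> powi t \<longleftrightarrow> \<epsilon> powi (int i + int a * int j - t) = 1"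
    using eps_nz by (simp add: power_int_diff)
  then show ?thesis using primitive_root_powi[OF primitive] by simp
qed

lemma carrier_S_mod: "carrier (S_mod a \<epsilon> t) = S t"
proof -
  have "gl2_act (zeta a \<epsilon>) f = const2 (\<epsilon> powi t) * f \<longleftrightarrow> f \<in> S t" for f
  proof -
    have "gl2_act (zeta a \<epsilon>) f = const2 (\<epsilon> powi t) * f \<longleftrightarrow>
      (\<forall>i j. \<epsilon> ^ i * (\<epsilon> ^ a) ^ j * coeff2 f i j = \<epsilon> powi t * coeff2 f i j)"
      using poly2_eqI[of "gl2_act (zeta a \<epsilon>) f" "const2 (\<epsilon> powi t) * f"]
      by (auto simp: zeta_eq coeff2_diag2_act const2_mult_coeff2 dest: arg_cong[where f = "\<lambda>g. coeff2 g _ _"])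
    then show ?thesis using eps_power_eq by (auto simp: S_def)
  qed
  then show ?thesis by (simp add: S_mod_def)
qed

lemma generate_zeta: "g \<in> cyclic_G a \<epsilon> \<Longrightarrow> \<exists>k. g = diag2 (\<epsilon> ^ k) ((\<epsilon> ^ a) ^ k)"
  unfolding cyclic_G_def
proof (induction g rule: generate.induct)
  case one
  then show ?case by (intro exI[of _ 0]) (simp add: GL2_def diag2_one)
next
  case (incl h)
  then show ?case by (intro exI[of _ 1]) (simp add: zeta_eq)
next
  case (inv h)
  have r: "\<epsilon> ^ r = 1" using primitive by (simp add: primitive_root_of_unity_def)
  \<comment> \<open>Since the generator has trivial r-th power, its inverse is the power with
    exponent \<open>s = r - 1\<close>; uniqueness of inverses then identifies the value of the
    inverse in \<open>GL2\<close>.\<close>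
  obtain s where s: "r = Suc s" using r_pos by (cases r) auto
  have one: "\<epsilon> * \<epsilon> ^ s = 1" "\<epsilon> ^ a * (\<epsilon> ^ a) ^ s = 1"
    using r s by (simp, metis power_Suc power_mult mult.commute power_one)
  let ?y = "diag2 (\<epsilon> ^ s) ((\<epsilon> ^ a) ^ s)"
  have y: "zeta a \<epsilon> ** ?y = mat 1" "?y ** zeta a \<epsilon> = mat 1"
    using one by (simp_all add: zeta_eq diag2_mult diag2_one mult.commute)
  have "inv\<^bsub>GL2\<^esub> (zeta a \<epsilon>) = ?y"
    unfolding m_inv_def
  proof (rule the_equality)
    show "?y \<in> carrier GL2 \<and> zeta a \<epsilon> \<otimes>\<^bsub>GL2\<^esub> ?y = \<one>\<^bsub>GL2\<^esub> \<and> ?y \<otimes>\<^bsub>GL2\<^esub> zeta a \<epsilon> = \<one>\<^bsub>GL2\<^esub>"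
      using y by (auto simp: GL2_def invertible_def)
  next
    fix z assume "z \<in> carrier GL2 \<and> zeta a \<epsilon> \<otimes>\<^bsub>GL2\<^esub> z = \<one>\<^bsub>GL2\<^esub> \<and> z \<otimes>\<^bsub>GL2\<^esub> zeta a \<epsilon> = \<one>\<^bsub>GL2\<^esub>"
    then have "zeta a \<epsilon> ** z = mat 1" by (simp add: GL2_def)
    then have "?y = ?y ** (zeta a \<epsilon> ** z)" by (simp add: matrix_mul_rid)
    also have "\<dots> = z" using y by (simp add: matrix_mul_assoc matrix_mul_lid)
    finally show "z = ?y" by simp
  qed
  then show ?case using inv by auto
next
  case (eng h1 h2)
  then obtain k1 k2 where "h1 = diag2 (\<epsilon> ^ k1) ((\<epsilon> ^ a) ^ k1)" "h2 = diag2 (\<epsilon> ^ k2) ((\<epsilon> ^ a) ^ k2)"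
    by blast
  then show ?case by (intro exI[of _ "k1 + k2"]) (simp add: GL2_def diag2_mult power_add)
qed

lemma carrier_invariant_ring: "carrier (invariant_ring (cyclic_G a \<epsilon>)) = S 0"
proof -
  have "(\<forall>g\<in>cyclic_G a \<epsilon>. gl2_act g f = f) \<longleftrightarrow> f \<in> S 0" for f
  proof
    assume "\<forall>g\<in>cyclic_G a \<epsilon>. gl2_act g f = f"
    moreover have "zeta a \<epsilon> \<in> cyclic_G a \<epsilon>" by (simp add: cyclic_G_def generate.incl)
    ultimately have "gl2_act (zeta a \<epsilon>) f = const2 (\<epsilon> powi 0) * f"
      by (simp add: const2_def flip: one_pCons)
    then show "f \<in> S 0" using carrier_S_mod[of 0] by (auto simp: S_mod_def)
  next
    assume f: "f \<in> S 0"
    show "\<forall>g\<in>cyclic_G a \<epsilon>. gl2_act g f = f"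
    proof
      fix g assume "g \<in> cyclic_G a \<epsilon>"
      then obtain k where g: "g = diag2 (\<epsilon> ^ k) ((\<epsilon> ^ a) ^ k)" using generate_zeta by blast
      have "(\<epsilon> ^ k) ^ i * ((\<epsilon> ^ a) ^ k) ^ j * coeff2 f i j = coeff2 f i j" for i j
      proof (cases "coeff2 f i j = 0")
        case False
        then have "\<epsilon> ^ i * (\<epsilon> ^ a) ^ j = 1" using f eps_power_eq[of i j 0] by (simp add: S_def)
        then have "(\<epsilon> ^ i * (\<epsilon> ^ a) ^ j) ^ k = 1" by simp
        then show ?thesis by (simp add: power_mult_distrib ac_simps flip: power_mult)
      qed simp
      then show "gl2_act g f = f" by (intro poly2_eqI) (simp add: g coeff2_diag2_act)
    qed
  qed
  then show ?thesis by (simp add: invariant_ring_def)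
qed

lemma S_zero: "0 \<in> S t"
  by (simp add: S_def)

lemma S_add: "f \<in> S t \<Longrightarrow> g \<in> S t \<Longrightarrow> f + g \<in> S t"
  by (auto simp: S_def) (metis add.right_neutral)

lemma S_sum: "(\<And>x. x \<in> A \<Longrightarrow> f x \<in> S t) \<Longrightarrow> (\<Sum>x\<in>A. f x) \<in> S t"
  by (induction A rule: infinite_finite_induct) (auto simp: S_zero S_add)

lemma S_mono2: "int r dvd int i + int a * int j - t \<Longrightarrow> mono2 c i j \<in> S t"
  by (auto simp: S_def coeff2_mono2)

lemma S_mult:
  assumes f: "f \<in> S s" and g: "g \<in> S t"
  shows "f * g \<in> S (s + t)"
  unfolding S_def
proof (intro CollectI allI impI)
  fix i j assume nz: "coeff2 (f * g) i j \<noteq> 0"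
  have "coeff2 (f * g) i j = (\<Sum>l\<le>j. \<Sum>k\<le>i. coeff2 f k l * coeff2 g (i - k) (j - l))"
    by (simp add: coeff_mult coeff_sum)
  then obtain l k where lk: "l \<le> j" "k \<le> i" "coeff2 f k l * coeff2 g (i - k) (j - l) \<noteq> 0"
    using nz by (metis (no_types, lifting) atMost_iff sum.neutral)
  then have "int r dvd int k + int a * int l - s" "int r dvd int (i - k) + int a * int (j - l) - t"
    using f g unfolding S_def by fastforce+
  then have "int r dvd (int k + int a * int l - s) + (int (i - k) + int a * int (j - l) - t)"
    by (rule dvd_add)
  also have "\<dots> = int i + int a * int j - (s + t)"
    using lk by (simp add: of_nat_diff algebra_simps)
  finally show "int r dvd int i + int a * int j - (s + t)" .
qed

lemma x_power_in_S: "mono2 c (nat (t mod int r)) 0 \<in> S t"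
proof (rule S_mono2)
  have "int r dvd t mod int r - t" by (metis dvd_minus_mod dvd_diff_commute)
  then show "int r dvd int (nat (t mod int r)) + int a * int 0 - t"
    using r_pos by simp
qed

text \<open>Coprimality makes \<open>a\<close> invertible modulo \<open>r\<close>, so
  \<open>a * j\<close> can be given any residue.\<close>

lemma y_power_in_S: "\<exists>j. mono2 c 0 j \<in> S t"
proof -
  obtain b where b: "[int a * b = 1] (mod int r)"
    using coprime_ra cong_solve_coprime_int[of "int a" "int r"] by (auto simp: coprime_commute)
  define j where "j = nat ((b * t) mod int r)"
  have "[int a * int j = int a * (b * t)] (mod int r)"
    using r_pos by (intro cong_mult) (simp_all add: j_def cong_def)
  also have "[int a * (b * t) = t] (mod int r)"
    using cong_mult[OF b cong_refl[of t]] by (simp add: mult.assoc)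
  finally have "int r dvd int a * int j - t" by (simp add: cong_iff_dvd_diff)
  then show ?thesis by (intro exI[of _ j] S_mono2) simp
qed

text \<open>
  Applying linearity to a power of \<open>x\<close> and a power of \<open>y\<close> in \<open>S s\<close> shows that the ratio
  \<open>\<phi> f / f\<close>, which does not depend on \<open>f\<close>, is a polynomial.
\<close>

theorem S_hom_is_mult:
  assumes maps: "\<And>f. f \<in> S s \<Longrightarrow> \<phi> f \<in> S t"
    and linear: "\<And>g f. g \<in> S 0 \<Longrightarrow> f \<in> S s \<Longrightarrow> \<phi> (g * f) = g * \<phi> f"
  shows "\<exists>h \<in> S (t - s). \<forall>f \<in> S s. \<phi> f = f * h"
proof -
  have exchange: "\<phi> f * g = \<phi> g * f" if f: "f \<in> S s" and g: "g \<in> S s" for f g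
  proof -
    \<comment> \<open>A multiplier from \<open>S (- s)\<close> turns \<open>f\<close> and
      \<open>g\<close> into invariants, over which \<phi> is linear; the image of the triple product
      is then computed in two ways.\<close>
    obtain i where m: "mono2 1 i 0 \<in> S (- s)" using x_power_in_S by blast
    let ?m = "mono2 1 i 0"
    have "?m * g \<in> S 0" "?m * f \<in> S 0" using S_mult[OF m g] S_mult[OF m f] by simp_all
    then have "?m * g * \<phi> f = \<phi> (?m * g * f)" "?m * f * \<phi> g = \<phi> (?m * f * g)"
      using linear f g by simp_all
    then have "?m * (\<phi> f * g) = ?m * (\<phi> g * f)" by (simp add: ac_simps)
    moreover have "?m \<noteq> 0" by (simp add: mono2_def)
    ultimately show ?thesis by (simp only: mult_cancel_left) simp
  qed
  obtain i j where x: "mono2 1 i 0 \<in> S s" and y: "mono2 1 0 j \<in> S s"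
    using x_power_in_S y_power_in_S by blast
  let ?x = "mono2 1 i 0" and ?y = "mono2 1 0 j"
  \<comment> \<open>This is the quotient of \<open>\<phi> ?y\<close> by \<open>?y\<close>, formed
    without knowing divisibility: \<open>poly_shift\<close> discards the terms of y-degree below
    \<open>j\<close>. Comparing coefficients at y-degree \<open>j + l\<close> in
    \<open>?y * \<phi> ?x = ?x * \<phi> ?y\<close> shows \<open>\<phi> ?x = ?x * h\<close>.\<close>
  define h where "h = poly_shift j (\<phi> ?y)"
  have "coeff2 (\<phi> ?x) k l = coeff2 (?x * h) k l" for k l
  proof -
    have "coeff2 (?y * \<phi> ?x) k (j + l) = coeff2 (?x * \<phi> ?y) k (j + l)"
      using exchange[OF x y] by (simp add: ac_simps)
    then show ?thesis by (simp add: coeff2_mono2_mult h_def coeff_poly_shift add.commute)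
  qed
  then have xh: "\<phi> ?x = ?x * h" by (rule poly2_eqI)
  have "h \<in> S (t - s)"
    unfolding S_def
  proof (intro CollectI allI impI)
    fix k l assume "coeff2 h k l \<noteq> 0"
    then have "coeff2 (\<phi> ?x) (i + k) l \<noteq> 0" by (simp add: xh coeff2_mono2_mult)
    then have "int r dvd int (i + k) + int a * int l - t" using maps[OF x] unfolding S_def by blast
    moreover have "int r dvd int i - s"
    proof -
      have "coeff2 ?x i 0 \<noteq> 0" by (simp add: coeff2_mono2)
      then show ?thesis using x unfolding S_def by fastforce
    qed
    ultimately have "int r dvd (int (i + k) + int a * int l - t) - (int i - s)" by (rule dvd_diff)
    then show "int r dvd int k + int a * int l - (t - s)" by (simp add: algebra_simps)
  qed
  moreover have "\<phi> f = f * h" if "f \<in> S s" for f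
  proof -
    have "?x * \<phi> f = ?x * (f * h)"
      using exchange[OF that x] xh by (simp add: ac_simps)
    moreover have "?x \<noteq> 0" by (simp add: mono2_def)
    ultimately show ?thesis by (simp only: mult_cancel_left) simp
  qed
  ultimately show ?thesis by blast
qed

end

section \<open>Endomorphism rings\<close>

locale sum_of_S = cyclic_quotient r a \<epsilon> for r a :: nat and \<epsilon> :: complex +
  fixes X :: "nat set" and d :: "nat \<Rightarrow> int"
  assumes finite_X: "finite X"
begin

abbreviation R where "R \<equiv> invariant_ring (cyclic_G a \<epsilon>)"

abbreviation T where "T \<equiv> finite_direct_sum X (\<lambda>p. S_mod a \<epsilon> (d p))"

lemma T_carrier: "carrier T = (\<Pi>\<^sub>E p\<in>X. S (d p))"
  by (simp add: finite_direct_sum_def carrier_S_mod)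

lemma T_simps: "zero T = (\<lambda>p\<in>X. 0)" "add T f g = (\<lambda>p\<in>X. f p + g p)" "smult T c f = (\<lambda>p\<in>X. c * f p)"
  by (simp_all add: finite_direct_sum_def S_mod_def)

text \<open>Elements of \<open>T\<close> are row vectors and matrices act from the right, so that "f
  followed by g" becomes the usual matrix product.\<close>

definition mat_endo :: "(nat \<Rightarrow> nat \<Rightarrow> complex poly poly) \<Rightarrow> (nat \<Rightarrow> complex poly poly) \<Rightarrow> nat \<Rightarrow> complex poly poly" where
  "mat_endo h = (\<lambda>x\<in>carrier T. \<lambda>q\<in>X. \<Sum>p\<in>X. x p * h p q)"

definition inj_at :: "nat \<Rightarrow> complex poly poly \<Rightarrow> nat \<Rightarrow> complex poly poly" where
  "inj_at p f = (\<lambda>q\<in>X. if q = p then f else 0)"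

lemma inj_at_carrier: "f \<in> S (d p) \<Longrightarrow> inj_at p f \<in> carrier T"
  by (auto simp: T_carrier inj_at_def S_zero)

lemma mat_endo_inj_at:
  assumes "p \<in> X" "q \<in> X" "f \<in> S (d p)"
  shows "mat_endo h (inj_at p f) q = f * h p q"
proof -
  have "(\<Sum>p'\<in>X. inj_at p f p' * h p' q) = (\<Sum>p'\<in>X. if p' = p then f * h p q else 0)"
    by (intro sum.cong) (auto simp: inj_at_def)
  then show ?thesis using assms finite_X by (simp add: mat_endo_def inj_at_carrier)
qed

lemma mat_endo_eval: "x \<in> carrier T \<Longrightarrow> q \<in> X \<Longrightarrow> mat_endo h x q = (\<Sum>p\<in>X. x p * h p q)"
  by (simp add: mat_endo_def)

lemma mat_endo_closed:
  assumes h: "\<And>p q. p \<in> X \<Longrightarrow> q \<in> X \<Longrightarrow> h p q \<in> S (d q - d p)" and x: "x \<in> carrier T"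
  shows "mat_endo h x \<in> carrier T"
proof -
  have "x p * h p q \<in> S (d q)" if "p \<in> X" "q \<in> X" for p q
    using S_mult[of "x p" "d p" "h p q" "d q - d p"] h[OF that] x that by (auto simp: T_carrier)
  then show ?thesis
    using x unfolding mat_endo_def by (auto simp: T_carrier intro!: S_sum)
qed

lemma T_add_closed: "x \<in> carrier T \<Longrightarrow> y \<in> carrier T \<Longrightarrow> x \<oplus>\<^bsub>T\<^esub> y \<in> carrier T"
  by (auto simp: T_carrier T_simps intro!: S_add)

lemma T_smult_closed: "c \<in> carrier R \<Longrightarrow> x \<in> carrier T \<Longrightarrow> c \<odot>\<^bsub>T\<^esub> x \<in> carrier T"
  using S_mult[of c 0] by (auto simp: T_carrier T_simps carrier_invariant_ring)

lemma T_ext: "x \<in> carrier T \<Longrightarrow> y \<in> carrier T \<Longrightarrow> (\<And>p. p \<in> X \<Longrightarrow> x p = y p) \<Longrightarrow> x = y"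
  unfolding T_carrier by (rule PiE_ext)

lemma mat_endo_in_module_endos:
  assumes h: "\<And>p q. p \<in> X \<Longrightarrow> q \<in> X \<Longrightarrow> h p q \<in> S (d q - d p)"
  shows "mat_endo h \<in> module_endos R T"
proof -
  have "mat_endo h \<in> carrier T \<rightarrow>\<^sub>E carrier T"
    using mat_endo_closed[OF h] by (auto simp: mat_endo_def)
  moreover have "mat_endo h (x \<oplus>\<^bsub>T\<^esub> y) = mat_endo h x \<oplus>\<^bsub>T\<^esub> mat_endo h y"
    if xy: "x \<in> carrier T" "y \<in> carrier T" for x y
  proof (rule T_ext)
    fix q assume "q \<in> X"
    then show "mat_endo h (x \<oplus>\<^bsub>T\<^esub> y) q = (mat_endo h x \<oplus>\<^bsub>T\<^esub> mat_endo h y) q"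
      using xy T_add_closed[OF xy]
      by (simp add: mat_endo_eval T_simps distrib_right sum.distrib)
  qed (use xy in \<open>auto intro!: mat_endo_closed[OF h] T_add_closed\<close>)
  moreover have "mat_endo h (c \<odot>\<^bsub>T\<^esub> x) = c \<odot>\<^bsub>T\<^esub> mat_endo h x"
    if cx: "c \<in> carrier R" "x \<in> carrier T" for c x
  proof (rule T_ext)
    fix q assume "q \<in> X"
    then show "mat_endo h (c \<odot>\<^bsub>T\<^esub> x) q = (c \<odot>\<^bsub>T\<^esub> mat_endo h x) q"
      using cx T_smult_closed[OF cx]
      by (simp add: mat_endo_eval T_simps sum_distrib_left mult.assoc)
  qed (use cx in \<open>auto intro!: mat_endo_closed[OF h] T_smult_closed\<close>)
  ultimately show ?thesis by (auto simp: module_endos_def)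
qed

text \<open>Between two summands \<phi> is a multiplication by \<open>S_hom_is_mult\<close>. An
  element of \<open>T\<close> is the sum of its finitely many components, so additivity, used for
  one index at a time, determines \<phi>.\<close>

theorem module_endos_mat_endo:
  assumes \<phi>: "\<phi> \<in> module_endos R T"
  shows "\<exists>h. (\<forall>p\<in>X. \<forall>q\<in>X. h p q \<in> S (d q - d p)) \<and> \<phi> = mat_endo h"
proof -
  have maps: "\<phi> \<in> carrier T \<rightarrow>\<^sub>E carrier T"
    and add: "\<And>x y. x \<in> carrier T \<Longrightarrow> y \<in> carrier T \<Longrightarrow> \<phi> (x \<oplus>\<^bsub>T\<^esub> y) = \<phi> x \<oplus>\<^bsub>T\<^esub> \<phi> y"
    and smult: "\<And>c x. c \<in> carrier R \<Longrightarrow> x \<in> carrier T \<Longrightarrow> \<phi> (c \<odot>\<^bsub>T\<^esub> x) = c \<odot>\<^bsub>T\<^esub> \<phi> x"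
    using \<phi> by (auto simp: module_endos_def)
  have "\<exists>h\<in>S (d q - d p). \<forall>f\<in>S (d p). \<phi> (inj_at p f) q = f * h" if pq: "p \<in> X" "q \<in> X" for p q
  proof (rule S_hom_is_mult)
    fix f assume f: "f \<in> S (d p)"
    then have "\<phi> (inj_at p f) \<in> carrier T" using maps inj_at_carrier by blast
    then show "\<phi> (inj_at p f) q \<in> S (d q)" using pq by (auto simp: T_carrier)
    fix g assume g: "g \<in> S 0"
    have "inj_at p (g * f) = g \<odot>\<^bsub>T\<^esub> inj_at p f"
      by (auto simp: T_simps inj_at_def fun_eq_iff)
    then show "\<phi> (inj_at p (g * f)) q = g * \<phi> (inj_at p f) q"
      using smult[of g "inj_at p f"] f g pq by (simp add: carrier_invariant_ring inj_at_carrier T_simps)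
  qed
  then obtain h where h: "\<And>p q. p \<in> X \<Longrightarrow> q \<in> X \<Longrightarrow> h p q \<in> S (d q - d p)"
    "\<And>p q f. p \<in> X \<Longrightarrow> q \<in> X \<Longrightarrow> f \<in> S (d p) \<Longrightarrow> \<phi> (inj_at p f) q = f * h p q"
    by metis
  have zero: "(\<lambda>p\<in>X. 0) \<in> carrier T" by (auto simp: T_carrier S_zero)
  have zero_eval: "\<phi> (\<lambda>p\<in>X. 0) q = 0" if q: "q \<in> X" for q
  proof -
    define z where "z = (\<lambda>p\<in>X. 0 :: complex poly poly)"
    have "z \<oplus>\<^bsub>T\<^esub> z = z" by (auto simp: T_simps z_def)
    then have "\<phi> z q = (\<phi> z \<oplus>\<^bsub>T\<^esub> \<phi> z) q" using add[OF zero zero] by (simp add: z_def)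
    then have "\<phi> z q = \<phi> z q + \<phi> z q" using q by (simp add: T_simps)
    then show ?thesis by (simp add: z_def)
  qed
  have "\<phi> x q = mat_endo h x q" if x: "x \<in> carrier T" and q: "q \<in> X" for x q
  proof -
    have xS: "x p \<in> S (d p)" if "p \<in> X" for p using x that by (auto simp: T_carrier)
    have "\<phi> (\<lambda>p\<in>X. if p \<in> A then x p else 0) q = (\<Sum>p\<in>A. x p * h p q)" if "finite A" "A \<subseteq> X" for A
      using that
    proof (induction A rule: finite_induct)
      case empty
      show ?case unfolding empty_iff if_False sum.empty by (rule zero_eval[OF q])
    next
      case (insert p A)
      let ?y = "\<lambda>p\<in>X. if p \<in> A then x p else 0"
      have y: "?y \<in> carrier T" using xS by (auto simp: T_carrier S_zero)
      have p: "inj_at p (x p) \<in> carrier T" using insert xS by (intro inj_at_carrier) auto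
      have split: "(\<lambda>p'\<in>X. if p' \<in> insert p A then x p' else 0) = inj_at p (x p) \<oplus>\<^bsub>T\<^esub> ?y"
        using insert by (auto simp: T_simps inj_at_def fun_eq_iff)
      have "\<phi> (inj_at p (x p) \<oplus>\<^bsub>T\<^esub> ?y) q = \<phi> (inj_at p (x p)) q + \<phi> ?y q"
        unfolding add[OF p y] using q by (simp add: T_simps)
      also have "\<dots> = x p * h p q + (\<Sum>p\<in>A. x p * h p q)"
      proof -
        have "p \<in> X" "\<phi> ?y q = (\<Sum>p\<in>A. x p * h p q)" using insert by blast+
        then show ?thesis using h(2)[OF _ q xS] by (simp only:)
      qed
      finally show ?case unfolding split using insert by simp
    qed
    from this[OF finite_X order.refl]
    have "\<phi> (\<lambda>p\<in>X. if p \<in> X then x p else 0) q = (\<Sum>p\<in>X. x p * h p q)" .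
    moreover have "(\<lambda>p\<in>X. if p \<in> X then x p else 0) = x"
      using x by (auto simp: T_carrier fun_eq_iff PiE_def extensional_def)
    ultimately show ?thesis unfolding mat_endo_eval[OF x q] by (simp only:)
  qed
  then have "\<phi> x = mat_endo h x" if "x \<in> carrier T" for x
    using that maps mat_endo_closed[OF h(1)] by (intro T_ext) auto
  then have "\<phi> = mat_endo h"
    using maps by (intro extensionalityI[of _ "carrier T"]) (auto simp: mat_endo_def PiE_def)
  then show ?thesis using h(1) by blast
qed

lemma End_ring_simps:
  "carrier (End_ring R T) = module_endos R T"
  "mult (End_ring R T) f g = compose (carrier T) g f"
  "one (End_ring R T) = (\<lambda>x\<in>carrier T. x)"
  "zero (End_ring R T) = (\<lambda>x\<in>carrier T. \<lambda>p\<in>X. 0)"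
  "add (End_ring R T) f g = (\<lambda>x\<in>carrier T. \<lambda>p\<in>X. f x p + g x p)"
  by (simp_all add: End_ring_def T_simps)

lemma mat_endo_add:
  "mat_endo (\<lambda>p q. g p q + h p q) = mat_endo g \<oplus>\<^bsub>End_ring R T\<^esub> mat_endo h"
  by (auto simp: End_ring_simps mat_endo_def fun_eq_iff distrib_left sum.distrib)

lemma mat_endo_mult:
  assumes g: "\<And>p q. p \<in> X \<Longrightarrow> q \<in> X \<Longrightarrow> g p q \<in> S (d q - d p)"
  shows "mat_endo (\<lambda>p q. \<Sum>s\<in>X. g p s * h s q) = mat_endo g \<otimes>\<^bsub>End_ring R T\<^esub> mat_endo h"
proof -
  have "mat_endo (\<lambda>p q. \<Sum>s\<in>X. g p s * h s q) x = mat_endo h (mat_endo g x)" if x: "x \<in> carrier T" for x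
  proof -
    have "(\<Sum>p\<in>X. x p * (\<Sum>s\<in>X. g p s * h s q)) = (\<Sum>s\<in>X. (\<Sum>p\<in>X. x p * g p s) * h s q)" for q
      unfolding sum_distrib_left sum_distrib_right by (subst sum.swap) (simp add: mult.assoc)
    moreover have "mat_endo g x \<in> carrier T" using mat_endo_closed[OF g x] .
    ultimately show ?thesis
      using x by (auto simp: mat_endo_def fun_eq_iff)
  qed
  then show ?thesis
    by (auto simp: End_ring_simps compose_def fun_eq_iff) (simp add: mat_endo_def)
qed

lemma mat_endo_one: "mat_endo (\<lambda>p q. if p = q then 1 else 0) = \<one>\<^bsub>End_ring R T\<^esub>"
proof -
  have "(\<lambda>q\<in>X. \<Sum>p\<in>X. x p * (if p = q then 1 else 0)) = x" if "x \<in> carrier T" for x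
    using that finite_X
    by (auto simp: fun_eq_iff T_carrier PiE_def extensional_def if_distrib[of "(*) _"] cong: if_cong)
  then show ?thesis by (auto simp: End_ring_simps mat_endo_def fun_eq_iff)
qed

text \<open>Every summand contains a nonzero power of x, and multiplication by it is injective on
  polynomials, so an endomorphism determines its matrix.\<close>

lemma mat_endo_zero_iff:
  "mat_endo h = \<zero>\<^bsub>End_ring R T\<^esub> \<longleftrightarrow> (\<forall>p\<in>X. \<forall>q\<in>X. h p q = 0)"
proof
  assume eq: "mat_endo h = \<zero>\<^bsub>End_ring R T\<^esub>"
  show "\<forall>p\<in>X. \<forall>q\<in>X. h p q = 0"
  proof (intro ballI)
    fix p q assume pq: "p \<in> X" "q \<in> X"
    let ?f = "mono2 1 (nat (d p mod int r)) 0"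
    have f: "?f \<in> S (d p)" by (rule x_power_in_S)
    then have "?f * h p q = 0"
      using mat_endo_inj_at[OF pq f, of h] eq pq by (simp add: End_ring_simps inj_at_carrier)
    then show "h p q = 0" by (simp add: mono2_def)
  qed
qed (auto simp: End_ring_simps mat_endo_def fun_eq_iff)

lemma mat_endo_cong: "(\<And>p q. p \<in> X \<Longrightarrow> q \<in> X \<Longrightarrow> g p q = h p q) \<Longrightarrow> mat_endo g = mat_endo h"
  unfolding mat_endo_def by (intro restrict_ext sum.cong arg_cong2[where f = "(*)"]) auto

end

section \<open>The isomorphism\<close>

locale reconstruction = hj_fraction r a \<alpha> + sum_of_S r a \<epsilon> "{1..length \<alpha> + 1}" "i_series r a \<alpha>"
  for r a :: nat and \<alpha> :: "nat list" and \<epsilon> :: complex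
begin

abbreviation "PA \<equiv> path_algebra RQ"

abbreviation "X \<equiv> {1..n + 1}"

text \<open>Summand \<open>n + 1\<close> of \<open>T\<close> belongs to vertex \<open>0\<close>.\<close>

definition vx :: "nat \<Rightarrow> nat" where "vx p = (if p = n + 1 then 0 else p)"

lemma vx_bij: "bij_betw vx X {0..n}"
  by (intro bij_betw_byWitness[of _ "\<lambda>v. if v = 0 then n + 1 else v"]) (auto simp: vx_def)

lemma vx_le: "p \<in> X \<Longrightarrow> vx p \<le> n"
  by (auto simp: vx_def)

lemma vI_vx: "p \<in> X \<Longrightarrow> vI (vx p) = I p"
  using I_Suc_n by (auto simp: vI_def vx_def)

section \<open>The polynomial matrix of an element of the path algebra\<close>

definition path_mono :: "(nat, arrow) path \<Rightarrow> complex \<Rightarrow> complex poly poly" where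
  "path_mono \<pi> c = mono2 c (rwxs (fst (snd \<pi>))) (rwys (fst (snd \<pi>)))"

definition path_entry :: "nat \<Rightarrow> nat \<Rightarrow> (nat, arrow) path \<Rightarrow> complex \<Rightarrow> complex poly poly" where
  "path_entry u v \<pi> c = (if fst \<pi> = u \<and> snd (snd \<pi>) = v then path_mono \<pi> c else 0)"

definition entry :: "((nat, arrow) path \<Rightarrow>\<^sub>0 complex) \<Rightarrow> nat \<Rightarrow> nat \<Rightarrow> complex poly poly" where
  "entry f u v = (\<Sum>\<pi>\<in>Poly_Mapping.keys f. path_entry u v \<pi> (Poly_Mapping.lookup f \<pi>))"

lemma path_entry_0 [simp]: "path_entry u v \<pi> 0 = 0"
  by (simp add: path_entry_def path_mono_def)

lemma path_entry_add: "path_entry u v \<pi> (c + d) = path_entry u v \<pi> c + path_entry u v \<pi> d"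
  by (simp add: path_entry_def path_mono_def mono2_add)

lemma entry_superset:
  assumes "finite A" "Poly_Mapping.keys f \<subseteq> A"
  shows "entry f u v = (\<Sum>\<pi>\<in>A. path_entry u v \<pi> (Poly_Mapping.lookup f \<pi>))"
  unfolding entry_def using assms by (intro sum.mono_neutral_left) (auto simp: in_keys_iff)

lemma entry_0 [simp]: "entry 0 u v = 0"
  by (simp add: entry_def)

lemma entry_single [simp]: "entry (Poly_Mapping.single \<pi> c) u v = path_entry u v \<pi> c"
  by (simp add: entry_superset[of "{\<pi>}"])

lemma entry_add: "entry (f + g) u v = entry f u v + entry g u v"
proof -
  let ?A = "Poly_Mapping.keys f \<union> Poly_Mapping.keys g"
  have "Poly_Mapping.keys (f + g) \<subseteq> ?A" by (rule keys_add)
  then show ?thesis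
    by (simp add: entry_superset[of ?A] lookup_add path_entry_add sum.distrib)
qed

lemma entry_sum: "entry (\<Sum>x\<in>A. f x) u v = (\<Sum>x\<in>A. entry (f x) u v)"
  by (induction A rule: infinite_finite_induct) (simp_all add: entry_add)

lemma entry_diff: "entry (f - g) u v = entry f u v - entry g u v"
  using entry_add[of "f - g" g u v] by simp

text \<open>Composable paths meet in one vertex and their exponents add, which is the rule for
  matrix units times monomials. That \<open>f\<close> consists of walks puts the meeting vertex into
  the range of summation.\<close>

lemma entry_path_mult:
  assumes f: "Poly_Mapping.keys f \<subseteq> paths RQ"
  shows "entry (path_mult f g) u w = (\<Sum>v\<in>{0..n}. entry f u v * entry g v w)"
  using f
proof (induction f rule: poly_mapping_span_induct)
  case (single \<pi> c)
  show ?case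
  proof (induction g rule: poly_mapping_induct)
    case (single \<sigma> d)
    obtain u0 p v0 where \<pi>: "\<pi> = (u0, p, v0)" by (cases \<pi>)
    obtain v1 q w0 where \<sigma>: "\<sigma> = (v1, q, w0)" by (cases \<sigma>)
    have v0: "v0 \<in> {0..n}"
      using \<open>\<pi> \<in> paths RQ\<close> RQ.awalk_last_in_verts[of u0 p v0] by (simp add: \<pi> paths_def)
    have "(\<Sum>v\<in>{0..n}. path_entry u v \<pi> c * path_entry v w \<sigma> d) =
      (\<Sum>v\<in>{0..n}. if v = v0 then path_entry u v0 \<pi> c * path_entry v0 w \<sigma> d else 0)"
      by (intro sum.cong) (auto simp: path_entry_def \<pi>)
    also have "\<dots> = path_entry u v0 \<pi> c * path_entry v0 w \<sigma> d"
      using v0 by (simp add: sum.delta)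
    finally show ?case
      by (auto simp: path_mult_single path_term_def path_entry_def path_mono_def mono2_mult \<pi> \<sigma>)
  qed (simp_all add: path_mult_add_right entry_add distrib_left sum.distrib)
qed (simp_all add: path_mult_add_left entry_add distrib_right sum.distrib)

lemma entry_one: "entry \<one>\<^bsub>PA\<^esub> u v = (if u = v \<and> u \<le> n then 1 else 0)"
proof -
  have "entry \<one>\<^bsub>PA\<^esub> u v = (\<Sum>w\<in>{0..n}. if w = u then (if u = v then 1 else 0) else 0)"
    unfolding RQ.path_algebra_simps entry_sum
    by (intro sum.cong) (auto simp: path_entry_def path_mono_def mono2_1)
  then show ?thesis by simp
qed

lemma lat_iff_S: "lat (int i + vI u - vI v) (int j) \<longleftrightarrow> int r dvd int i + int a * int j - (vI v - vI u)"
  by (simp add: lat_def algebra_simps)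

lemma entry_in_S:
  assumes "Poly_Mapping.keys f \<subseteq> paths RQ"
  shows "entry f u v \<in> S (vI v - vI u)"
  unfolding entry_def
proof (rule S_sum)
  fix \<pi> assume "\<pi> \<in> Poly_Mapping.keys f"
  then have "RQ.awalk (fst \<pi>) (fst (snd \<pi>)) (snd (snd \<pi>))" using assms by (auto simp: paths_def)
  from TP.walk_lat[OF this] show "path_entry u v \<pi> (Poly_Mapping.lookup f \<pi>) \<in> S (vI v - vI u)"
    by (auto simp: path_entry_def path_mono_def S_zero lat_iff_S intro!: S_mono2)
qed

lemma entry_surj:
  assumes u: "u \<le> n" and v: "v \<le> n" and g: "g \<in> S (vI v - vI u)"
  shows "\<exists>f \<in> carrier PA. \<forall>u' v'. entry f u' v' = (if u' = u \<and> v' = v then g else 0)"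
proof -
  \<comment> \<open>Where the coefficient is 0 no walk need exist and \<open>W i j\<close> is
    arbitrary, but the corresponding term of \<open>f\<close> is then 0.\<close>
  define W where "W i j = (SOME p. RQ.awalk u p v \<and> rwxs p = i \<and> rwys p = j)" for i j
  have W: "RQ.awalk u (W i j) v \<and> rwxs (W i j) = i \<and> rwys (W i j) = j" if "coeff2 g i j \<noteq> 0" for i j
    unfolding W_def
  proof (rule someI_ex, rule TP.walk_exists[OF u v])
    show "lat (int i + vI u - vI v) (int j)" using that g by (simp add: S_def lat_iff_S)
  qed
  let ?t = "\<lambda>i j. Poly_Mapping.single (u, W i j, v) (coeff2 g i j)"
  define f where "f = (\<Sum>j\<le>degree g. \<Sum>i\<le>degree (poly.coeff g j). ?t i j)"
  have "Poly_Mapping.keys (?t i j) \<subseteq> paths RQ" for i j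
    using W[where i = i and j = j] by (cases "coeff2 g i j = 0") (simp_all add: paths_def)
  then have "f \<in> carrier PA"
    unfolding f_def RQ.path_algebra_simps
    by (intro CollectI order.trans[OF keys_sum] UN_least)
  moreover have "entry f u' v' = (if u' = u \<and> v' = v then g else 0)" for u' v'
  proof -
    have "entry (?t i j) u' v' = (if u' = u \<and> v' = v then mono2 (coeff2 g i j) i j else 0)" for i j
      using W[where i = i and j = j]
      by (cases "coeff2 g i j = 0") (simp_all add: path_entry_def path_mono_def)
    then show ?thesis
      unfolding f_def entry_sum using mono2_expansion[of g] by (cases "u' = u \<and> v' = v") (simp, auto)
  qed
  ultimately show ?thesis by blast
qed

section \<open>The homomorphism to the endomorphism ring, its image and its kernel\<close>

definition Phi :: "((nat, arrow) path \<Rightarrow>\<^sub>0 complex) \<Rightarrow> (nat \<Rightarrow> complex poly poly) \<Rightarrow> nat \<Rightarrow> complex poly poly" where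
  "Phi f = mat_endo (\<lambda>p q. entry f (vx p) (vx q))"

lemma entry_vx_in_S:
  assumes "f \<in> carrier PA" "p \<in> X" "q \<in> X"
  shows "entry f (vx p) (vx q) \<in> S (I q - I p)"
  using entry_in_S[of f "vx p" "vx q"] assms vI_vx by simp

lemma Phi_hom: "Phi \<in> ring_hom PA (End_ring R T)"
proof (rule ring_hom_memI)
  fix f assume f: "f \<in> carrier PA"
  show "Phi f \<in> carrier (End_ring R T)"
    unfolding Phi_def End_ring_simps by (intro mat_endo_in_module_endos entry_vx_in_S[OF f])
  fix g assume g: "g \<in> carrier PA"
  show "Phi (f \<oplus>\<^bsub>PA\<^esub> g) = Phi f \<oplus>\<^bsub>End_ring R T\<^esub> Phi g"
    unfolding Phi_def RQ.path_algebra_simps entry_add by (rule mat_endo_add)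
  have "(\<Sum>v\<in>{0..n}. entry f (vx p) v * entry g v (vx q)) =
    (\<Sum>s\<in>X. entry f (vx p) (vx s) * entry g (vx s) (vx q))" for p q
    by (rule sum.reindex_bij_betw[OF vx_bij, symmetric])
  then have "Phi (f \<otimes>\<^bsub>PA\<^esub> g) =
    mat_endo (\<lambda>p q. \<Sum>s\<in>X. entry f (vx p) (vx s) * entry g (vx s) (vx q))"
    unfolding Phi_def
    by (intro mat_endo_cong) (use f in \<open>simp only: RQ.path_algebra_simps mem_Collect_eq entry_path_mult\<close>)
  then show "Phi (f \<otimes>\<^bsub>PA\<^esub> g) = Phi f \<otimes>\<^bsub>End_ring R T\<^esub> Phi g"
    unfolding Phi_def using mat_endo_mult[OF entry_vx_in_S[OF f]] by (simp only:)
next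
  have "vx p = vx q \<longleftrightarrow> p = q" if "p \<in> X" "q \<in> X" for p q
    using that bij_betw_imp_inj_on[OF vx_bij] by (auto dest: inj_onD)
  then have "Phi \<one>\<^bsub>PA\<^esub> = mat_endo (\<lambda>p q. if p = q then 1 else 0)"
    unfolding Phi_def entry_one using vx_le by (intro mat_endo_cong) (simp only: if_True simp_thms)
  then show "Phi \<one>\<^bsub>PA\<^esub> = \<one>\<^bsub>End_ring R T\<^esub>" by (simp only: mat_endo_one)
qed

lemma Phi_surj: "Phi ` carrier PA = carrier (End_ring R T)"
proof (intro equalityI subsetI)
  fix \<phi> assume "\<phi> \<in> carrier (End_ring R T)"
  then obtain h where h: "\<And>p q. p \<in> X \<Longrightarrow> q \<in> X \<Longrightarrow> h p q \<in> S (I q - I p)" "\<phi> = mat_endo h"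
    using module_endos_mat_endo unfolding End_ring_simps by blast
  have "\<exists>f. p \<in> X \<longrightarrow> q \<in> X \<longrightarrow> f \<in> carrier PA \<and>
      (\<forall>u v. entry f u v = (if u = vx p \<and> v = vx q then h p q else 0))" for p q
    using entry_surj[of "vx p" "vx q" "h p q"] h(1)[of p q] vI_vx vx_le by metis
  then obtain F where F: "\<And>p q. p \<in> X \<Longrightarrow> q \<in> X \<Longrightarrow> F p q \<in> carrier PA"
    "\<And>p q u v. p \<in> X \<Longrightarrow> q \<in> X \<Longrightarrow> entry (F p q) u v = (if u = vx p \<and> v = vx q then h p q else 0)"
    by metis
  define f where "f = (\<Sum>p\<in>X. \<Sum>q\<in>X. F p q)"
  have "f \<in> carrier PA"
    using F(1) unfolding f_def RQ.path_algebra_simps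
    by (intro CollectI order.trans[OF keys_sum] UN_least) blast
  moreover have "entry f (vx p) (vx q) = h p q" if p: "p \<in> X" and q: "q \<in> X" for p q
  proof -
    have inj: "vx s = vx t \<longleftrightarrow> s = t" if "s \<in> X" "t \<in> X" for s t
      using that bij_betw_imp_inj_on[OF vx_bij] by (auto dest: inj_onD)
    have "entry f (vx p) (vx q) = (\<Sum>p'\<in>X. \<Sum>q'\<in>X. if q' = q then (if p' = p then h p q else 0) else 0)"
      unfolding f_def entry_sum using p q by (intro sum.cong refl) (auto simp: F(2) inj)
    also have "\<dots> = (\<Sum>p'\<in>X. if p' = p then h p q else 0)"
      using q by (intro sum.cong refl) (simp add: sum.delta del: sum.cl_ivl_Suc)
    also have "\<dots> = h p q" using p by (simp add: sum.delta del: sum.cl_ivl_Suc)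
    finally show ?thesis .
  qed
  then have "Phi f = \<phi>" unfolding Phi_def h(2) by (intro mat_endo_cong) auto
  ultimately show "\<phi> \<in> Phi ` carrier PA" by blast
qed (use ring_hom_closed[OF Phi_hom] in blast)

lemma Phi_zero_iff:
  assumes "f \<in> carrier PA"
  shows "Phi f = \<zero>\<^bsub>End_ring R T\<^esub> \<longleftrightarrow> (\<forall>u\<le>n. \<forall>v\<le>n. entry f u v = 0)"
proof -
  have "(\<forall>u\<le>n. \<forall>v\<le>n. entry f u v = 0) \<longleftrightarrow> (\<forall>u\<in>{0..n}. \<forall>v\<in>{0..n}. entry f u v = 0)"
    by auto
  also have "{0..n} = vx ` X" using vx_bij by (rule bij_betw_imp_surj_on[symmetric])
  finally show ?thesis unfolding Phi_def mat_endo_zero_iff ball_simps ..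
qed

lemma Phi_relators:
  assumes "g \<in> RR.relators"
  shows "Phi g = \<zero>\<^bsub>End_ring R T\<^esub>"
proof -
  obtain p q where pq: "(p, q) \<in> recon_relations \<alpha>" and g: "g = path_elem RQ p - path_elem RQ q"
    using assms by (auto simp: RR.relators_def)
  obtain u v where w: "RQ.awalk u p v" "RQ.awalk u q v" "p \<noteq> []" "q \<noteq> []"
    using RR.rels_walks[OF pq] by blast
  have "g = Poly_Mapping.single (u, p, v) 1 - Poly_Mapping.single (u, q, v) 1"
    unfolding g using RR.path_elem_walk w by simp
  then have "entry g u' v' = 0" for u' v'
    using relation_weights[OF pq] by (simp add: entry_diff path_entry_def path_mono_def)
  then show ?thesis
    using Phi_zero_iff[of g] RR.relators_closed assms by blast
qed

lemma coeff2_entry: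
  "coeff2 (entry f u v) i j = (\<Sum>\<pi>\<in>Poly_Mapping.keys f.
    if fst \<pi> = u \<and> snd (snd \<pi>) = v \<and> rwxs (fst (snd \<pi>)) = i \<and> rwys (fst (snd \<pi>)) = j
    then Poly_Mapping.lookup f \<pi> else 0)"
  unfolding entry_def coeff_sum
  by (intro sum.cong) (auto simp: path_entry_def path_mono_def coeff2_mono2)

text \<open>Each path is replaced by a representative depending only on its ends and its monomial;
  by \<open>walk_unique\<close> this changes nothing modulo the relations. The coefficients
  collected at one representative add up to a coefficient of a matrix entry, which is 0.\<close>

lemma Phi_kernel:
  assumes f: "f \<in> carrier PA" and zero: "Phi f = \<zero>\<^bsub>End_ring R T\<^esub>"
  shows "f \<in> RR.relation_ideal"
proof -
  define W where "W u v i j = (SOME p. RQ.awalk u p v \<and> rwxs p = i \<and> rwys p = j)" for u v i j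
  define \<rho> where "\<rho> \<pi> = (case \<pi> of (u, p, v) \<Rightarrow> (u, W u v (rwxs p) (rwys p), v))" for \<pi> :: "(nat, arrow) path"
  have W: "RQ.awalk u (W u v (rwxs p) (rwys p)) v \<and> rwxs (W u v (rwxs p) (rwys p)) = rwxs p \<and>
      rwys (W u v (rwxs p) (rwys p)) = rwys p" if "RQ.awalk u p v" for u p v
    unfolding W_def by (rule someI[of _ p]) (use that in simp)
  have keys: "RQ.awalk u p v" if "(u, p, v) \<in> Poly_Mapping.keys f" for u p v
    using that f by (auto simp: paths_def)
  show ?thesis
  proof (rule RR.in_relation_ideal[OF f])
    fix \<pi> assume \<pi>: "\<pi> \<in> Poly_Mapping.keys f"
    obtain u p v where upv: "\<pi> = (u, p, v)" by (cases \<pi>)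
    then have w: "RQ.awalk u p v" using keys \<pi> by simp
    show "RR.path_eqv \<pi> (\<rho> \<pi>)"
      unfolding upv \<rho>_def prod.case using W[OF w] by (intro TP.walk_unique w) auto
  next
    show "(\<Sum>\<pi>\<in>Poly_Mapping.keys f. Poly_Mapping.single (\<rho> \<pi>) (Poly_Mapping.lookup f \<pi>)) = 0"
    proof (rule poly_mapping_eqI)
      fix \<sigma> :: "(nat, arrow) path"
      have sum: "Poly_Mapping.lookup (\<Sum>\<pi>\<in>Poly_Mapping.keys f. Poly_Mapping.single (\<rho> \<pi>) (Poly_Mapping.lookup f \<pi>)) \<sigma>
        = (\<Sum>\<pi>\<in>Poly_Mapping.keys f. if \<rho> \<pi> = \<sigma> then Poly_Mapping.lookup f \<pi> else 0)"
        by (simp add: lookup_sum lookup_single when_def)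
      have "(\<Sum>\<pi>\<in>Poly_Mapping.keys f. if \<rho> \<pi> = \<sigma> then Poly_Mapping.lookup f \<pi> else 0) = 0"
      proof (cases "\<exists>\<pi>\<in>Poly_Mapping.keys f. \<rho> \<pi> = \<sigma>")
        case True
        then obtain u p v where p: "(u, p, v) \<in> Poly_Mapping.keys f" and \<sigma>: "\<sigma> = \<rho> (u, p, v)"
          by (metis prod_cases3)
        have w: "RQ.awalk u p v" using keys[OF p] .
        \<comment> \<open>A representative has the same ends and monomial as its path, so equality
          of representatives is equality of these data.\<close>
        have "\<rho> \<pi> = \<sigma> \<longleftrightarrow> fst \<pi> = u \<and> snd (snd \<pi>) = v \<and> rwxs (fst (snd \<pi>)) = rwxs p \<and> rwys (fst (snd \<pi>)) = rwys p"
          if "\<pi> \<in> Poly_Mapping.keys f" for \<pi>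
        proof -
          obtain u' p' v' where \<pi>: "\<pi> = (u', p', v')" by (cases \<pi>)
          have w': "RQ.awalk u' p' v'" using keys that \<pi> by simp
          show ?thesis
            using W[OF w] W[OF w'] unfolding \<pi> \<sigma> \<rho>_def prod.case fst_conv snd_conv prod.inject
            by metis
        qed
        then have "(\<Sum>\<pi>\<in>Poly_Mapping.keys f. if \<rho> \<pi> = \<sigma> then Poly_Mapping.lookup f \<pi> else 0) =
          coeff2 (entry f u v) (rwxs p) (rwys p)"
          unfolding coeff2_entry by (intro sum.cong) auto
        moreover have "u \<le> n" "v \<le> n"
          using RQ.awalk_hd_in_verts[OF w] RQ.awalk_last_in_verts[OF w] by simp_all
        ultimately show ?thesis using zero Phi_zero_iff[OF f] by simp
      next
        case False
        then show ?thesis by (intro sum.neutral) auto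
      qed
      then show "Poly_Mapping.lookup (\<Sum>\<pi>\<in>Poly_Mapping.keys f. Poly_Mapping.single (\<rho> \<pi>) (Poly_Mapping.lookup f \<pi>)) \<sigma>
        = Poly_Mapping.lookup 0 \<sigma>"
        using sum by simp
    qed
  qed
qed

theorem reconstruction_iso: "reconstruction_algebra \<alpha> \<simeq> End_ring R T"
proof -
  have zero: "Phi \<zero>\<^bsub>PA\<^esub> = \<zero>\<^bsub>End_ring R T\<^esub>"
    using Phi_zero_iff[OF RQ.PA.zero_closed] by simp
  have "PA Quot genideal PA RR.relators \<simeq> End_ring R T"
  proof (rule RQ.PA.genideal_quotient_iso[OF RR.relators_closed Phi_hom Phi_surj zero Phi_relators])
    fix f assume "f \<in> carrier PA" "Phi f = \<zero>\<^bsub>End_ring R T\<^esub>"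
    then show "f \<in> genideal PA RR.relators"
      using Phi_kernel unfolding RR.relation_ideal_def by blast
  qed
  then show ?thesis
    by (simp add: reconstruction_algebra_def path_algebra_mod_relations_def RR.relators_def)
qed

end

theorem theorem3p24:
  fixes r a :: nat and \<alpha> :: "nat list" and \<epsilon> :: complex
  assumes "1 \<le> a" and "a < r" and "coprime r a"
    and "primitive_root_of_unity r \<epsilon>"
    and "jung_hirzebruch r a \<alpha>"
  shows "reconstruction_algebra \<alpha> \<simeq>
    End_ring (invariant_ring (cyclic_G a \<epsilon>)) (T_mod r a \<epsilon> \<alpha>)"
proof -
  interpret reconstruction r a \<alpha> \<epsilon>
    using assms by unfold_locales auto
  show ?thesis
    unfolding T_mod_def by (rule reconstruction_iso)
qed

end
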